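(* For every $m\in\mathbb N$, $$\sup_{\substack{0<\epsilon<1\\ 0\le\alpha\le2}}\ \ \sup_{\|\phi-\mathbf e_m\|_{H^1}\le\epsilon}\ \ \sup_{t\in\mathbb R}\ \|S_{\alpha,\epsilon}(t)\phi\|_{H^1}<\infty,$$ where the middle supremum is over $\phi\in H^1_+$ with $\|\phi-\mathbf e_m\|_{H^1}\le\epsilon$.
   Context: $\mathbb N=\{0,1,2,\dots\}$, $\mathbb S^1=\mathbb R/2\pi\mathbb Z$, $\mathbf e_m(x)=e^{imx}$. $\Pi$ is the Szegő projector $\Pi(\sum_{k\in\mathbb Z}u_ke^{ikx})=\sum_{k\ge0}u_ke^{ikx}$ on $L^2(\mathbb S^1)$; $L^2_+=\Pi(L^2(\mathbb S^1))$, $H^s_+=H^s(\mathbb S^1)\cap L^2_+$, with $\|u\|_{H^s}^2=\sum_k(1+k^2)^s|u_k|^2$. $S_{\alpha,\epsilon}$ denotes the nonlinear evolution group on $H^{1/2}_+$ of the equation $i\partial_tu+\epsilon^\alpha\partial_x^2u=\Pi(|u|^2u)$: for $\phi\in H^{1/2}_+$, $t\mapsto S_{\alpha,\epsilon}(t)\phi$ is the unique global solution $u\in C(\mathbb R,H^{1/2}_+)$ with $u(0)=\phi$ (it lies in $C(\mathbb R,H^s_+)$ when $\phi\in H^s_+$, $s\ge\frac12$). *)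

theory Defs
  imports "HOL-Analysis.Analysis"
begin

text \<open>
  Functions on the circle \<open>\<real> / 2\<pi>\<int>\<close> are represented by \<open>2\<pi>\<close>-periodic functions on the real
  line. Elements of \<open>L\<^sup>2\<close> are not quotiented by equality almost everywhere; everything below
  depends only on the class of a function, and equality in \<open>L\<^sup>2\<close> is written with \<open>AE\<close>.
\<close>

definition L2_circle :: "(real \<Rightarrow> complex) set" where
  "L2_circle = {f. f \<in> borel_measurable lborel \<and> (\<forall>x. f (x + 2 * pi) = f x) \<and>
     set_integrable lborel {0..2 * pi} (\<lambda>x. (cmod (f x))\<^sup>2)}"

definition fourier_mode :: "int \<Rightarrow> real \<Rightarrow> complex" where
  "fourier_mode k x = exp (\<i> * of_int k * of_real x)"

text \<open>The normalisation is the one for which \<open>f = (\<Sum>k. fourier_coeff f k * fourier_mode k)\<close>.\<close>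

definition fourier_coeff :: "(real \<Rightarrow> complex) \<Rightarrow> int \<Rightarrow> complex" where
  "fourier_coeff f k =
     (1 / (2 * of_real pi)) * (LINT x:{0..2 * pi}|lborel. f x * cnj (fourier_mode k x))"

definition L2_plus :: "(real \<Rightarrow> complex) set" where
  "L2_plus = {f \<in> L2_circle. \<forall>k<0. fourier_coeff f k = 0}"

text \<open>
  The Szego projector. A function with the prescribed Fourier coefficients exists and is
  unique up to null sets when \<open>f\<close> is in \<open>L\<^sup>2\<close>.
\<close>

definition szego_proj :: "(real \<Rightarrow> complex) \<Rightarrow> real \<Rightarrow> complex" where
  "szego_proj f = (SOME g. g \<in> L2_circle \<and>
     (\<forall>k. fourier_coeff g k = (if 0 \<le> k then fourier_coeff f k else 0)))"

text \<open>Only for regularity \<open>s \<ge> 0\<close>, where \<open>H\<^sup>s\<close> consists of functions in \<open>L\<^sup>2\<close>.\<close>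

definition sobolev :: "real \<Rightarrow> (real \<Rightarrow> complex) set" where
  "sobolev s = {f \<in> L2_circle.
     (\<lambda>k::int. (1 + (real_of_int k)\<^sup>2) powr s * (cmod (fourier_coeff f k))\<^sup>2) summable_on UNIV}"

definition sobolev_plus :: "real \<Rightarrow> (real \<Rightarrow> complex) set" where
  "sobolev_plus s = sobolev s \<inter> L2_plus"

definition sobolev_norm :: "real \<Rightarrow> (real \<Rightarrow> complex) \<Rightarrow> ennreal" where
  "sobolev_norm s f =
     (if f \<in> sobolev s
      then ennreal (sqrt (\<Sum>\<^sub>\<infinity>k::int.
             (1 + (real_of_int k)\<^sup>2) powr s * (cmod (fourier_coeff f k))\<^sup>2))
      else \<infinity>)"

definition continuous_in_sobolev_plus :: "real \<Rightarrow> (real \<Rightarrow> real \<Rightarrow> complex) \<Rightarrow> bool" where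
  "continuous_in_sobolev_plus s u \<longleftrightarrow>
     (\<forall>t. u t \<in> sobolev_plus s) \<and>
     (\<forall>t. ((\<lambda>r. sobolev_norm s (\<lambda>x. u r x - u t x)) \<longlongrightarrow> 0) (at t))"

text \<open>
  Global solutions \<open>u \<in> C(\<real>, H\<^sup>1\<^sup>/\<^sup>2\<^sub>+)\<close> of
  \<open>\<i> \<partial>\<^sub>t u + \<epsilon>\<^sup>\<alpha> \<partial>\<^sub>x\<^sup>2 u = \<Pi>(|u|\<^sup>2 u)\<close> with \<open>u(0) = \<phi>\<close>. Since \<open>u(t)\<close> is in general not
  differentiable, the equation is read in the sense of distributions on the circle, i.e.
  as equality of all Fourier coefficients; \<open>(\<i> k)\<^sup>2\<close> is the symbol of \<open>\<partial>\<^sub>x\<^sup>2\<close>. The cubic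
  term is in \<open>L\<^sup>2\<close> because \<open>H\<^sup>1\<^sup>/\<^sup>2\<close> embeds into \<open>L\<^sup>6\<close>.
\<close>

definition is_nls_szego_solution ::
  "real \<Rightarrow> real \<Rightarrow> (real \<Rightarrow> complex) \<Rightarrow> (real \<Rightarrow> real \<Rightarrow> complex) \<Rightarrow> bool" where
  "is_nls_szego_solution \<alpha> \<epsilon> \<phi> u \<longleftrightarrow>
     continuous_in_sobolev_plus (1/2) u \<and>
     (AE x in lborel. u 0 x = \<phi> x) \<and>
     (\<forall>k t. \<exists>d. ((\<lambda>r. fourier_coeff (u r) k) has_vector_derivative d) (at t) \<and>
        \<i> * d + of_real (\<epsilon> powr \<alpha>) * ((\<i> * of_int k)\<^sup>2 * fourier_coeff (u t) k) =
        fourier_coeff (szego_proj (\<lambda>x. of_real ((cmod (u t x))\<^sup>2) * u t x)) k)"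

text \<open>
  The nonlinear evolution group. The solution is unique as a curve in \<open>L\<^sup>2\<close>; the choice
  operator only picks a representative of each \<open>u(t)\<close>.
\<close>

definition nls_szego_flow ::
  "real \<Rightarrow> real \<Rightarrow> real \<Rightarrow> (real \<Rightarrow> complex) \<Rightarrow> real \<Rightarrow> complex" where
  "nls_szego_flow \<alpha> \<epsilon> t \<phi> = (SOME u. is_nls_szego_solution \<alpha> \<epsilon> \<phi> u) t"

end

theory Submission
  imports Defs "HOL-Probability.Discrete_Topology"
begin

text \<open>
  Write \<open>lam = \<epsilon>\<^sup>\<alpha>\<close>. The equation conserves the mass \<open>\<integral>|u|\<^sup>2\<close> and the energy
  \<open>2 lam \<integral>|\<partial>\<^sub>xu|\<^sup>2 + \<integral>|u|\<^sup>4\<close> (integrals over the circle with total mass 1). By Cauchy-Schwarz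
  \<open>\<integral>|u(t)|\<^sup>4 \<ge> (\<integral>|u(t)|\<^sup>2)\<^sup>2 = (\<integral>|\<phi>|\<^sup>2)\<^sup>2\<close>, so the kinetic part can grow by at most the variance of
  \<open>|\<phi>|\<^sup>2\<close>:
  \<open>2 lam (\<integral>|\<partial>\<^sub>xu(t)|\<^sup>2 - \<integral>|\<partial>\<^sub>x\<phi>|\<^sup>2) \<le> \<integral>|\<phi>|\<^sup>4 - (\<integral>|\<phi>|\<^sup>2)\<^sup>2\<close>.
  As \<open>|e\<^sub>m| = 1\<close> and \<open>\<phi>\<close> is within \<open>\<epsilon>\<close> of \<open>e\<^sub>m\<close>, this variance is \<open>O(\<epsilon>\<^sup>2)\<close>, and \<open>\<epsilon>\<^sup>2 \<le> lam\<close> because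
  \<open>\<alpha> \<le> 2\<close>. Dividing by \<open>lam\<close> gives a bound that depends on \<open>m\<close> alone
  (\<open>quartic_defect_near_mode\<close>, \<open>mass_square_le\<close>, \<open>Galerkin_bound\<close>).

  The flow is given by a choice among all curves in \<open>H\<^sup>1\<^sup>/\<^sup>2\<close> that solve the equation coefficient by
  coefficient. For such curves the conservation laws are not available directly. They hold for
  truncations of the equation to finitely many frequencies, and the bound is carried over to the
  flow in two steps: the truncations converge to a solution bounded in \<open>H\<^sup>1\<close> (\<open>strong_solution\<close>,
  \<open>existence_of_flow\<close>), and every solution in \<open>H\<^sup>1\<^sup>/\<^sup>2\<close> with the same data has the same coefficients
  (\<open>uniqueness_of_flow\<close>). Both steps are instances of one estimate, \<open>stability\<close>, which compares two
  curves that satisfy only the first \<open>K\<close> of the coefficient equations.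

  The analysis takes place on coefficient sequences. Since negative frequencies are absent, \<open>u\<^sup>2\<close> has
  coefficients given by finite convolutions, and \<open>\<Pi>(|u|\<^sup>2u)\<close> is the correlation of these with the
  coefficients of \<open>u\<close>; the elementary inequality \<open>hnorm2_conv_le\<close> then replaces the Sobolev
  embedding of \<open>H\<^sup>1\<^sup>/\<^sup>2\<close> into \<open>L\<^sup>4\<close>. The passage between functions and sequences uses
  \<open>Riesz_Fischer\<close> and \<open>fourier_uniqueness\<close>, and leads to \<open>fourier_coeff_szego_cubic\<close>.
\<close>

section \<open>Weighted sequence spaces and convolution\<close>

text \<open>
  A function with no negative frequencies is handled through the sequence \<open>a\<close> of its Fourier
  coefficients. The weight \<open>(n + 1)\<^sup>s\<close> is equivalent to \<open>(1 + n\<^sup>2)\<^sup>s\<^sup>/\<^sup>2\<close>, so that \<open>hseq s\<close> below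
  is the coefficient space of \<open>H\<^sup>s\<^sup>/\<^sup>2\<close> and \<open>hnorm2 s\<close> the square of an equivalent norm. Only
  \<open>s = 0, 1, 2\<close> occur, and integer powers keep the algebra elementary.
\<close>

definition wsq :: "nat \<Rightarrow> (nat \<Rightarrow> complex) \<Rightarrow> nat \<Rightarrow> real" where
  "wsq s a n = (real n + 1) ^ s * (cmod (a n))\<^sup>2"

definition hseq :: "nat \<Rightarrow> (nat \<Rightarrow> complex) set" where
  "hseq s = {a. summable (wsq s a)}"

definition hnorm2 :: "nat \<Rightarrow> (nat \<Rightarrow> complex) \<Rightarrow> real" where
  "hnorm2 s a = (\<Sum>n. wsq s a n)"

lemma wsq_nonneg [simp]: "0 \<le> wsq s a n"
  by (simp add: wsq_def)

lemma wsq_0: "wsq 0 a n = (cmod (a n))\<^sup>2"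
  by (simp add: wsq_def)

lemma hnorm2_nonneg: "a \<in> hseq s \<Longrightarrow> 0 \<le> hnorm2 s a"
  by (simp add: hnorm2_def hseq_def suminf_nonneg)

lemma sum_le_hnorm2: "a \<in> hseq s \<Longrightarrow> finite A \<Longrightarrow> (\<Sum>n\<in>A. wsq s a n) \<le> hnorm2 s a"
  unfolding hnorm2_def hseq_def by (rule sum_le_suminf) auto

lemma summable_of_sum_atMost_le:
  fixes f :: "nat \<Rightarrow> real"
  assumes "\<And>n. 0 \<le> f n" "\<And>N. (\<Sum>n\<le>N. f n) \<le> B"
  shows "summable f" "suminf f \<le> B"
proof -
  have *: "(\<Sum>n<N. f n) \<le> B" for N
    by (rule order_trans[OF sum_mono2 assms(2)[of N]]) (auto simp: assms)
  show "summable f"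
    by (rule summableI_nonneg_bounded[of _ B]) (use assms * in auto)
  then show "suminf f \<le> B"
    by (rule suminf_le_const) (use * in auto)
qed

lemma hseqI_bounded:
  assumes "\<And>N. (\<Sum>n\<le>N. wsq s a n) \<le> B"
  shows "a \<in> hseq s" "hnorm2 s a \<le> B"
  using summable_of_sum_atMost_le[of "wsq s a" B] assms by (auto simp: hseq_def hnorm2_def)

lemma hseq_mono:
  assumes "a \<in> hseq s" "r \<le> s" "\<And>n. cmod (b n) \<le> cmod (a n)"
  shows "b \<in> hseq r" "hnorm2 r b \<le> hnorm2 s a"
proof -
  have *: "wsq r b n \<le> wsq s a n" for n
    unfolding wsq_def
    by (intro mult_mono power_increasing power_mono) (use assms in auto)
  have "(\<Sum>n\<le>N. wsq r b n) \<le> hnorm2 s a" for N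
    by (rule order_trans[OF sum_mono sum_le_hnorm2]) (use * assms in auto)
  then show "b \<in> hseq r" "hnorm2 r b \<le> hnorm2 s a"
    using hseqI_bounded by blast+
qed

lemma hseq_weaken: "a \<in> hseq s \<Longrightarrow> r \<le> s \<Longrightarrow> a \<in> hseq r"
  and hnorm2_weaken: "a \<in> hseq s \<Longrightarrow> r \<le> s \<Longrightarrow> hnorm2 r a \<le> hnorm2 s a"
  using hseq_mono[of a s r a] by auto

lemma wsq_add_le: "wsq s (\<lambda>n. a n + b n) n \<le> 2 * wsq s a n + 2 * wsq s b n"
proof -
  have "(cmod (a n + b n))\<^sup>2 \<le> (cmod (a n) + cmod (b n))\<^sup>2"
    by (intro power_mono norm_triangle_ineq) auto
  also have "\<dots> \<le> 2 * (cmod (a n))\<^sup>2 + 2 * (cmod (b n))\<^sup>2"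
    using sum_squares_bound[of "cmod (a n)" "cmod (b n)"] by (simp add: power2_sum)
  finally have "(real n + 1) ^ s * (cmod (a n + b n))\<^sup>2
      \<le> (real n + 1) ^ s * (2 * (cmod (a n))\<^sup>2 + 2 * (cmod (b n))\<^sup>2)"
    by (intro mult_left_mono) auto
  then show ?thesis by (simp add: wsq_def algebra_simps)
qed

lemma hseq_add:
  assumes "a \<in> hseq s" "b \<in> hseq s"
  shows "(\<lambda>n. a n + b n) \<in> hseq s"
    "hnorm2 s (\<lambda>n. a n + b n) \<le> 2 * hnorm2 s a + 2 * hnorm2 s b"
proof -
  have "(\<Sum>n\<le>N. wsq s (\<lambda>n. a n + b n) n) \<le> 2 * hnorm2 s a + 2 * hnorm2 s b" for N
  proof -
    have "(\<Sum>n\<le>N. wsq s (\<lambda>n. a n + b n) n) \<le> (\<Sum>n\<le>N. 2 * wsq s a n + 2 * wsq s b n)"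
      by (intro sum_mono wsq_add_le)
    also have "\<dots> = 2 * (\<Sum>n\<le>N. wsq s a n) + 2 * (\<Sum>n\<le>N. wsq s b n)"
      by (simp add: sum.distrib sum_distrib_left)
    also have "\<dots> \<le> 2 * hnorm2 s a + 2 * hnorm2 s b"
      using sum_le_hnorm2[of a s "{..N}"] sum_le_hnorm2[of b s "{..N}"] assms by simp
    finally show ?thesis .
  qed
  then show "(\<lambda>n. a n + b n) \<in> hseq s"
    "hnorm2 s (\<lambda>n. a n + b n) \<le> 2 * hnorm2 s a + 2 * hnorm2 s b"
    using hseqI_bounded by blast+
qed

lemma wsq_scale: "wsq s (\<lambda>n. c * a n) n = (cmod c)\<^sup>2 * wsq s a n"
  by (simp add: wsq_def norm_mult power_mult_distrib)

lemma hseq_scale: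
  assumes "a \<in> hseq s"
  shows "(\<lambda>n. c * a n) \<in> hseq s" "hnorm2 s (\<lambda>n. c * a n) = (cmod c)\<^sup>2 * hnorm2 s a"
  using assms by (auto simp: hseq_def hnorm2_def wsq_scale[abs_def] suminf_mult)

lemma hseq_diff:
  assumes "a \<in> hseq s" "b \<in> hseq s"
  shows "(\<lambda>n. a n - b n) \<in> hseq s"
    "hnorm2 s (\<lambda>n. a n - b n) \<le> 2 * hnorm2 s a + 2 * hnorm2 s b"
  using hseq_add[OF assms(1) hseq_scale(1)[OF assms(2), of "-1"]]
    hseq_scale(2)[OF assms(2), of "-1"] by simp_all

lemma hseq_finite_support:
  assumes "\<And>n. n > N \<Longrightarrow> a n = 0"
  shows "a \<in> hseq s" "hnorm2 s a = (\<Sum>n\<le>N. wsq s a n)"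
proof -
  have z: "wsq s a n = 0" if "n \<notin> {..N}" for n
    using assms that by (simp add: wsq_def)
  show "a \<in> hseq s"
    unfolding hseq_def using summable_finite[of "{..N}" "wsq s a"] z by auto
  show "hnorm2 s a = (\<Sum>n\<le>N. wsq s a n)"
    unfolding hnorm2_def by (rule suminf_finite) (use z in auto)
qed

lemma Cauchy_Schwarz_hseq:
  assumes "a \<in> hseq 0" "b \<in> hseq 0"
  shows "summable (\<lambda>n. cmod (a n) * cmod (b n))"
    "(\<Sum>n. cmod (a n) * cmod (b n)) \<le> sqrt (hnorm2 0 a) * sqrt (hnorm2 0 b)"
proof -
  have "(\<Sum>n\<le>N. cmod (a n) * cmod (b n)) \<le> sqrt (hnorm2 0 a) * sqrt (hnorm2 0 b)" for N
  proof -
    have "(\<Sum>n\<le>N. cmod (a n) * cmod (b n))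
        \<le> L2_set (\<lambda>n. cmod (a n)) {..N} * L2_set (\<lambda>n. cmod (b n)) {..N}"
      using L2_set_mult_ineq[of "\<lambda>n. cmod (a n)" "\<lambda>n. cmod (b n)" "{..N}"] by simp
    also have "\<dots> \<le> sqrt (hnorm2 0 a) * sqrt (hnorm2 0 b)"
      unfolding L2_set_def
      using sum_le_hnorm2[OF assms(1), of "{..N}"] sum_le_hnorm2[OF assms(2), of "{..N}"]
      by (intro mult_mono) (auto simp: wsq_0 sum_nonneg hnorm2_nonneg assms)
    finally show ?thesis .
  qed
  from summable_of_sum_atMost_le[OF _ this]
  show "summable (\<lambda>n. cmod (a n) * cmod (b n))"
    "(\<Sum>n. cmod (a n) * cmod (b n)) \<le> sqrt (hnorm2 0 a) * sqrt (hnorm2 0 b)" by auto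
qed

lemma hseq_shift:
  assumes "a \<in> hseq 0"
  shows "(\<lambda>n. a (k + n)) \<in> hseq 0" "hnorm2 0 (\<lambda>n. a (k + n)) \<le> hnorm2 0 a"
proof -
  have "(\<Sum>n\<le>N. wsq 0 (\<lambda>n. a (k + n)) n) \<le> hnorm2 0 a" for N
  proof -
    have "(\<Sum>n\<le>N. wsq 0 (\<lambda>n. a (k + n)) n) = (\<Sum>n\<in>(+) k ` {..N}. wsq 0 a n)"
      by (subst sum.reindex) (auto simp: wsq_0)
    also have "\<dots> \<le> hnorm2 0 a"
      by (rule sum_le_hnorm2) (use assms in auto)
    finally show ?thesis .
  qed
  then show "(\<lambda>n. a (k + n)) \<in> hseq 0" "hnorm2 0 (\<lambda>n. a (k + n)) \<le> hnorm2 0 a"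
    using hseqI_bounded by blast+
qed

lemma cmod_suminf_mult_le:
  assumes "a \<in> hseq 0" "b \<in> hseq 0"
  shows "summable (\<lambda>n. a n * cnj (b n))"
    "cmod (\<Sum>n. a n * cnj (b n)) \<le> sqrt (hnorm2 0 a) * sqrt (hnorm2 0 b)"
proof -
  note cs = Cauchy_Schwarz_hseq[OF assms]
  have s: "summable (\<lambda>n. cmod (a n * cnj (b n)))"
    using cs(1) by (simp add: norm_mult)
  then show "summable (\<lambda>n. a n * cnj (b n))" by (rule summable_norm_cancel)
  have "cmod (\<Sum>n. a n * cnj (b n)) \<le> (\<Sum>n. cmod (a n * cnj (b n)))"
    by (rule summable_norm[OF s])
  also have "\<dots> \<le> sqrt (hnorm2 0 a) * sqrt (hnorm2 0 b)"
    using cs(2) by (simp add: norm_mult)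
  finally show "cmod (\<Sum>n. a n * cnj (b n)) \<le> sqrt (hnorm2 0 a) * sqrt (hnorm2 0 b)" .
qed

definition conv :: "(nat \<Rightarrow> complex) \<Rightarrow> (nat \<Rightarrow> complex) \<Rightarrow> nat \<Rightarrow> complex" where
  "conv a b n = (\<Sum>j\<le>n. a j * b (n - j))"

lemma conv_commute: "conv a b = conv b a"
proof
  fix n
  show "conv a b n = conv b a n"
    unfolding conv_def
    by (rule sum.reindex_bij_witness[of _ "\<lambda>j. n - j" "\<lambda>j. n - j"]) auto
qed

lemma conv_add_left: "conv (\<lambda>n. a n + b n) c = (\<lambda>n. conv a c n + conv b c n)"
  by (auto simp: conv_def sum.distrib algebra_simps)

lemma conv_add_right: "conv c (\<lambda>n. a n + b n) = (\<lambda>n. conv c a n + conv c b n)"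
  by (auto simp: conv_def sum.distrib algebra_simps)

lemma conv_scale_left: "conv (\<lambda>n. z * a n) c = (\<lambda>n. z * conv a c n)"
  by (auto simp: conv_def sum_distrib_left mult_ac)

lemma conv_scale_right: "conv c (\<lambda>n. z * a n) = (\<lambda>n. z * conv c a n)"
  by (auto simp: conv_def sum_distrib_left mult_ac)

lemma conv_finite_support:
  assumes "\<And>n. n > N \<Longrightarrow> a n = 0" "\<And>n. n > M \<Longrightarrow> b n = 0" "n > N + M"
  shows "conv a b n = 0"
proof -
  have "a j * b (n - j) = 0" for j
    using assms(1)[of j] assms(2)[of "n - j"] assms(3) by (cases "j > N") auto
  then show ?thesis unfolding conv_def by (intro sum.neutral) blast
qed

lemma cmod_conv_le: "cmod (conv a b n) \<le> (\<Sum>j\<le>n. cmod (a j) * cmod (b (n - j)))"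
  unfolding conv_def by (rule order_trans[OF norm_sum]) (simp add: norm_mult)

text \<open>
  In terms of functions this is \<open>\<parallel>u v\<parallel>\<^sub>2\<^sup>2 \<le> \<parallel>u\<parallel>\<^sub>1\<^sub>/\<^sub>2\<^sup>2 \<parallel>v\<parallel>\<^sub>2\<^sup>2 + \<parallel>u\<parallel>\<^sub>2\<^sup>2 \<parallel>v\<parallel>\<^sub>1\<^sub>/\<^sub>2\<^sup>2\<close>. Because
  negative frequencies are absent, the \<open>n\<close>-th coefficient of a product has only \<open>n + 1\<close> terms;
  Cauchy-Schwarz costs this factor, which splits as \<open>n + 1 \<le> (j + 1) + (n - j + 1)\<close> between the
  two factors.
\<close>

lemma hnorm2_conv_le:
  assumes "a \<in> hseq 1" "b \<in> hseq 1"
  shows "conv a b \<in> hseq 0"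
    "hnorm2 0 (conv a b) \<le> hnorm2 1 a * hnorm2 0 b + hnorm2 0 a * hnorm2 1 b"
proof -
  have a0: "a \<in> hseq 0" and b0: "b \<in> hseq 0"
    using assms hseq_weaken by auto
  define A where "A n = (\<Sum>j\<le>n. wsq 1 a j * wsq 0 b (n - j))" for n
  define B where "B n = (\<Sum>j\<le>n. wsq 0 a j * wsq 1 b (n - j))" for n
  have S: "A sums (hnorm2 1 a * hnorm2 0 b)" "B sums (hnorm2 0 a * hnorm2 1 b)"
    unfolding A_def B_def hnorm2_def
    by (rule Cauchy_product_sums; use assms a0 b0 in \<open>simp add: hseq_def\<close>)+
  have le: "wsq 0 (conv a b) n \<le> A n + B n" for n
  proof -
    have "(cmod (conv a b n))\<^sup>2 \<le> (\<Sum>j\<le>n. cmod (a j) * cmod (b (n - j)))\<^sup>2"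
      by (intro power_mono cmod_conv_le) auto
    also have "\<dots> = (\<Sum>j\<le>n. 1 * (cmod (a j) * cmod (b (n - j))))\<^sup>2" by simp
    also have "\<dots> \<le> (\<Sum>j\<le>n. 1\<^sup>2) * (\<Sum>j\<le>n. (cmod (a j) * cmod (b (n - j)))\<^sup>2)"
      by (rule Cauchy_Schwarz_ineq_sum)
    also have "\<dots> = (\<Sum>j\<le>n. (real n + 1) * (wsq 0 a j * wsq 0 b (n - j)))"
      by (simp add: sum_distrib_left wsq_0 power_mult_distrib algebra_simps)
    also have "\<dots> \<le> (\<Sum>j\<le>n. wsq 1 a j * wsq 0 b (n - j) + wsq 0 a j * wsq 1 b (n - j))"
    proof (rule sum_mono)
      fix j assume j: "j \<in> {..n}"
      have "(real n + 1) * (wsq 0 a j * wsq 0 b (n - j))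
          \<le> ((real j + 1) + (real (n - j) + 1)) * (wsq 0 a j * wsq 0 b (n - j))"
        using j by (intro mult_right_mono) (auto simp: of_nat_diff)
      also have "\<dots> = wsq 1 a j * wsq 0 b (n - j) + wsq 0 a j * wsq 1 b (n - j)"
        by (simp add: wsq_def algebra_simps)
      finally show "(real n + 1) * (wsq 0 a j * wsq 0 b (n - j))
        \<le> wsq 1 a j * wsq 0 b (n - j) + wsq 0 a j * wsq 1 b (n - j)" .
    qed
    finally show ?thesis by (simp add: wsq_0 A_def B_def sum.distrib)
  qed
  have sumAB: "(\<lambda>n. A n + B n) sums (hnorm2 1 a * hnorm2 0 b + hnorm2 0 a * hnorm2 1 b)"
    by (rule sums_add[OF S])
  have "(\<Sum>n\<le>N. wsq 0 (conv a b) n) \<le> hnorm2 1 a * hnorm2 0 b + hnorm2 0 a * hnorm2 1 b" for N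
  proof -
    have "(\<Sum>n\<le>N. wsq 0 (conv a b) n) \<le> (\<Sum>n\<le>N. A n + B n)"
      by (intro sum_mono le)
    also have "\<dots> \<le> (\<Sum>n. A n + B n)"
      by (rule sum_le_suminf[OF sums_summable[OF sumAB]])
        (auto simp: A_def B_def intro!: sum_nonneg add_nonneg_nonneg)
    finally show ?thesis using sums_unique[OF sumAB] by simp
  qed
  then show "conv a b \<in> hseq 0"
    "hnorm2 0 (conv a b) \<le> hnorm2 1 a * hnorm2 0 b + hnorm2 0 a * hnorm2 1 b"
    using hseqI_bounded by blast+
qed

lemma conv_l1:
  assumes "summable (\<lambda>n. cmod (a n))" "summable (\<lambda>n. cmod (b n))"
  shows "summable (\<lambda>n. cmod (conv a b n))"
    "(\<Sum>n. cmod (conv a b n)) \<le> (\<Sum>n. cmod (a n)) * (\<Sum>n. cmod (b n))"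
proof -
  have S: "(\<lambda>n. \<Sum>j\<le>n. cmod (a j) * cmod (b (n - j))) sums ((\<Sum>n. cmod (a n)) * (\<Sum>n. cmod (b n)))"
    by (rule Cauchy_product_sums) (use assms in auto)
  show s: "summable (\<lambda>n. cmod (conv a b n))"
    by (rule summable_comparison_test'[OF sums_summable[OF S], of 0]) (use cmod_conv_le in auto)
  show "(\<Sum>n. cmod (conv a b n)) \<le> (\<Sum>n. cmod (a n)) * (\<Sum>n. cmod (b n))"
    unfolding sums_unique[OF S]
    by (rule suminf_le[OF _ s sums_summable[OF S]]) (rule cmod_conv_le)
qed

text \<open>
  Young's inequality \<open>\<ell>\<^sup>1 * \<ell>\<^sup>2 \<subseteq> \<ell>\<^sup>2\<close>, from Cauchy-Schwarz with the weight \<open>cmod (a j)\<close>.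
\<close>

lemma hnorm2_conv_l1_le:
  assumes "summable (\<lambda>n. cmod (a n))" "b \<in> hseq 0"
  shows "conv a b \<in> hseq 0" "hnorm2 0 (conv a b) \<le> (\<Sum>n. cmod (a n))\<^sup>2 * hnorm2 0 b"
proof -
  define R where "R = (\<Sum>n. cmod (a n))"
  have S: "(\<lambda>n. \<Sum>j\<le>n. cmod (a j) * wsq 0 b (n - j)) sums (R * hnorm2 0 b)"
    unfolding R_def hnorm2_def
    by (rule Cauchy_product_sums) (use assms in \<open>auto simp: hseq_def\<close>)
  have le: "wsq 0 (conv a b) n \<le> R * (\<Sum>j\<le>n. cmod (a j) * wsq 0 b (n - j))" for n
  proof -
    have "(cmod (conv a b n))\<^sup>2 \<le> (\<Sum>j\<le>n. cmod (a j) * cmod (b (n - j)))\<^sup>2"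
      by (intro power_mono cmod_conv_le) auto
    also have "\<dots> = (\<Sum>j\<le>n. sqrt (cmod (a j)) * (sqrt (cmod (a j)) * cmod (b (n - j))))\<^sup>2"
      by (simp flip: mult.assoc)
    also have "\<dots> \<le> (\<Sum>j\<le>n. (sqrt (cmod (a j)))\<^sup>2) *
        (\<Sum>j\<le>n. (sqrt (cmod (a j)) * cmod (b (n - j)))\<^sup>2)"
      by (rule Cauchy_Schwarz_ineq_sum)
    also have "\<dots> = (\<Sum>j\<le>n. cmod (a j)) * (\<Sum>j\<le>n. cmod (a j) * wsq 0 b (n - j))"
      by (simp add: power_mult_distrib wsq_0)
    also have "\<dots> \<le> R * (\<Sum>j\<le>n. cmod (a j) * wsq 0 b (n - j))"
      unfolding R_def
      by (intro mult_right_mono sum_le_suminf assms sum_nonneg) auto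
    finally show ?thesis by (simp add: wsq_0)
  qed
  note RS = sums_mult[OF S, of R]
  have R0: "0 \<le> R" unfolding R_def by (rule suminf_nonneg) (use assms in auto)
  have "(\<Sum>n\<le>N. wsq 0 (conv a b) n) \<le> R\<^sup>2 * hnorm2 0 b" for N
  proof -
    have "(\<Sum>n\<le>N. wsq 0 (conv a b) n) \<le> (\<Sum>n\<le>N. R * (\<Sum>j\<le>n. cmod (a j) * wsq 0 b (n - j)))"
      by (intro sum_mono le)
    also have "\<dots> \<le> (\<Sum>n. R * (\<Sum>j\<le>n. cmod (a j) * wsq 0 b (n - j)))"
      by (rule sum_le_suminf[OF sums_summable[OF RS]]) (use R0 in \<open>auto intro!: sum_nonneg mult_nonneg_nonneg\<close>)
    finally show ?thesis using sums_unique[OF RS] by (simp add: power2_eq_square mult_ac)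
  qed
  then show "conv a b \<in> hseq 0" "hnorm2 0 (conv a b) \<le> (\<Sum>n. cmod (a n))\<^sup>2 * hnorm2 0 b"
    using hseqI_bounded unfolding R_def by blast+
qed

lemma cmod_conv_le_hnorm2:
  assumes "a \<in> hseq 0" "b \<in> hseq 0"
  shows "cmod (conv a b n) \<le> sqrt (hnorm2 0 a) * sqrt (hnorm2 0 b)"
proof -
  have "cmod (conv a b n) \<le> (\<Sum>j\<le>n. \<bar>cmod (a j)\<bar> * \<bar>cmod (b (n - j))\<bar>)"
    using cmod_conv_le by simp
  also have "\<dots> \<le> L2_set (\<lambda>j. cmod (a j)) {..n} * L2_set (\<lambda>j. cmod (b (n - j))) {..n}"
    by (rule L2_set_mult_ineq)
  also have "L2_set (\<lambda>j. cmod (b (n - j))) {..n} = L2_set (\<lambda>j. cmod (b j)) {..n}"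
    unfolding L2_set_def
    by (intro arg_cong[where f=sqrt] sum.reindex_bij_witness[of _ "\<lambda>j. n - j" "\<lambda>j. n - j"]) auto
  also have "L2_set (\<lambda>j. cmod (a j)) {..n} * L2_set (\<lambda>j. cmod (b j)) {..n}
      \<le> sqrt (hnorm2 0 a) * sqrt (hnorm2 0 b)"
    unfolding L2_set_def
    using sum_le_hnorm2[OF assms(1), of "{..n}"] sum_le_hnorm2[OF assms(2), of "{..n}"]
    by (intro mult_mono) (auto simp: wsq_0 sum_nonneg hnorm2_nonneg assms)
  finally show ?thesis .
qed

definition zeta2 :: real where "zeta2 = (\<Sum>n. 1 / (real n + 1)\<^sup>2)"

lemma summable_inverse_squares: "summable (\<lambda>n. 1 / (real n + 1)\<^sup>2)"
proof -
  have "summable (\<lambda>n. inverse ((real (Suc n)) ^ 2))"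
    using inverse_power_summable[of 2, where 'a=real] by (subst summable_Suc_iff) auto
  then show ?thesis by (simp add: field_simps)
qed

lemma zeta2_nonneg: "0 \<le> zeta2"
  unfolding zeta2_def by (rule suminf_nonneg[OF summable_inverse_squares]) auto

lemma l1_of_hseq2:
  assumes "a \<in> hseq 2"
  shows "summable (\<lambda>n. cmod (a n))" "(\<Sum>n. cmod (a n)) \<le> sqrt zeta2 * sqrt (hnorm2 2 a)"
proof -
  define p where "p n = complex_of_real (1 / (real n + 1))" for n :: nat
  define q where "q n = of_real (real n + 1) * a n" for n
  have pn: "cmod (p n) = 1 / (real n + 1)" for n
    unfolding p_def norm_of_real by simp
  have "wsq 0 p = (\<lambda>n. 1 / (real n + 1)\<^sup>2)"
    by (auto simp: wsq_0 pn power_divide)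
  then have p: "p \<in> hseq 0" "hnorm2 0 p = zeta2"
    using summable_inverse_squares by (auto simp: hseq_def hnorm2_def zeta2_def)
  have qn: "cmod (q n) = (real n + 1) * cmod (a n)" for n
    unfolding q_def norm_mult norm_of_real by simp
  have wq: "wsq 0 q = wsq 2 a"
    by (auto simp: wsq_def qn power_mult_distrib)
  have q: "q \<in> hseq 0" "hnorm2 0 q = hnorm2 2 a"
    using assms wq by (auto simp: hseq_def hnorm2_def)
  have "cmod (p n) * cmod (q n) = cmod (a n)" for n
    unfolding pn qn by (simp add: field_simps)
  with Cauchy_Schwarz_hseq[OF p(1) q(1)] p(2) q(2)
  show "summable (\<lambda>n. cmod (a n))" "(\<Sum>n. cmod (a n)) \<le> sqrt zeta2 * sqrt (hnorm2 2 a)"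
    by simp_all
qed

text \<open>
  Coefficients of \<open>\<Pi>(p \<cdot> cnj c)\<close>: multiplication by a conjugate shifts frequencies down, and the
  projector discards those that become negative.
\<close>

definition corr :: "(nat \<Rightarrow> complex) \<Rightarrow> (nat \<Rightarrow> complex) \<Rightarrow> nat \<Rightarrow> complex" where
  "corr p c k = (\<Sum>m. p (k + m) * cnj (c m))"

lemma summable_corr:
  assumes "p \<in> hseq 0" "c \<in> hseq 0"
  shows "summable (\<lambda>m. p (k + m) * cnj (c m))"
  by (rule cmod_suminf_mult_le[OF hseq_shift(1)[OF assms(1)] assms(2)])

lemma cmod_corr_le:
  assumes "p \<in> hseq 0" "c \<in> hseq 0"
  shows "cmod (corr p c k) \<le> sqrt (hnorm2 0 p) * sqrt (hnorm2 0 c)"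
proof -
  have "cmod (corr p c k) \<le> sqrt (hnorm2 0 (\<lambda>m. p (k + m))) * sqrt (hnorm2 0 c)"
    unfolding corr_def by (rule cmod_suminf_mult_le[OF hseq_shift(1)[OF assms(1)] assms(2)])
  also have "\<dots> \<le> sqrt (hnorm2 0 p) * sqrt (hnorm2 0 c)"
    by (intro mult_right_mono) (use hseq_shift(2)[OF assms(1)] hnorm2_nonneg assms in auto)
  finally show ?thesis .
qed

lemma corr_diff_left:
  assumes "p \<in> hseq 0" "q \<in> hseq 0" "c \<in> hseq 0"
  shows "corr (\<lambda>n. p n - q n) c k = corr p c k - corr q c k"
  unfolding corr_def
  using suminf_diff[OF summable_corr[OF assms(1,3)] summable_corr[OF assms(2,3)], of k k]
  by (simp add: left_diff_distrib)

lemma corr_diff_right: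
  assumes "p \<in> hseq 0" "b \<in> hseq 0" "c \<in> hseq 0"
  shows "corr p (\<lambda>n. b n - c n) k = corr p b k - corr p c k"
  unfolding corr_def
  using suminf_diff[OF summable_corr[OF assms(1,2)] summable_corr[OF assms(1,3)], of k k]
  by (simp add: right_diff_distrib)

lemma corr_shift:
  assumes "p \<in> hseq 0" "c \<in> hseq 0"
  shows "(\<lambda>n. if k \<le> n then p n * cnj (c (n - k)) else 0) sums corr p c k"
proof -
  have "(\<lambda>m. p (k + m) * cnj (c m)) sums corr p c k"
    unfolding corr_def by (rule summable_sums[OF summable_corr[OF assms]])
  moreover have "(\<lambda>m. p (k + m) * cnj (c m)) =
      (\<lambda>m. (if k \<le> m + k then p (m + k) * cnj (c (m + k - k)) else 0))"
    by (auto simp: add.commute)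
  ultimately have "(\<lambda>m. (if k \<le> m + k then p (m + k) * cnj (c (m + k - k)) else 0)) sums corr p c k"
    by simp
  then show ?thesis
    by (subst (asm) sums_iff_shift[where f="\<lambda>n. if k \<le> n then p n * cnj (c (n - k)) else 0"]) simp
qed

text \<open>
  The identity \<open>\<integral> \<Pi>(p \<cdot> cnj c) \<cdot> cnj d = \<integral> p \<cdot> cnj (c d)\<close> for \<open>d\<close> in the range of \<open>\<Pi>\<close>. Both
  the uniqueness estimate and the conservation laws rest on it.
\<close>

lemma corr_conv_duality:
  assumes "p \<in> hseq 0" "c \<in> hseq 0" "\<And>n. n > K \<Longrightarrow> d n = 0"
  shows "(\<lambda>n. p n * cnj (conv c d n)) sums (\<Sum>k\<le>K. corr p c k * cnj (d k))"
proof -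
  have "(\<lambda>n. \<Sum>k\<le>K. (if k \<le> n then p n * cnj (c (n - k)) else 0) * cnj (d k)) sums
      (\<Sum>k\<le>K. corr p c k * cnj (d k))"
    by (intro sums_sum sums_mult2 corr_shift assms)
  moreover have "(\<Sum>k\<le>K. (if k \<le> n then p n * cnj (c (n - k)) else 0) * cnj (d k)) =
      p n * cnj (conv c d n)" for n
  proof -
    have "(\<Sum>k\<le>K. (if k \<le> n then p n * cnj (c (n - k)) else 0) * cnj (d k)) =
        (\<Sum>k\<in>{..K} \<inter> {..n}. p n * cnj (c (n - k)) * cnj (d k))"
      by (rule sum.mono_neutral_cong_right) auto
    also have "\<dots> = (\<Sum>k\<le>n. p n * cnj (c (n - k)) * cnj (d k))"
      by (rule sum.mono_neutral_left) (use assms(3) in auto)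
    also have "\<dots> = p n * cnj (conv d c n)"
      unfolding conv_def by (simp add: sum_distrib_left mult_ac)
    finally show ?thesis by (simp add: conv_commute)
  qed
  ultimately show ?thesis by simp
qed

section \<open>The cubic nonlinearity on coefficients\<close>

text \<open>
  The coefficients of \<open>\<Pi>(|u|\<^sup>2 u) = \<Pi>(u\<^sup>2 \<cdot> cnj u)\<close> if \<open>a\<close> are those of \<open>u\<close>; this is the content of
  \<open>fourier_coeff_szego_cubic\<close>.
\<close>

definition cubic :: "(nat \<Rightarrow> complex) \<Rightarrow> nat \<Rightarrow> complex" where
  "cubic a = corr (conv a a) a"

lemma cubic_scale:
  assumes "a \<in> hseq 1"
  shows "cubic (\<lambda>n. of_real c * a n) k = of_real (c ^ 3) * cubic a k"
proof -
  have "summable (\<lambda>m. conv a a (k + m) * cnj (a m))"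
    by (rule summable_corr) (use assms hnorm2_conv_le hseq_weaken in auto)
  from suminf_mult[OF this, of "of_real (c ^ 3)"] show ?thesis
    unfolding cubic_def corr_def conv_scale_left conv_scale_right
    by (simp add: power3_eq_cube mult_ac)
qed

lemma harmonic_le_sqrt: "(\<Sum>j\<le>n. 1 / (real j + 1)) \<le> 2 * sqrt (real n + 1)"
proof (induction n)
  case (Suc n)
  define s where "s = sqrt (real n + 1)"
  define t where "t = sqrt (real n + 2)"
  have st: "0 < s" "s \<le> t" "s\<^sup>2 = real n + 1" "t\<^sup>2 = real n + 2" by (auto simp: s_def t_def)
  have "1 / (real n + 2) \<le> 2 * (t - s)"
  proof -
    have "(t - s) * (t + s) = 1" using st by (simp add: algebra_simps power2_eq_square)
    then have "t - s = 1 / (t + s)" using st by (simp add: field_simps)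
    moreover have "1 / (2 * t) \<le> 1 / (t + s)" using st by (intro divide_left_mono) auto
    moreover have "1 / t\<^sup>2 \<le> 1 / t"
    proof (rule divide_left_mono)
      have "1 \<le> t" by (simp add: t_def)
      then show "t \<le> t\<^sup>2" "0 < t\<^sup>2 * t" by (auto simp: power2_eq_square)
    qed simp
    ultimately show ?thesis using st by simp
  qed
  moreover have "(\<Sum>j\<le>Suc n. 1 / (real j + 1)) = (\<Sum>j\<le>n. 1 / (real j + 1)) + 1 / (real n + 2)"
    by (simp add: add.commute)
  moreover have "sqrt (real (Suc n) + 1) = t"
    unfolding t_def by (rule arg_cong[where f=sqrt]) simp
  moreover have "(\<Sum>j\<le>n. 1 / (real j + 1)) \<le> 2 * s" using Suc by (simp add: s_def)
  ultimately show ?case by (simp only: right_diff_distrib)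
qed simp

lemma sum_inverse_products_le:
  "(\<Sum>j\<le>n. 1 / ((real j + 1) * (real (n - j) + 1))) \<le> 4 / sqrt (real n + 1)"
proof -
  have "(\<Sum>j\<le>n. 1 / ((real j + 1) * (real (n - j) + 1)))
      = (\<Sum>j\<le>n. (1 / (real j + 1) + 1 / (real (n - j) + 1)) / (real n + 2))"
  proof (intro sum.cong refl)
    fix j assume "j \<in> {..n}"
    define x where "x = real j + 1"
    define y where "y = real (n - j) + 1"
    have "real n + 2 = x + y" "0 < x" "0 < y" using \<open>j \<in> {..n}\<close> by (auto simp: x_def y_def of_nat_diff)
    then show "1 / ((real j + 1) * (real (n - j) + 1))
        = (1 / (real j + 1) + 1 / (real (n - j) + 1)) / (real n + 2)"
      unfolding x_def[symmetric] y_def[symmetric] by (simp add: divide_simps add.commute)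
  qed
  also have "\<dots> = ((\<Sum>j\<le>n. 1 / (real j + 1)) + (\<Sum>j\<le>n. 1 / (real (n - j) + 1))) / (real n + 2)"
    unfolding sum.distrib[symmetric] sum_divide_distrib ..
  also have "(\<Sum>j\<le>n. 1 / (real (n - j) + 1)) = (\<Sum>j\<le>n. 1 / (real j + 1))"
    by (rule sum.reindex_bij_witness[of _ "\<lambda>j. n - j" "\<lambda>j. n - j"]) auto
  also have "((\<Sum>j\<le>n. 1 / (real j + 1)) + (\<Sum>j\<le>n. 1 / (real j + 1))) / (real n + 2)
      \<le> (4 * sqrt (real n + 1)) / (real n + 2)"
    using harmonic_le_sqrt[of n] by (intro divide_right_mono) auto
  also have "\<dots> \<le> (4 * sqrt (real n + 1)) / (real n + 1)"
    by (intro divide_left_mono) auto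
  also have "\<dots> = 4 / sqrt (real n + 1)"
    by (simp add: field_simps)
  finally show ?thesis .
qed

text \<open>
  A sharper form of the product estimate for two sequences in \<open>hseq 1\<close>. Putting the
  weights on both factors leaves the sum of \<open>1 / ((j + 1) (n - j + 1))\<close>, which decays in \<open>n\<close>
  like \<open>log n / n\<close>; the bound \<open>4 / sqrt (n + 1)\<close> is enough for \<open>cubic_hseq0\<close>.
\<close>

lemma cmod_conv_power2_le:
  "(cmod (conv a b n))\<^sup>2 \<le> 4 / sqrt (real n + 1) * (\<Sum>j\<le>n. wsq 1 a j * wsq 1 b (n - j))"
proof -
  define v where "v j = 1 / sqrt ((real j + 1) * (real (n - j) + 1))" for j
  define x where "x j = sqrt ((real j + 1) * (real (n - j) + 1)) * (cmod (a j) * cmod (b (n - j)))" for j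
  have vx: "v j * x j = cmod (a j) * cmod (b (n - j))" for j
  proof -
    have "0 < (real j + 1) * (real (n - j) + 1)" by (intro mult_pos_pos) auto
    then have "sqrt ((real j + 1) * (real (n - j) + 1)) \<noteq> 0" by (simp only: real_sqrt_eq_zero_cancel_iff)
    then show ?thesis by (simp add: v_def x_def del: real_sqrt_eq_zero_cancel_iff)
  qed
  have "(cmod (conv a b n))\<^sup>2 \<le> (\<Sum>j\<le>n. v j * x j)\<^sup>2"
    unfolding vx by (intro power_mono cmod_conv_le) auto
  also have "\<dots> \<le> (\<Sum>j\<le>n. (v j)\<^sup>2) * (\<Sum>j\<le>n. (x j)\<^sup>2)"
    by (rule Cauchy_Schwarz_ineq_sum)
  also have "(\<Sum>j\<le>n. (v j)\<^sup>2) = (\<Sum>j\<le>n. 1 / ((real j + 1) * (real (n - j) + 1)))"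
    unfolding v_def by (simp add: power_divide)
  also have "(\<Sum>j\<le>n. (x j)\<^sup>2) = (\<Sum>j\<le>n. wsq 1 a j * wsq 1 b (n - j))"
    unfolding x_def wsq_def by (simp add: power_mult_distrib mult_ac)
  also have "(\<Sum>j\<le>n. 1 / ((real j + 1) * (real (n - j) + 1))) * (\<Sum>j\<le>n. wsq 1 a j * wsq 1 b (n - j))
      \<le> 4 / sqrt (real n + 1) * (\<Sum>j\<le>n. wsq 1 a j * wsq 1 b (n - j))"
    by (intro mult_right_mono sum_inverse_products_le sum_nonneg mult_nonneg_nonneg) auto
  finally show ?thesis .
qed

lemma summable_inverse_three_halves: "summable (\<lambda>n. 1 / ((real n + 1) * sqrt (real n + 1)))"
proof -
  have "summable (\<lambda>n. real n powr (- 3/2))" by (simp add: summable_real_powr_iff)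
  then have "summable (\<lambda>n. real (Suc n) powr (- 3/2))" by (subst summable_Suc_iff)
  moreover have "real (Suc n) powr (- 3/2) = 1 / ((real n + 1) * sqrt (real n + 1))" for n
  proof -
    have "real (Suc n) powr (- 3/2) = inverse (real (Suc n) powr (1 + 1/2))"
      by (simp add: powr_minus[symmetric])
    also have "real (Suc n) powr (1 + 1/2) = real (Suc n) * sqrt (real (Suc n))"
      unfolding powr_add by (simp add: powr_half_sqrt)
    finally show ?thesis by (simp add: field_simps)
  qed
  ultimately show ?thesis by simp
qed

text \<open>
  The projected cubic term of an \<open>H\<^sup>1\<^sup>/\<^sup>2\<close> function is in \<open>L\<^sup>2\<close>. This is what makes \<open>szego_proj\<close>
  meaningful along a solution: a function with the prescribed coefficients exists. The decay
  \<open>1 / sqrt (n + 1)\<close> gained for \<open>conv a a\<close> makes the Cauchy-Schwarz weights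
  \<open>1 / ((m + 1) sqrt (m + 1))\<close> summable, uniformly in the shift \<open>k\<close>.
\<close>

lemma cubic_hseq0:
  assumes "a \<in> hseq 1"
  shows "cubic a \<in> hseq 0"
proof -
  have a0: "a \<in> hseq 0" using assms hseq_weaken by auto
  have bb0: "conv a a \<in> hseq 0" by (rule hnorm2_conv_le[OF assms assms])
  define B where "B n = (\<Sum>j\<le>n. wsq 1 a j * wsq 1 a (n - j))" for n
  define S where "S = hnorm2 1 a"
  have S0: "0 \<le> S" unfolding S_def by (rule hnorm2_nonneg[OF assms])
  have Bs: "B sums (S * S)"
    unfolding B_def S_def hnorm2_def
    by (rule Cauchy_product_sums) (use assms in \<open>auto simp: hseq_def\<close>)
  have B0: "0 \<le> B n" for n unfolding B_def by (intro sum_nonneg mult_nonneg_nonneg) auto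
  define q where "q m = 1 / ((real m + 1) * sqrt (real m + 1))" for m :: nat
  define Z where "Z = 4 * (\<Sum>m. q m)"
  have q0: "0 \<le> q m" for m by (simp add: q_def)
  have qs: "summable q" unfolding q_def by (rule summable_inverse_three_halves)
  have Z0: "0 \<le> Z" unfolding Z_def using suminf_nonneg[OF qs q0] by simp
  have part: "(cmod (\<Sum>m<M. conv a a (k + m) * cnj (a m)))\<^sup>2 \<le> Z * (\<Sum>m<M. B (k + m) * wsq 1 a m)" for k M
  proof -
    have bm: "cmod (conv a a (k + m)) \<le> sqrt (4 * B (k + m) / sqrt (real m + 1))" for m
    proof (rule real_le_rsqrt)
      have "(cmod (conv a a (k + m)))\<^sup>2 \<le> 4 / sqrt (real (k + m) + 1) * B (k + m)"
        unfolding B_def by (rule cmod_conv_power2_le)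
      also have "\<dots> \<le> 4 / sqrt (real m + 1) * B (k + m)"
        by (intro mult_right_mono divide_left_mono B0) auto
      finally show "(cmod (conv a a (k + m)))\<^sup>2 \<le> 4 * B (k + m) / sqrt (real m + 1)" by simp
    qed
    have "cmod (\<Sum>m<M. conv a a (k + m) * cnj (a m))
        \<le> (\<Sum>m<M. cmod (conv a a (k + m)) * cmod (a m))"
      by (rule order_trans[OF norm_sum]) (simp add: norm_mult)
    also have "\<dots> \<le> (\<Sum>m<M. sqrt (4 * q m) * sqrt (B (k + m) * wsq 1 a m))"
    proof (rule sum_mono)
      fix m
      have "cmod (conv a a (k + m)) * cmod (a m)
          \<le> sqrt (4 * B (k + m) / sqrt (real m + 1)) * sqrt ((cmod (a m))\<^sup>2)"
        using bm[of m] B0[of "k + m"] by (intro mult_mono) auto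
      also have "\<dots> = sqrt (4 * q m * (B (k + m) * wsq 1 a m))"
        unfolding real_sqrt_mult[symmetric]
        by (rule arg_cong[where f=sqrt]) (auto simp: q_def wsq_def divide_simps)
      finally show "cmod (conv a a (k + m)) * cmod (a m) \<le> sqrt (4 * q m) * sqrt (B (k + m) * wsq 1 a m)"
        by (simp add: real_sqrt_mult)
    qed
    finally have "(cmod (\<Sum>m<M. conv a a (k + m) * cnj (a m)))\<^sup>2
        \<le> (\<Sum>m<M. sqrt (4 * q m) * sqrt (B (k + m) * wsq 1 a m))\<^sup>2"
      by (intro power_mono) auto
    also have "\<dots> \<le> (\<Sum>m<M. (sqrt (4 * q m))\<^sup>2) * (\<Sum>m<M. (sqrt (B (k + m) * wsq 1 a m))\<^sup>2)"
      by (rule Cauchy_Schwarz_ineq_sum)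
    also have "\<dots> = (4 * (\<Sum>m<M. q m)) * (\<Sum>m<M. B (k + m) * wsq 1 a m)"
      using q0 B0 by (simp add: sum_distrib_left)
    also have "\<dots> \<le> Z * (\<Sum>m<M. B (k + m) * wsq 1 a m)"
      unfolding Z_def using sum_le_suminf[OF qs, of "{..<M}"] q0 B0
      by (intro mult_right_mono sum_nonneg mult_nonneg_nonneg) auto
    finally show ?thesis .
  qed
  have tot: "(\<Sum>k\<le>N. (cmod (\<Sum>m<M. conv a a (k + m) * cnj (a m)))\<^sup>2) \<le> Z * (S * S * S)" for N M
  proof -
    have "(\<Sum>k\<le>N. (cmod (\<Sum>m<M. conv a a (k + m) * cnj (a m)))\<^sup>2)
        \<le> (\<Sum>k\<le>N. Z * (\<Sum>m<M. B (k + m) * wsq 1 a m))"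
      by (intro sum_mono part)
    also have "\<dots> = Z * (\<Sum>m<M. (\<Sum>k\<le>N. B (k + m)) * wsq 1 a m)"
      by (simp add: sum_distrib_left sum_distrib_right sum.swap[of _ "{..N}"])
    also have "\<dots> \<le> Z * (\<Sum>m<M. (S * S) * wsq 1 a m)"
    proof (intro mult_left_mono[OF sum_mono Z0] mult_right_mono)
      fix m
      have "(\<Sum>k\<le>N. B (k + m)) = (\<Sum>n\<in>(\<lambda>k. k + m) ` {..N}. B n)"
        by (subst sum.reindex) (auto simp: inj_on_def)
      also have "\<dots> \<le> (\<Sum>n. B n)"
        by (intro sum_le_suminf sums_summable[OF Bs]) (use B0 in auto)
      finally show "(\<Sum>k\<le>N. B (k + m)) \<le> S * S" using sums_unique[OF Bs] by simp
    qed auto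
    also have "\<dots> \<le> Z * ((S * S) * S)"
      unfolding sum_distrib_left[symmetric]
      by (intro mult_left_mono) (use sum_le_hnorm2[OF assms, of "{..<M}"] S0 Z0 in \<open>auto simp: S_def\<close>)
    finally show ?thesis by simp
  qed
  have "(\<Sum>k\<le>N. wsq 0 (cubic a) k) \<le> Z * (S * S * S)" for N
  proof (rule LIMSEQ_le_const2)
    show "(\<lambda>M. \<Sum>k\<le>N. (cmod (\<Sum>m<M. conv a a (k + m) * cnj (a m)))\<^sup>2)
        \<longlonglongrightarrow> (\<Sum>k\<le>N. wsq 0 (cubic a) k)"
      unfolding wsq_0 cubic_def corr_def
      by (intro tendsto_sum tendsto_power tendsto_norm summable_LIMSEQ summable_corr bb0 a0)
  qed (use tot in auto)
  then show ?thesis by (rule hseqI_bounded(1))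
qed

text \<open>
  With \<open>u = v + w\<close> this reads \<open>|u|\<^sup>2u - |v|\<^sup>2v = (w\<^sup>2 + 2vw) \<cdot> cnj u + v\<^sup>2 \<cdot> cnj w\<close>.
\<close>

lemma cubic_diff_eq:
  assumes "a \<in> hseq 1" "b \<in> hseq 1"
  defines "w \<equiv> \<lambda>n. a n - b n"
  shows "cubic a k - cubic b k =
    corr (\<lambda>n. conv w w n + 2 * conv b w n) a k + corr (conv b b) w k"
proof -
  have w: "w \<in> hseq 1" unfolding w_def by (rule hseq_diff(1)[OF assms(1,2)])
  have h0: "a \<in> hseq 0" "b \<in> hseq 0" "w \<in> hseq 0"
    using assms(1,2) w hseq_weaken by auto
  have a: "a = (\<lambda>n. b n + w n)" by (simp add: w_def)
  have "(\<lambda>n. conv w w n + 2 * conv b w n) = (\<lambda>n. conv a a n - conv b b n)"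
    unfolding a conv_add_left conv_add_right conv_commute[of w b]
    by (auto simp: algebra_simps)
  moreover have "corr (conv b b) w k = corr (conv b b) a k - corr (conv b b) b k"
    unfolding w_def by (rule corr_diff_right) (use h0 hnorm2_conv_le assms(1,2) in auto)
  moreover have "corr (\<lambda>n. conv a a n - conv b b n) a k = corr (conv a a) a k - corr (conv b b) a k"
    by (rule corr_diff_left) (use h0 hnorm2_conv_le assms(1,2) in auto)
  ultimately show ?thesis by (simp add: cubic_def)
qed

lemma hnorm2_conv_diff_le:
  assumes "w \<in> hseq 1" "b \<in> hseq 0" "summable (\<lambda>n. cmod (b n))"
  defines "R \<equiv> (\<Sum>n. cmod (b n))"
  shows "(\<lambda>n. conv w w n + 2 * conv b w n) \<in> hseq 0"
    "hnorm2 0 (\<lambda>n. conv w w n + 2 * conv b w n) \<le> (4 * hnorm2 1 w + 8 * R\<^sup>2) * hnorm2 0 w"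
proof -
  have w0: "w \<in> hseq 0" using assms hseq_weaken by auto
  note ww = hnorm2_conv_le[OF assms(1,1)]
  note bw = hnorm2_conv_l1_le[OF assms(3) w0, folded R_def]
  note add = hseq_add[OF ww(1) hseq_scale(1)[OF bw(1), of 2]]
  show "(\<lambda>n. conv w w n + 2 * conv b w n) \<in> hseq 0" by (rule add(1))
  have "hnorm2 0 (\<lambda>n. conv w w n + 2 * conv b w n)
      \<le> 2 * hnorm2 0 (conv w w) + 2 * (4 * hnorm2 0 (conv b w))"
    using add(2) by (simp add: hseq_scale(2)[OF bw(1)])
  then show "hnorm2 0 (\<lambda>n. conv w w n + 2 * conv b w n) \<le> (4 * hnorm2 1 w + 8 * R\<^sup>2) * hnorm2 0 w"
    using ww(2) bw(2) by (simp add: algebra_simps)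
qed

lemma cmod_cubic_diff_le:
  assumes "a \<in> hseq 1" "b \<in> hseq 1" "summable (\<lambda>n. cmod (b n))"
  defines "w \<equiv> \<lambda>n. a n - b n" and "R \<equiv> (\<Sum>n. cmod (b n))"
  shows "cmod (cubic a k - cubic b k) \<le>
    (sqrt (4 * hnorm2 1 w + 8 * R\<^sup>2) * sqrt (hnorm2 0 a) + R * sqrt (hnorm2 0 b)) * sqrt (hnorm2 0 w)"
proof -
  have w: "w \<in> hseq 1" unfolding w_def by (rule hseq_diff(1)[OF assms(1,2)])
  have h0: "a \<in> hseq 0" "b \<in> hseq 0" "w \<in> hseq 0"
    using assms(1,2) w hseq_weaken by auto
  have R0: "0 \<le> R" unfolding R_def by (rule suminf_nonneg[OF assms(3)]) auto
  note p = hnorm2_conv_diff_le[OF w h0(2) assms(3), folded R_def]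
  note bb = hnorm2_conv_l1_le[OF assms(3) h0(2), folded R_def]
  have "cmod (cubic a k - cubic b k) \<le> cmod (corr (\<lambda>n. conv w w n + 2 * conv b w n) a k)
      + cmod (corr (conv b b) w k)"
    unfolding cubic_diff_eq[OF assms(1,2), folded w_def] by (rule norm_triangle_ineq)
  also have "\<dots> \<le> sqrt (hnorm2 0 (\<lambda>n. conv w w n + 2 * conv b w n)) * sqrt (hnorm2 0 a)
      + sqrt (hnorm2 0 (conv b b)) * sqrt (hnorm2 0 w)"
    by (intro add_mono cmod_corr_le p bb h0)
  also have "\<dots> \<le> sqrt ((4 * hnorm2 1 w + 8 * R\<^sup>2) * hnorm2 0 w) * sqrt (hnorm2 0 a)
      + sqrt (R\<^sup>2 * hnorm2 0 b) * sqrt (hnorm2 0 w)"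
    using p(2) bb(2) by (intro add_mono mult_right_mono) (auto simp: hnorm2_nonneg h0)
  also have "\<dots> = (sqrt (4 * hnorm2 1 w + 8 * R\<^sup>2) * sqrt (hnorm2 0 a) + R * sqrt (hnorm2 0 b))
      * sqrt (hnorm2 0 w)"
    unfolding real_sqrt_mult using R0 by (simp add: algebra_simps)
  finally show ?thesis .
qed

text \<open>
  The estimate behind uniqueness: testing the difference of the nonlinearities against a
  truncation of \<open>w\<close> is quadratic in the \<open>L\<^sup>2\<close> norm of \<open>w\<close>, although \<open>a\<close> is only in \<open>H\<^sup>1\<^sup>/\<^sup>2\<close>. Only
  \<open>b\<close> has to be bounded: the terms of higher order in \<open>w\<close> are of the form \<open>\<integral>|w|\<^sup>4\<close> or
  \<open>\<integral>|b||w|\<^sup>3\<close>, and \<open>hnorm2_conv_le\<close> trades the extra powers for the \<open>H\<^sup>1\<^sup>/\<^sup>2\<close> norm.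
\<close>

lemma cubic_diff_pairing_le:
  assumes "a \<in> hseq 1" "b \<in> hseq 1" "summable (\<lambda>n. cmod (b n))"
  defines "w \<equiv> \<lambda>n. a n - b n" and "R \<equiv> (\<Sum>n. cmod (b n))"
  shows "cmod (\<Sum>k\<le>K. (cubic a k - cubic b k) * cnj (w k)) \<le>
    (4 * hnorm2 1 w + 9 * R\<^sup>2) * hnorm2 0 w"
proof -
  \<comment> \<open>The sum over \<open>k \<le> K\<close> is a pairing with the truncation \<open>d\<close> of \<open>w\<close>, to which duality applies.\<close>
  define d where "d n = (if n \<le> K then w n else 0)" for n
  define p where "p = (\<lambda>n. conv w w n + 2 * conv b w n)"
  have w: "w \<in> hseq 1" unfolding w_def by (rule hseq_diff(1)[OF assms(1,2)])
  have h0: "a \<in> hseq 0" "b \<in> hseq 0" "w \<in> hseq 0"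
    using assms(1,2) w hseq_weaken by auto
  define W where "W = hnorm2 0 w"
  define H where "H = hnorm2 1 w"
  have pos: "0 \<le> W" "0 \<le> H" using hnorm2_nonneg h0 w by (auto simp: W_def H_def)
  have dw: "cmod (d n) \<le> cmod (w n)" for n by (simp add: d_def)
  have d: "d \<in> hseq 1" "hnorm2 1 d \<le> H" "d \<in> hseq 0" "hnorm2 0 d \<le> W"
    using hseq_mono[OF w _ dw, of 1] hseq_mono[OF h0(3) _ dw, of 0] by (auto simp: W_def H_def)
  have p: "p \<in> hseq 0" "hnorm2 0 p \<le> (4 * H + 8 * R\<^sup>2) * W"
    using hnorm2_conv_diff_le[OF w h0(2) assms(3)] by (auto simp: p_def H_def W_def R_def)
  have ad_eq: "conv a d = (\<lambda>n. conv w d n + conv b d n)"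
    by (simp add: conv_add_left[symmetric] w_def)
  have wd: "conv w d \<in> hseq 0" "hnorm2 0 (conv w d) \<le> 2 * H * W"
  proof -
    show "conv w d \<in> hseq 0" by (rule hnorm2_conv_le[OF w d(1)])
    have "hnorm2 0 (conv w d) \<le> H * hnorm2 0 d + W * hnorm2 1 d"
      using hnorm2_conv_le(2)[OF w d(1)] by (simp add: H_def W_def)
    also have "\<dots> \<le> H * W + W * H"
      by (intro add_mono mult_left_mono d pos)
    finally show "hnorm2 0 (conv w d) \<le> 2 * H * W" by simp
  qed
  have bd: "conv b d \<in> hseq 0" "hnorm2 0 (conv b d) \<le> R\<^sup>2 * W"
    using hnorm2_conv_l1_le[OF assms(3) d(3)] mult_left_mono[OF d(4), of "R\<^sup>2"]
    by (auto simp: R_def)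
  have ad: "conv a d \<in> hseq 0" "hnorm2 0 (conv a d) \<le> (4 * H + 2 * R\<^sup>2) * W"
    using hseq_add[OF wd(1) bd(1)] wd(2) bd(2) by (auto simp: ad_eq algebra_simps)
  have bb: "summable (\<lambda>n. cmod (conv b b n))" "(\<Sum>n. cmod (conv b b n)) \<le> R\<^sup>2"
    using conv_l1[OF assms(3,3)] by (auto simp: R_def power2_eq_square)
  have bb0: "conv b b \<in> hseq 0" by (rule hnorm2_conv_l1_le[OF assms(3) h0(2)])
  have s1: "(\<lambda>n. p n * cnj (conv a d n)) sums (\<Sum>k\<le>K. corr p a k * cnj (d k))"
    by (rule corr_conv_duality) (use p h0 in \<open>auto simp: d_def\<close>)
  have s2: "(\<lambda>n. conv b b n * cnj (conv w d n)) sums (\<Sum>k\<le>K. corr (conv b b) w k * cnj (d k))"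
    by (rule corr_conv_duality) (use bb0 h0 in \<open>auto simp: d_def\<close>)
  have b1: "cmod (\<Sum>k\<le>K. corr p a k * cnj (d k)) \<le> (4 * H + 8 * R\<^sup>2) * W"
  proof -
    have "cmod (\<Sum>k\<le>K. corr p a k * cnj (d k)) \<le> sqrt (hnorm2 0 p) * sqrt (hnorm2 0 (conv a d))"
      using cmod_suminf_mult_le(2)[OF p(1) ad(1)] sums_unique[OF s1] by simp
    also have "\<dots> \<le> sqrt ((4 * H + 8 * R\<^sup>2) * W) * sqrt ((4 * H + 8 * R\<^sup>2) * W)"
    proof (intro mult_mono)
      show "sqrt (hnorm2 0 (conv a d)) \<le> sqrt ((4 * H + 8 * R\<^sup>2) * W)"
        using ad(2) pos mult_right_mono[of "4 * H + 2 * R\<^sup>2" "4 * H + 8 * R\<^sup>2" W] by simp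
    qed (use p pos ad hnorm2_nonneg in auto)
    also have "\<dots> = (4 * H + 8 * R\<^sup>2) * W" using pos by simp
    finally show ?thesis .
  qed
  have b2: "cmod (\<Sum>k\<le>K. corr (conv b b) w k * cnj (d k)) \<le> R\<^sup>2 * W"
  proof -
    have le: "cmod (conv b b n * cnj (conv w d n)) \<le> cmod (conv b b n) * W" for n
    proof -
      have "cmod (conv w d n) \<le> sqrt (hnorm2 0 w) * sqrt (hnorm2 0 d)"
        by (rule cmod_conv_le_hnorm2[OF h0(3) d(3)])
      also have "\<dots> \<le> sqrt W * sqrt W"
        by (intro mult_mono) (use d pos hnorm2_nonneg in \<open>auto simp: W_def\<close>)
      finally show ?thesis using pos by (simp add: norm_mult mult_left_mono)
    qed
    have sm: "summable (\<lambda>n. cmod (conv b b n) * W)" by (intro summable_mult2 bb)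
    have sn: "summable (\<lambda>n. cmod (conv b b n * cnj (conv w d n)))"
      by (rule summable_comparison_test'[OF sm, of 0]) (use le in auto)
    have "cmod (\<Sum>k\<le>K. corr (conv b b) w k * cnj (d k)) = cmod (\<Sum>n. conv b b n * cnj (conv w d n))"
      using sums_unique[OF s2] by simp
    also have "\<dots> \<le> (\<Sum>n. cmod (conv b b n * cnj (conv w d n)))" by (rule summable_norm[OF sn])
    also have "\<dots> \<le> (\<Sum>n. cmod (conv b b n) * W)" by (rule suminf_le[OF le sn sm])
    also have "\<dots> = (\<Sum>n. cmod (conv b b n)) * W" by (rule suminf_mult2[OF bb(1), symmetric])
    also have "\<dots> \<le> R\<^sup>2 * W" by (intro mult_right_mono bb pos)
    finally show ?thesis .
  qed
  have "(\<Sum>k\<le>K. (cubic a k - cubic b k) * cnj (w k))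
      = (\<Sum>k\<le>K. corr p a k * cnj (d k)) + (\<Sum>k\<le>K. corr (conv b b) w k * cnj (d k))"
    unfolding sum.distrib[symmetric]
    by (intro sum.cong)
      (auto simp: cubic_diff_eq[OF assms(1,2), folded w_def] d_def p_def algebra_simps)
  then have "cmod (\<Sum>k\<le>K. (cubic a k - cubic b k) * cnj (w k))
      \<le> (4 * H + 8 * R\<^sup>2) * W + R\<^sup>2 * W"
    using norm_triangle_le[OF add_mono[OF b1 b2]] by simp
  then show ?thesis by (simp add: H_def W_def algebra_simps)
qed

section \<open>Stability of the coefficient equations\<close>

lemma has_derivative_cmod_power2:
  assumes "(f has_vector_derivative f') (at t)"
  shows "((\<lambda>t. (cmod (f t))\<^sup>2) has_real_derivative 2 * Re (f' * cnj (f t))) (at t)"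
proof -
  have "((\<lambda>t. Re (f t)) has_real_derivative Re f') (at t)"
    "((\<lambda>t. Im (f t)) has_real_derivative Im f') (at t)"
    unfolding has_real_derivative_iff_has_vector_derivative
    by (rule bounded_linear.has_vector_derivative[OF bounded_linear_Re assms]
      bounded_linear.has_vector_derivative[OF bounded_linear_Im assms])+
  then show ?thesis
    unfolding cmod_power2
    by (rule DERIV_cong[OF DERIV_add[OF DERIV_power DERIV_power]]) (auto simp: algebra_simps)
qed

lemma Gronwall:
  fixes y :: "real \<Rightarrow> real"
  assumes der: "\<And>t. \<bar>t\<bar> \<le> T \<Longrightarrow> (y has_real_derivative y' t) (at t)"
    and le: "\<And>t. \<bar>t\<bar> \<le> T \<Longrightarrow> \<bar>y' t\<bar> \<le> c * y t"
    and t: "\<bar>t\<bar> \<le> T"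
  shows "y t \<le> y 0 * exp (c * \<bar>t\<bar>)"
proof -
  have pos: "x t \<le> x 0 * exp (c * t)"
    if der: "\<And>t. \<bar>t\<bar> \<le> T \<Longrightarrow> (x has_real_derivative x' t) (at t)"
      and le: "\<And>t. \<bar>t\<bar> \<le> T \<Longrightarrow> \<bar>x' t\<bar> \<le> c * x t" and t: "0 \<le> t" "t \<le> T"
    for x x' :: "real \<Rightarrow> real" and t
  proof -
    have "x t * exp (- c * t) \<le> x 0 * exp (- c * 0)"
    proof (rule DERIV_nonpos_imp_nonincreasing[OF t(1)])
      fix s assume s: "0 \<le> s" "s \<le> t"
      have "((\<lambda>t. x t * exp (- c * t)) has_real_derivative
          (x' s - c * x s) * exp (- c * s)) (at s)"
        using s t by (auto intro!: derivative_eq_intros der simp: algebra_simps)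
      moreover have "(x' s - c * x s) * exp (- c * s) \<le> 0"
        using le[of s] s t by (intro mult_nonpos_nonneg) auto
      ultimately show "\<exists>y. ((\<lambda>t. x t * exp (- c * t)) has_real_derivative y) (at s) \<and> y \<le> 0"
        by blast
    qed
    then show ?thesis by (simp add: exp_minus field_simps)
  qed
  show ?thesis
  proof (cases "0 \<le> t")
    case True
    with pos[of y y' t] der le t show ?thesis by auto
  next
    case False
    have "((\<lambda>s. y (- s)) has_real_derivative - y' (- s)) (at s)" if "\<bar>s\<bar> \<le> T" for s
      using DERIV_chain'[OF DERIV_minus[OF DERIV_ident], of y "y' (- s)" s] der[of "- s"] that by simp
    from pos[OF this, of "- t"] le t False show ?thesis by simp
  qed
qed

text \<open>
  The equation for the frequencies \<open>k \<le> K\<close> only. This covers both a true solution (all \<open>K\<close>) and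
  a truncation of the equation to frequencies at most \<open>N \<ge> K\<close>.
\<close>

definition solves_upto :: "real \<Rightarrow> nat \<Rightarrow> (real \<Rightarrow> nat \<Rightarrow> complex) \<Rightarrow> bool" where
  "solves_upto lam K a \<longleftrightarrow> (\<forall>k\<le>K. \<forall>t. ((\<lambda>r. a r k) has_vector_derivative
      - \<i> * (of_real (lam * (real k)\<^sup>2) * a t k + cubic (a t) k)) (at t))"

lemma hnorm2_le_truncation:
  assumes "w \<in> hseq (Suc s)"
  shows "hnorm2 s w \<le> (\<Sum>k\<le>K. wsq s w k) + hnorm2 (Suc s) w / (real K + 1)"
proof -
  have "(\<Sum>k\<le>N. wsq s w k) \<le> (\<Sum>k\<le>K. wsq s w k) + hnorm2 (Suc s) w / (real K + 1)" for N
  proof -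
    have "(\<Sum>k\<le>N. wsq s w k) \<le> (\<Sum>k\<in>{..K} \<union> {K<..N}. wsq s w k)"
      by (rule sum_mono2) auto
    also have "\<dots> = (\<Sum>k\<le>K. wsq s w k) + (\<Sum>k\<in>{K<..N}. wsq s w k)"
      by (rule sum.union_disjoint) auto
    also have "(\<Sum>k\<in>{K<..N}. wsq s w k) \<le> (\<Sum>k\<in>{K<..N}. wsq (Suc s) w k / (real K + 1))"
    proof (rule sum_mono)
      fix k assume "k \<in> {K<..N}"
      then have "wsq s w k * (real K + 1) \<le> wsq s w k * (real k + 1)"
        by (intro mult_left_mono) auto
      then show "wsq s w k \<le> wsq (Suc s) w k / (real K + 1)"
        by (simp add: field_simps wsq_def)
    qed
    also have "\<dots> = (\<Sum>k\<in>{K<..N}. wsq (Suc s) w k) / (real K + 1)"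
      by (simp add: sum_divide_distrib)
    also have "\<dots> \<le> hnorm2 (Suc s) w / (real K + 1)"
      by (intro divide_right_mono sum_le_hnorm2 assms) auto
    finally show ?thesis by simp
  qed
  then show ?thesis by (rule hseqI_bounded(2))
qed

text \<open>
  The low modes of the difference satisfy a Gronwall inequality by
  \<open>cubic_diff_pairing_le\<close>, since the linear part \<open>lam k\<^sup>2\<close> is real and drops out; the high
  modes are small in \<open>\<ell>\<^sup>2\<close> because of the bound in \<open>hseq 1\<close>. The lemma has two uses: truncated
  solutions at different levels form a Cauchy sequence, and an \<open>H\<^sup>1\<^sup>/\<^sup>2\<close> solution coincides
  with an \<open>H\<^sup>1\<close> one (let \<open>K\<close> tend to infinity).
\<close>

lemma stability:
  fixes a b :: "real \<Rightarrow> nat \<Rightarrow> complex"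
  assumes sol: "solves_upto lam K a" "solves_upto lam K b"
    and a: "\<And>t. a t \<in> hseq 1" and b: "\<And>t. b t \<in> hseq 1" "\<And>t. summable (\<lambda>n. cmod (b t n))"
    and init: "\<And>k. k \<le> K \<Longrightarrow> a 0 k = b 0 k"
    and R: "\<And>t. \<bar>t\<bar> \<le> T \<Longrightarrow> (\<Sum>n. cmod (b t n)) \<le> R"
    and H: "\<And>t. \<bar>t\<bar> \<le> T \<Longrightarrow> hnorm2 1 (\<lambda>n. a t n - b t n) \<le> H"
    and t: "\<bar>t\<bar> \<le> T"
  shows "hnorm2 0 (\<lambda>n. a t n - b t n) \<le> H / (real K + 1) * exp (2 * (4 * H + 9 * R\<^sup>2) * T)"
proof -
  define w where "w t = (\<lambda>n. a t n - b t n)" for t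
  \<comment> \<open>\<open>\<delta>\<close> bounds the contribution of the modes above \<open>K\<close>; adding it to \<open>y\<close> closes the inequality.\<close>
  define \<delta> where "\<delta> = H / (real K + 1)"
  define C where "C = 2 * (4 * H + 9 * R\<^sup>2)"
  define y where "y t = (\<Sum>k\<le>K. (cmod (w t k))\<^sup>2) + \<delta>" for t
  define y' where "y' t = 2 * Re (- \<i> * (\<Sum>k\<le>K. (cubic (a t) k - cubic (b t) k) * cnj (w t k)))" for t
  have w1: "w t \<in> hseq 1" for t unfolding w_def by (rule hseq_diff(1)[OF a b(1)])
  then have w0: "w t \<in> hseq 0" for t using hseq_weaken by auto
  have H0: "0 \<le> H" using H[OF t] hnorm2_nonneg[OF w1[of t]] by (simp add: w_def)
  have wy: "hnorm2 0 (w t) \<le> y t" if "\<bar>t\<bar> \<le> T" for t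
  proof -
    have "hnorm2 0 (w t) \<le> (\<Sum>k\<le>K. wsq 0 (w t) k) + hnorm2 1 (w t) / (real K + 1)"
      using hnorm2_le_truncation[of "w t" 0 K] w1 by simp
    also have "\<dots> \<le> y t"
      unfolding y_def \<delta>_def wsq_0 using H[OF that] by (auto simp: w_def intro!: divide_right_mono)
    finally show ?thesis .
  qed
  have der: "(y has_real_derivative y' t) (at t)" for t
  proof -
    define w' where "w' k = - \<i> * (of_real (lam * (real k)\<^sup>2) * w t k + (cubic (a t) k - cubic (b t) k))" for k
    have "((\<lambda>r. w r k) has_vector_derivative w' k) (at t)" if "k \<le> K" for k
    proof -
      have "((\<lambda>r. a r k - b r k) has_vector_derivative
         - \<i> * (of_real (lam * (real k)\<^sup>2) * a t k + cubic (a t) k) -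
         (- \<i> * (of_real (lam * (real k)\<^sup>2) * b t k + cubic (b t) k))) (at t)"
        by (rule has_vector_derivative_diff) (use sol that in \<open>auto simp: solves_upto_def\<close>)
      then show ?thesis by (simp add: w_def w'_def algebra_simps)
    qed
    from has_derivative_cmod_power2[OF this]
    have "(y has_real_derivative (\<Sum>k\<le>K. 2 * Re (w' k * cnj (w t k)))) (at t)"
      unfolding y_def by (intro DERIV_cong[OF DERIV_add[OF DERIV_sum DERIV_const]]) auto
    moreover have "Re (w' k * cnj (w t k)) =
        Re (- \<i> * ((cubic (a t) k - cubic (b t) k) * cnj (w t k)))" for k
      unfolding w'_def by (simp add: algebra_simps)
    moreover have "y' t = (\<Sum>k\<le>K. 2 * Re (- \<i> * ((cubic (a t) k - cubic (b t) k) * cnj (w t k))))"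
      unfolding y'_def by (simp only: sum_distrib_left Re_sum)
    ultimately show ?thesis by (simp only:)
  qed
  have le: "\<bar>y' t\<bar> \<le> C * y t" if "\<bar>t\<bar> \<le> T" for t
  proof -
    have "\<bar>y' t\<bar> \<le> 2 * cmod (- \<i> * (\<Sum>k\<le>K. (cubic (a t) k - cubic (b t) k) * cnj (w t k)))"
      unfolding y'_def abs_mult by (intro mult_mono abs_Re_le_cmod) auto
    also have "\<dots> = 2 * cmod (\<Sum>k\<le>K. (cubic (a t) k - cubic (b t) k) * cnj (w t k))"
      by (simp add: norm_mult)
    also have "\<dots> \<le> 2 * ((4 * hnorm2 1 (w t) + 9 * (\<Sum>n. cmod (b t n))\<^sup>2) * hnorm2 0 (w t))"
      using cubic_diff_pairing_le[OF a[of t] b(1)[of t] b(2)] by (simp add: w_def)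
    also have "\<dots> \<le> 2 * ((4 * H + 9 * R\<^sup>2) * y t)"
      using H[OF that] R[OF that] wy[OF that] b(2)
      by (intro mult_left_mono mult_mono add_mono power_mono)
        (auto simp: w_def[symmetric] hnorm2_nonneg w0 H0 suminf_nonneg)
    finally show ?thesis by (simp only: C_def mult.assoc)
  qed
  have "y t \<le> y 0 * exp (C * \<bar>t\<bar>)" by (rule Gronwall[of T y y', OF der le t])
  also have "y 0 = \<delta>" by (simp add: y_def w_def init)
  also have "\<delta> * exp (C * \<bar>t\<bar>) \<le> \<delta> * exp (C * T)"
  proof (intro mult_left_mono)
    have "C * \<bar>t\<bar> \<le> C * T" using t H0 by (intro mult_left_mono) (auto simp: C_def)
    then show "exp (C * \<bar>t\<bar>) \<le> exp (C * T)" by simp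
  qed (use H0 in \<open>simp add: \<delta>_def\<close>)
  finally show ?thesis using wy[OF t] by (simp add: w_def \<delta>_def C_def)
qed

section \<open>Global solutions of Lipschitz differential equations\<close>

lemma antiderivative_on_line:
  fixes g :: "real \<Rightarrow> 'a::banach"
  assumes "continuous_on UNIV g"
  shows "\<exists>G. G 0 = 0 \<and> (\<forall>t. (G has_vector_derivative g t) (at t))"
proof -
  define G where "G t = integral {0..t} g - integral {t..0} g" for t
  have G0: "G 0 = 0" by (simp add: G_def)
  have int: "g integrable_on {a..b}" for a b
    by (intro integrable_continuous_real continuous_on_subset[OF assms]) auto
  have "(G has_vector_derivative g t) (at t)" for t
  proof -
    define T where "T = \<bar>t\<bar> + 1"
    have "((\<lambda>u. integral {- T..u} g) has_vector_derivative g t) (at t within {- T..T})"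
      by (rule integral_has_vector_derivative[OF continuous_on_subset[OF assms]]) (auto simp: T_def)
    then have "((\<lambda>u. integral {- T..u} g) has_vector_derivative g t) (at t)"
      by (subst (asm) at_within_interior) (auto simp: T_def)
    then have "((\<lambda>u. integral {- T..u} g - integral {- T..0} g) has_vector_derivative g t - 0) (at t)"
      by (intro has_vector_derivative_diff has_vector_derivative_const)
    then have d: "((\<lambda>u. integral {- T..u} g - integral {- T..0} g) has_vector_derivative g t) (at t)"
      by simp
    have eq: "integral {- T..u} g - integral {- T..0} g = G u" if "u \<in> {- T<..<T}" for u
    proof (cases "0 \<le> u")
      case True
      then have "integral {- T..0} g + integral {0..u} g = integral {- T..u} g"
        by (intro Henstock_Kurzweil_Integration.integral_combine int) (auto simp: T_def)
      moreover have "integral {u..0} g = 0" using True by (cases "u = 0") auto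
      ultimately show ?thesis by (simp add: G_def algebra_simps)
    next
      case False
      then have "integral {- T..u} g + integral {u..0} g = integral {- T..0} g"
        using that by (intro Henstock_Kurzweil_Integration.integral_combine int) auto
      then show ?thesis using False by (simp add: G_def algebra_simps)
    qed
    show ?thesis
      by (rule has_vector_derivative_transform_within_open[OF d, of "{- T<..<T}"])
        (use eq in \<open>auto simp: T_def\<close>)
  qed
  with G0 show ?thesis by blast
qed

text \<open>
  An integral estimate stated for antiderivatives, valid on both sides of 0 without
  oriented integrals.
\<close>

lemma norm_le_exp_of_derivative:
  fixes G :: "real \<Rightarrow> 'a::real_normed_vector"
  assumes der: "\<And>t. (G has_vector_derivative g t) (at t)"
    and le: "\<And>t. norm (g t) \<le> C * exp (K * \<bar>t\<bar>)" and K: "K > 0"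
  shows "norm (G t - G 0) \<le> C / K * exp (K * \<bar>t\<bar>)"
proof -
  have C0: "0 \<le> C" using order_trans[OF norm_ge_zero le[of 0]] by simp
  have pos: "norm (F t - F 0) \<le> C / K * exp (K * t)"
    if der: "\<And>t. (F has_vector_derivative f t) (at t)"
      and le: "\<And>t. norm (f t) \<le> C * exp (K * \<bar>t\<bar>)" and t: "0 < t" for F f t
  proof -
    have "norm (F t - F 0) \<le> C / K * exp (K * t) - C / K * exp (K * 0)"
    proof (rule differentiable_bound_general[OF t])
      show "continuous_on {0..t} F"
        by (meson der has_vector_derivative_continuous continuous_at_imp_continuous_on)
      show "continuous_on {0..t} (\<lambda>t. C / K * exp (K * t))" by (intro continuous_intros)
      fix s assume s: "0 < s" "s < t"
      show "(F has_vector_derivative f s) (at s)" by (rule der)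
      show "((\<lambda>t. C / K * exp (K * t)) has_vector_derivative C * exp (K * s)) (at s)"
        unfolding has_real_derivative_iff_has_vector_derivative[symmetric]
        using K by (auto intro!: derivative_eq_intros)
      show "norm (f s) \<le> C * exp (K * s)" using le[of s] s by simp
    qed
    also have "\<dots> \<le> C / K * exp (K * t)" using C0 K by simp
    finally show ?thesis .
  qed
  consider "t = 0" | "0 < t" | "t < 0" by linarith
  then show ?thesis
  proof cases
    case 1
    then show ?thesis using C0 K by simp
  next
    case 2
    then show ?thesis using pos[OF der le] by simp
  next
    case 3
    have "((\<lambda>s. G (- s)) has_vector_derivative - g (- s)) (at s)" for s
    proof -
      have "(uminus has_vector_derivative (- 1)) (at s)"
        unfolding has_real_derivative_iff_has_vector_derivative[symmetric]
        by (rule DERIV_cong[OF DERIV_minus[OF DERIV_ident]]) simp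
      from vector_diff_chain_at[OF this der] show ?thesis by (simp add: o_def)
    qed
    moreover have "norm (- g (- s)) \<le> C * exp (K * \<bar>s\<bar>)" for s using le[of "- s"] by simp
    ultimately have "norm (G (- (- t)) - G (- 0)) \<le> C / K * exp (K * (- t))"
      using 3 by (intro pos) auto
    then show ?thesis using 3 by simp
  qed
qed

text \<open>
  Picard iteration in the space of curves \<open>y\<close> with \<open>exp (- K |t|) y t\<close> bounded. For \<open>K\<close> larger
  than the Lipschitz constant the integral operator is a contraction on the whole line, so
  no continuation argument is needed.
\<close>

lemma Picard_Lindeloef_global:
  fixes f :: "'a::banach \<Rightarrow> 'a"
  assumes lip: "\<And>x y. norm (f x - f y) \<le> L * norm (x - y)"
  obtains y where "y 0 = y0" "\<And>t. (y has_vector_derivative f (y t)) (at t)"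
proof -
  define K where "K = 2 * (\<bar>L\<bar> + 1)"
  have K: "K > 0" by (simp add: K_def)
  have lip': "norm (f x - f y) \<le> K / 2 * norm (x - y)" for x y
  proof -
    have "L * norm (x - y) \<le> K / 2 * norm (x - y)" by (intro mult_right_mono) (auto simp: K_def)
    then show ?thesis using lip[of x y] by linarith
  qed
  have cf: "continuous_on UNIV f"
  proof -
    have "(K/2)-lipschitz_on UNIV f"
      by (rule lipschitz_onI) (use lip' K in \<open>auto simp: dist_norm\<close>)
    then show ?thesis by (rule lipschitz_on_continuous_on)
  qed
  \<comment> \<open>The unknown is \<open>z t = exp (- K |t|) y t\<close>, a bounded continuous function.\<close>
  define F where "F z s = f (exp (K * \<bar>s\<bar>) *\<^sub>R apply_bcontfun z s)" for z :: "real \<Rightarrow>\<^sub>C 'a" and s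
  have F_cont: "continuous_on UNIV (F z)" for z
    unfolding F_def
    by (rule continuous_on_compose2[OF cf]) (auto intro!: continuous_intros)
  define G where "G z = (SOME G. G 0 = 0 \<and> (\<forall>t. (G has_vector_derivative F z t) (at t)))" for z
  have G: "G z 0 = 0" "(G z has_vector_derivative F z t) (at t)" for z t
  proof -
    from someI_ex[OF antiderivative_on_line[OF F_cont[of z]], folded G_def]
    show "G z 0 = 0" "(G z has_vector_derivative F z t) (at t)" by auto
  qed
  have F_diff: "norm (F z s - F z' s) \<le> (K / 2 * dist z z') * exp (K * \<bar>s\<bar>)" for z z' s
  proof -
    have "norm (F z s - F z' s)
        \<le> K / 2 * norm (exp (K * \<bar>s\<bar>) *\<^sub>R apply_bcontfun z s - exp (K * \<bar>s\<bar>) *\<^sub>R apply_bcontfun z' s)"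
      unfolding F_def by (rule lip')
    also have "\<dots> = K / 2 * (exp (K * \<bar>s\<bar>) * dist (apply_bcontfun z s) (apply_bcontfun z' s))"
      by (simp add: scaleR_diff_right[symmetric] dist_norm)
    also have "\<dots> \<le> K / 2 * (exp (K * \<bar>s\<bar>) * dist z z')"
      using K by (intro mult_left_mono dist_bounded) auto
    finally show ?thesis by (simp add: mult_ac)
  qed
  define \<Psi> where "\<Psi> z t = exp (- K * \<bar>t\<bar>) *\<^sub>R (y0 + G z t)" for z t
  have Psi_diff: "norm (\<Psi> z t - \<Psi> z' t) \<le> dist z z' / 2" for z z' t
  proof -
    have "norm ((G z t - G z' t) - (G z 0 - G z' 0)) \<le> (K / 2 * dist z z') / K * exp (K * \<bar>t\<bar>)"
      by (rule norm_le_exp_of_derivative[OF has_vector_derivative_diff[OF G(2) G(2)] F_diff K])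
    then have *: "norm (G z t - G z' t) \<le> dist z z' / 2 * exp (K * \<bar>t\<bar>)"
      using K by (simp add: G)
    have "norm (\<Psi> z t - \<Psi> z' t) = exp (- K * \<bar>t\<bar>) * norm (G z t - G z' t)"
      by (simp add: \<Psi>_def scaleR_diff_right[symmetric])
    also have "\<dots> \<le> exp (- K * \<bar>t\<bar>) * (dist z z' / 2 * exp (K * \<bar>t\<bar>))"
      by (intro mult_left_mono *) auto
    also have "\<dots> = dist z z' / 2" by (simp add: exp_minus field_simps)
    finally show ?thesis .
  qed
  have Psi_cont: "continuous_on UNIV (\<Psi> z)" for z
  proof -
    have "continuous_on UNIV (G z)"
      by (meson G(2) has_vector_derivative_continuous continuous_at_imp_continuous_on)
    then show ?thesis unfolding \<Psi>_def by (intro continuous_intros)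
  qed
  have Psi0_bdd: "norm (\<Psi> 0 t) \<le> norm y0 + norm (f 0) / K" for t
  proof -
    have "norm (G 0 t - G 0 0) \<le> norm (f 0) / K * exp (K * \<bar>t\<bar>)"
    proof (rule norm_le_exp_of_derivative[OF G(2) _ K])
      show "norm (F 0 t) \<le> norm (f 0) * exp (K * \<bar>t\<bar>)" for t
        using K mult_left_mono[of 1 "exp (K * \<bar>t\<bar>)" "norm (f 0)"] by (simp add: F_def)
    qed
    then have "norm (y0 + G 0 t) \<le> norm y0 + norm (f 0) / K * exp (K * \<bar>t\<bar>)"
      by (intro order_trans[OF norm_triangle_ineq]) (simp add: G)
    also have "\<dots> \<le> norm y0 * exp (K * \<bar>t\<bar>) + norm (f 0) / K * exp (K * \<bar>t\<bar>)"
      using K mult_left_mono[of 1 "exp (K * \<bar>t\<bar>)" "norm y0"] by simp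
    finally have "norm (y0 + G 0 t) \<le> (norm y0 + norm (f 0) / K) * exp (K * \<bar>t\<bar>)"
      by (simp add: distrib_right)
    then have "exp (- K * \<bar>t\<bar>) * norm (y0 + G 0 t)
        \<le> exp (- K * \<bar>t\<bar>) * ((norm y0 + norm (f 0) / K) * exp (K * \<bar>t\<bar>))"
      by (intro mult_left_mono) auto
    also have "\<dots> = norm y0 + norm (f 0) / K" by (simp add: exp_minus)
    finally show ?thesis by (simp add: \<Psi>_def)
  qed
  have Psi_bcont: "\<Psi> z \<in> bcontfun" for z
  proof (rule bcontfun_normI[OF Psi_cont])
    fix t
    have "norm (\<Psi> z t) \<le> norm (\<Psi> 0 t) + norm (\<Psi> z t - \<Psi> 0 t)"
      by (metis add.commute diff_add_cancel norm_triangle_ineq)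
    also have "\<dots> \<le> norm y0 + norm (f 0) / K + dist z 0 / 2"
      by (intro add_mono Psi0_bdd Psi_diff)
    finally show "norm (\<Psi> z t) \<le> norm y0 + norm (f 0) / K + dist z 0 / 2" .
  qed
  have "\<exists>!z. Bcontfun (\<Psi> z) = z"
  proof (rule banach_fix_type)
    show "\<forall>z z'. dist (Bcontfun (\<Psi> z)) (Bcontfun (\<Psi> z')) \<le> 1/2 * dist z z'"
    proof (intro allI dist_bound)
      fix z z' t
      show "dist (apply_bcontfun (Bcontfun (\<Psi> z)) t) (apply_bcontfun (Bcontfun (\<Psi> z')) t) \<le> 1/2 * dist z z'"
        using Psi_diff[of z t z'] by (simp add: Bcontfun_inverse[OF Psi_bcont] dist_norm)
    qed
  qed auto
  then obtain z where z: "Bcontfun (\<Psi> z) = z" by blast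
  have zt: "apply_bcontfun z t = \<Psi> z t" for t
    using z Bcontfun_inverse[OF Psi_bcont[of z]] by metis
  have e: "exp (K * \<bar>t\<bar>) *\<^sub>R apply_bcontfun z t = y0 + G z t" for t
    by (simp add: zt \<Psi>_def exp_minus)
  show thesis
  proof (rule that[of "\<lambda>t. y0 + G z t"])
    show "y0 + G z 0 = y0" by (simp add: G)
    fix t
    have "((\<lambda>t. y0 + G z t) has_vector_derivative 0 + F z t) (at t)"
      by (intro has_vector_derivative_add has_vector_derivative_const G)
    then show "((\<lambda>t. y0 + G z t) has_vector_derivative f (y0 + G z t)) (at t)"
      by (simp add: F_def e)
  qed
qed

section \<open>Truncated equations and their conservation laws\<close>

instance bcontfun :: (metric_space, banach) banach ..

text \<open>
  The cubic vector field is only locally Lipschitz. Composing it with the retraction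
  \<open>x \<mapsto> radial_cutoff M x * x\<close> onto a ball makes it globally Lipschitz. The retraction
  multiplies by a real scalar, so by \<open>cubic_scale\<close> the nonlinearity itself is multiplied by a
  real scalar; this leaves the conservation of mass intact.
\<close>

definition radial_cutoff :: "real \<Rightarrow> 'a::real_normed_vector \<Rightarrow> real" where
  "radial_cutoff M x = (if norm x \<le> M then 1 else M / norm x)"

lemma norm_radial_retraction_le:
  assumes "M > 0"
  shows "norm (radial_cutoff M x *\<^sub>R x) \<le> M"
  using assms by (auto simp: radial_cutoff_def)

lemma radial_retraction_lipschitz:
  fixes x y :: "'a::real_normed_vector"
  assumes M: "M > 0"
  shows "norm (radial_cutoff M x *\<^sub>R x - radial_cutoff M y *\<^sub>R y) \<le> 2 * norm (x - y)"
proof -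
  have one: "norm (x - radial_cutoff M y *\<^sub>R y) \<le> 2 * norm (x - y)"
    if "norm x \<le> M" "\<not> norm y \<le> M" for x y :: 'a
  proof -
    have y: "norm y > 0" using that M by linarith
    have "norm (x - radial_cutoff M y *\<^sub>R y) \<le> norm (x - y) + norm (y - (M / norm y) *\<^sub>R y)"
      using norm_triangle_ineq[of "x - y" "y - (M / norm y) *\<^sub>R y"] that by (simp add: radial_cutoff_def)
    also have "y - (M / norm y) *\<^sub>R y = (1 - M / norm y) *\<^sub>R y" by (simp add: scaleR_diff_left)
    also have "norm ((1 - M / norm y) *\<^sub>R y) = norm y - M"
      using that y M by (simp add: field_simps)
    also have "norm (x - y) + (norm y - M) \<le> 2 * norm (x - y)"
      using that norm_triangle_ineq2[of y x] by (simp add: norm_minus_commute)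
    finally show ?thesis .
  qed
  consider "norm x \<le> M" "norm y \<le> M" | "norm x \<le> M" "\<not> norm y \<le> M"
    | "\<not> norm x \<le> M" "norm y \<le> M" | "\<not> norm x \<le> M" "\<not> norm y \<le> M" by blast
  then show ?thesis
  proof cases
    case 1
    then show ?thesis by (simp add: radial_cutoff_def)
  next
    case 2
    then show ?thesis using one[of x y] by (simp add: radial_cutoff_def)
  next
    case 3
    then show ?thesis using one[of y x] by (simp add: radial_cutoff_def norm_minus_commute)
  next
    case 4
    then have xy: "norm x > 0" "norm y > 0" using M by linarith+
    have "(M / norm x) *\<^sub>R x - (M / norm y) *\<^sub>R y
        = (M / norm x) *\<^sub>R (x - y) + (M / norm x - M / norm y) *\<^sub>R y"
      by (simp add: scaleR_diff_left scaleR_diff_right)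
    then have "norm ((M / norm x) *\<^sub>R x - (M / norm y) *\<^sub>R y)
        \<le> M / norm x * norm (x - y) + \<bar>M / norm x - M / norm y\<bar> * norm y"
      using norm_triangle_ineq[of "(M / norm x) *\<^sub>R (x - y)" "(M / norm x - M / norm y) *\<^sub>R y"] M
      by simp
    also have "\<bar>M / norm x - M / norm y\<bar> * norm y = M / norm x * \<bar>norm y - norm x\<bar>"
    proof -
      have "M / norm x - M / norm y = M / norm x * ((norm y - norm x) / norm y)"
        using xy by (simp add: field_simps)
      then show ?thesis using xy M by (simp add: abs_mult)
    qed
    also have "M / norm x * norm (x - y) + M / norm x * \<bar>norm y - norm x\<bar>
        \<le> M / norm x * (2 * norm (x - y))"
      using norm_triangle_ineq3[of x y] M xy
      by (subst distrib_left[symmetric], intro mult_left_mono) (auto simp: abs_minus_commute)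
    also have "\<dots> \<le> 1 * (2 * norm (x - y))"
      using 4 M xy by (intro mult_right_mono) auto
    finally show ?thesis using 4 by (simp add: radial_cutoff_def)
  qed
qed

definition trunc :: "nat \<Rightarrow> (nat \<Rightarrow> complex) \<Rightarrow> nat \<Rightarrow> complex" where
  "trunc N a n = (if n \<le> N then a n else 0)"

lemma trunc_beyond: "N < n \<Longrightarrow> trunc N a n = 0"
  by (simp add: trunc_def)

lemma hseq_trunc: "trunc N a \<in> hseq s"
  by (rule hseq_finite_support(1)[OF trunc_beyond])

lemma hnorm2_trunc: "hnorm2 s (trunc N a) = (\<Sum>n\<le>N. wsq s a n)"
  using hseq_finite_support(2)[of N "trunc N a" s] by (simp add: trunc_def wsq_def)

lemma hnorm2_trunc_le:
  assumes "\<And>n. cmod (a n) \<le> D"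
  shows "hnorm2 s (trunc N a) \<le> (real N + 1) ^ (s + 1) * D\<^sup>2"
proof -
  have "hnorm2 s (trunc N a) \<le> (\<Sum>n\<le>N. (real N + 1) ^ s * D\<^sup>2)"
    unfolding hnorm2_trunc wsq_def using assms
    by (intro sum_mono mult_mono power_mono) auto
  then show ?thesis by (simp add: algebra_simps)
qed

lemma cubic_trunc_lipschitz:
  obtains L where "\<And>x y D k. (\<And>n. cmod (x n) \<le> M) \<Longrightarrow> (\<And>n. cmod (y n) \<le> M) \<Longrightarrow>
    (\<And>n. cmod (x n - y n) \<le> D) \<Longrightarrow> cmod (cubic (trunc N x) k - cubic (trunc N y) k) \<le> L * D"
proof
  fix x y :: "nat \<Rightarrow> complex" and D k
  assume x: "\<And>n. cmod (x n) \<le> M" and y: "\<And>n. cmod (y n) \<le> M"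
    and D: "\<And>n. cmod (x n - y n) \<le> D"
  define a where "a = trunc N x"
  define b where "b = trunc N y"
  define w where "w n = a n - b n" for n
  define q where "q = real N + 1"
  have q: "q \<ge> 1" by (simp add: q_def)
  have D0: "0 \<le> D" and M0: "0 \<le> M" using D[of 0] x[of 0] norm_ge_zero order_trans by blast+
  have w: "w = trunc N (\<lambda>n. x n - y n)" by (auto simp: w_def a_def b_def trunc_def)
  have xy2: "cmod (x n - y n) \<le> 2 * M" for n
    using norm_triangle_ineq4[of "x n" "y n"] x[of n] y[of n] by linarith
  have R: "summable (\<lambda>n. cmod (b n))" "(\<Sum>n. cmod (b n)) \<le> q * M"
  proof -
    have z: "cmod (b n) = 0" if "n \<notin> {..N}" for n using that by (simp add: b_def trunc_def)
    show "summable (\<lambda>n. cmod (b n))" by (rule summable_finite[of "{..N}"]) (use z in auto)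
    have "(\<Sum>n. cmod (b n)) = (\<Sum>n\<le>N. cmod (b n))" by (rule suminf_finite) (use z in auto)
    also have "\<dots> \<le> (\<Sum>n\<le>N. M)" by (intro sum_mono) (simp add: b_def trunc_def y M0)
    finally show "(\<Sum>n. cmod (b n)) \<le> q * M" by (simp add: q_def algebra_simps)
  qed
  have R0: "0 \<le> (\<Sum>n. cmod (b n))" by (rule suminf_nonneg[OF R(1)]) auto
  have h: "hnorm2 1 w \<le> q\<^sup>2 * (2 * M)\<^sup>2" "hnorm2 0 a \<le> q * M\<^sup>2" "hnorm2 0 b \<le> q * M\<^sup>2" "hnorm2 0 w \<le> q * D\<^sup>2"
    using hnorm2_trunc_le[of _ "2*M" 1 N, OF xy2] hnorm2_trunc_le[of x M 0 N, OF x] 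
      hnorm2_trunc_le[of y M 0 N, OF y] hnorm2_trunc_le[of _ D 0 N, OF D]
    by (auto simp: w a_def b_def q_def power2_eq_square)
  have "cmod (cubic a k - cubic b k) \<le>
    (sqrt (4 * hnorm2 1 w + 8 * (\<Sum>n. cmod (b n))\<^sup>2) * sqrt (hnorm2 0 a) + (\<Sum>n. cmod (b n)) * sqrt (hnorm2 0 b))
      * sqrt (hnorm2 0 w)"
    unfolding w_def by (rule cmod_cubic_diff_le) (auto simp: a_def b_def hseq_trunc R[unfolded b_def])
  also have "\<dots> \<le> (sqrt (4 * (q\<^sup>2 * (2 * M)\<^sup>2) + 8 * (q * M)\<^sup>2) * sqrt (q * M\<^sup>2) + (q * M) * sqrt (q * M\<^sup>2))
      * sqrt (q * D\<^sup>2)"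
    using h R R0 M0 q hnorm2_nonneg[OF hseq_trunc]
    by (intro mult_mono add_mono real_sqrt_le_mono power_mono) (auto simp: a_def b_def w)
  also have "\<dots> = (sqrt (4 * (q\<^sup>2 * (2 * M)\<^sup>2) + 8 * (q * M)\<^sup>2) * sqrt (q * M\<^sup>2) + (q * M) * sqrt (q * M\<^sup>2))
      * sqrt q * D"
    using D0 by (simp add: real_sqrt_mult)
  finally show "cmod (cubic (trunc N x) k - cubic (trunc N y) k) \<le>
    (sqrt (4 * ((real N + 1)\<^sup>2 * (2 * M)\<^sup>2) + 8 * ((real N + 1) * M)\<^sup>2) * sqrt ((real N + 1) * M\<^sup>2)
      + ((real N + 1) * M) * sqrt ((real N + 1) * M\<^sup>2)) * sqrt (real N + 1) * D"
    by (simp add: a_def b_def q_def)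
qed

text \<open>
  The identity \<open>\<integral> \<Pi>(|u|\<^sup>2u) \<cdot> cnj u = \<integral> |u|\<^sup>4\<close>; what matters for the mass is that it is real.
\<close>

lemma cubic_pairing_self:
  assumes "\<And>n. n > N \<Longrightarrow> a n = 0"
  shows "(\<Sum>k\<le>N. cubic a k * cnj (a k)) = of_real (hnorm2 0 (conv a a))"
proof -
  note fs = hseq_finite_support[OF assms]
  have c0: "conv a a \<in> hseq 0" by (rule hnorm2_conv_le(1)[OF fs(1) fs(1)])
  have "(\<lambda>n. conv a a n * cnj (conv a a n)) sums (\<Sum>k\<le>N. cubic a k * cnj (a k))"
    unfolding cubic_def by (rule corr_conv_duality[OF c0 fs(1) assms])
  moreover have "(\<lambda>n. complex_of_real (wsq 0 (conv a a) n)) sums complex_of_real (hnorm2 0 (conv a a))"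
    unfolding hnorm2_def
    by (rule sums_of_real[OF summable_sums]) (use c0 in \<open>simp add: hseq_def\<close>)
  ultimately show ?thesis
    by (simp add: wsq_0 complex_norm_square[symmetric] sums_iff)
qed

lemma constant_of_zero_derivative:
  fixes f :: "real \<Rightarrow> 'a::real_normed_vector"
  assumes "\<And>t. (f has_vector_derivative 0) (at t)"
  shows "f t = f 0"
proof -
  obtain c where "\<And>x. x \<in> UNIV \<Longrightarrow> f x = c"
    using has_vector_derivative_zero_constant[of UNIV f] assms by auto
  then show ?thesis by simp
qed

text \<open>
  The truncated equation with a real, time-dependent factor in front of the nonlinearity, as
  produced by the radial cutoff.
\<close>

definition solves_damped :: "real \<Rightarrow> nat \<Rightarrow> (real \<Rightarrow> real) \<Rightarrow> (real \<Rightarrow> nat \<Rightarrow> complex) \<Rightarrow> bool" where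
  "solves_damped lam N c a \<longleftrightarrow> (\<forall>k\<le>N. \<forall>t. ((\<lambda>r. a r k) has_vector_derivative
      - \<i> * (of_real (lam * (real k)\<^sup>2) * a t k + of_real (c t) * cubic (a t) k)) (at t))"

lemma mass_conservation:
  assumes sol: "solves_damped lam N c a" and supp: "\<And>t k. N < k \<Longrightarrow> a t k = 0"
  shows "hnorm2 0 (a t) = hnorm2 0 (a 0)"
proof -
  define a' where "a' t k = - \<i> * (of_real (lam * (real k)\<^sup>2) * a t k + of_real (c t) * cubic (a t) k)" for t k
  have der: "((\<lambda>r. a r k) has_vector_derivative a' t k) (at t)" if "k \<le> N" for t k
    using sol that by (simp add: solves_damped_def a'_def)
  have h: "hnorm2 0 (a t) = (\<Sum>k\<le>N. (cmod (a t k))\<^sup>2)" for t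
    using hseq_finite_support(2)[OF supp] by (simp add: wsq_0)
  have "((\<lambda>t. \<Sum>k\<le>N. (cmod (a t k))\<^sup>2) has_real_derivative (\<Sum>k\<le>N. 2 * Re (a' t k * cnj (a t k)))) (at t)" for t
    by (intro DERIV_sum has_derivative_cmod_power2) (use der in auto)
  moreover have "(\<Sum>k\<le>N. 2 * Re (a' t k * cnj (a t k))) = 0" for t
  proof -
    have "Re (a' t k * cnj (a t k)) = Re (- \<i> * of_real (c t) * (cubic (a t) k * cnj (a t k)))" for k
      by (simp add: a'_def algebra_simps)
    then have "(\<Sum>k\<le>N. 2 * Re (a' t k * cnj (a t k)))
        = 2 * Re (- \<i> * of_real (c t) * (\<Sum>k\<le>N. cubic (a t) k * cnj (a t k)))"
      by (simp only: sum_distrib_left Re_sum)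
    also have "(\<Sum>k\<le>N. cubic (a t) k * cnj (a t k)) = of_real (hnorm2 0 (conv (a t) (a t)))"
      by (rule cubic_pairing_self[OF supp])
    finally have "(\<Sum>k\<le>N. 2 * Re (a' t k * cnj (a t k)))
        = 2 * Re (- \<i> * of_real (c t) * of_real (hnorm2 0 (conv (a t) (a t))))" .
    also have "\<dots> = 0" by simp
    finally show ?thesis .
  qed
  ultimately have "((\<lambda>t. \<Sum>k\<le>N. (cmod (a t k))\<^sup>2) has_vector_derivative 0) (at t)" for t
    by (simp add: has_real_derivative_iff_has_vector_derivative)
  from constant_of_zero_derivative[OF this] show ?thesis by (simp add: h)
qed

text \<open>
  Four times the Hamiltonian \<open>lam/2 \<integral>|\<partial>\<^sub>xu|\<^sup>2 + 1/4 \<integral>|u|\<^sup>4\<close> with the normalised measure, as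
  \<open>hnorm2 0 (conv a a)\<close> is \<open>\<integral>|u\<^sup>2|\<^sup>2\<close>.
\<close>

definition energy :: "real \<Rightarrow> nat \<Rightarrow> (nat \<Rightarrow> complex) \<Rightarrow> real" where
  "energy lam N a = 2 * lam * (\<Sum>k\<le>N. (real k)\<^sup>2 * (cmod (a k))\<^sup>2) + hnorm2 0 (conv a a)"

text \<open>
  The equation is \<open>a' = - \<i> g\<close> where \<open>4 g\<close> is the gradient of the energy, by
  \<open>corr_conv_duality\<close> for the quartic part; and \<open>- \<i> g\<close> is orthogonal to \<open>g\<close>.
\<close>

lemma energy_conservation:
  assumes sol: "solves_upto lam N a" and supp: "\<And>t k. N < k \<Longrightarrow> a t k = 0"
  shows "energy lam N (a t) = energy lam N (a 0)"
proof -
  define g where "g t k = of_real (lam * (real k)\<^sup>2) * a t k + cubic (a t) k" for t k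
  define a' where "a' t k = (if k \<le> N then - \<i> * g t k else 0)" for t k
  have der: "((\<lambda>r. a r k) has_vector_derivative a' t k) (at t)" for t k
    using sol supp by (cases "k \<le> N") (auto simp: solves_upto_def a'_def g_def)
  have bsupp: "conv (a t) (a t) n = 0" if "N + N < n" for t n
    by (rule conv_finite_support[of N _ N]) (use supp that in auto)
  have h: "hnorm2 0 (conv (a t) (a t)) = (\<Sum>n\<le>N + N. (cmod (conv (a t) (a t) n))\<^sup>2)" for t
    using hseq_finite_support(2)[OF bsupp] by (simp add: wsq_0)
  have bder: "((\<lambda>r. conv (a r) (a r) n) has_vector_derivative 2 * conv (a t) (a' t) n) (at t)" for t n
  proof -
    have "((\<lambda>r. conv (a r) (a r) n) has_vector_derivative
        (\<Sum>j\<le>n. a t j * a' t (n - j) + a' t j * a t (n - j))) (at t)"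
      unfolding conv_def by (intro has_vector_derivative_sum has_vector_derivative_mult der)
    also have "(\<Sum>j\<le>n. a t j * a' t (n - j) + a' t j * a t (n - j)) = conv (a t) (a' t) n + conv (a' t) (a t) n"
      by (simp add: conv_def sum.distrib)
    finally show ?thesis by (simp add: conv_commute[of "a' t"])
  qed
  have "((\<lambda>t. energy lam N (a t)) has_real_derivative
      2 * lam * (\<Sum>k\<le>N. (real k)\<^sup>2 * (2 * Re (a' t k * cnj (a t k)))) +
      (\<Sum>n\<le>N+N. 2 * Re ((2 * conv (a t) (a' t) n) * cnj (conv (a t) (a t) n)))) (at t)" for t
    unfolding energy_def h
    by (intro DERIV_add DERIV_cmult DERIV_sum has_derivative_cmod_power2 der bder)
  moreover have "2 * lam * (\<Sum>k\<le>N. (real k)\<^sup>2 * (2 * Re (a' t k * cnj (a t k)))) +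
      (\<Sum>n\<le>N+N. 2 * Re ((2 * conv (a t) (a' t) n) * cnj (conv (a t) (a t) n))) = 0" for t
  proof -
    have a0: "a t \<in> hseq 0" and a1: "a t \<in> hseq 1" by (rule hseq_finite_support(1)[OF supp], simp)+
    have c0: "conv (a t) (a t) \<in> hseq 0" by (rule hnorm2_conv_le[OF a1 a1])
    have "(\<lambda>n. conv (a t) (a t) n * cnj (conv (a t) (a' t) n)) sums (\<Sum>k\<le>N. cubic (a t) k * cnj (a' t k))"
      unfolding cubic_def by (rule corr_conv_duality[OF c0 a0]) (simp add: a'_def)
    moreover have "(\<lambda>n. conv (a t) (a t) n * cnj (conv (a t) (a' t) n)) sums
        (\<Sum>n\<le>N+N. conv (a t) (a t) n * cnj (conv (a t) (a' t) n))"
      by (rule sums_finite) (use bsupp in auto)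
    ultimately have dual: "(\<Sum>n\<le>N+N. conv (a t) (a t) n * cnj (conv (a t) (a' t) n))
        = (\<Sum>k\<le>N. cubic (a t) k * cnj (a' t k))"
      by (rule sums_unique2[symmetric])
    have "(\<Sum>n\<le>N+N. 2 * Re ((2 * conv (a t) (a' t) n) * cnj (conv (a t) (a t) n)))
        = 4 * Re (\<Sum>n\<le>N+N. conv (a t) (a t) n * cnj (conv (a t) (a' t) n))"
      by (simp add: sum_distrib_left algebra_simps)
    also have "\<dots> = (\<Sum>k\<le>N. 4 * Re (cubic (a t) k * cnj (a' t k)))"
      unfolding dual by (simp only: Re_sum sum_distrib_left)
    finally have eq: "2 * lam * (\<Sum>k\<le>N. (real k)\<^sup>2 * (2 * Re (a' t k * cnj (a t k)))) +
      (\<Sum>n\<le>N+N. 2 * Re ((2 * conv (a t) (a' t) n) * cnj (conv (a t) (a t) n)))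
      = (\<Sum>k\<le>N. 2 * lam * ((real k)\<^sup>2 * (2 * Re (a' t k * cnj (a t k)))) + 4 * Re (cubic (a t) k * cnj (a' t k)))"
      by (simp only: sum_distrib_left sum.distrib)
    have "2 * lam * ((real k)\<^sup>2 * (2 * Re (a' t k * cnj (a t k)))) + 4 * Re (cubic (a t) k * cnj (a' t k))
        = 4 * Re (g t k * cnj (a' t k))" for k
      by (simp add: g_def algebra_simps)
    also have "\<dots> k = 0" for k
      by (simp add: a'_def)
    finally show ?thesis unfolding eq by simp
  qed
  ultimately have "((\<lambda>t. energy lam N (a t)) has_vector_derivative 0) (at t)" for t
    by (simp add: has_real_derivative_iff_has_vector_derivative)
  from constant_of_zero_derivative[OF this] show ?thesis .
qed

text \<open>
  The truncated equations for all \<open>N\<close> live in one Banach space, that of bounded sequences, viewed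
  as bounded continuous functions on the discrete space of indices.
\<close>

definition coord :: "(nat discrete \<Rightarrow>\<^sub>C complex) \<Rightarrow> nat \<Rightarrow> complex" where
  "coord x k = apply_bcontfun x (discrete k)"

definition state :: "(nat \<Rightarrow> complex) \<Rightarrow> (nat discrete \<Rightarrow>\<^sub>C complex)" where
  "state g = Bcontfun (\<lambda>d. g (of_discrete d))"

lemma coord_state:
  assumes "\<And>k. N < k \<Longrightarrow> g k = 0"
  shows "coord (state g) = g"
proof -
  have "(\<lambda>d. g (of_discrete d)) \<in> bcontfun"
  proof (rule bcontfun_normI)
    show "continuous_on UNIV (\<lambda>d. g (of_discrete d))"
      by (simp add: continuous_on_open_vimage open_discrete)
    fix d :: "nat discrete"
    show "norm (g (of_discrete d)) \<le> (\<Sum>k\<le>N. norm (g k))"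
      using assms[of "of_discrete d"] member_le_sum[of "of_discrete d" "{..N}" "\<lambda>k. norm (g k)"]
      by (cases "of_discrete d \<le> N") (auto simp: sum_nonneg)
  qed
  then show ?thesis
    by (auto simp: coord_def state_def Bcontfun_inverse discrete_inverse)
qed

lemma cmod_coord_le: "cmod (coord x k) \<le> norm x"
  unfolding coord_def by (rule norm_bounded)

lemma norm_le_coord:
  assumes "\<And>k. cmod (coord x k) \<le> b"
  shows "norm x \<le> b"
proof (rule norm_bound)
  fix d :: "nat discrete"
  show "norm (apply_bcontfun x d) \<le> b"
    using assms[of "of_discrete d"] by (simp add: coord_def of_discrete_inverse)
qed

lemma coord_diff: "coord (x - y) k = coord x k - coord y k"
  and coord_scaleR: "coord (c *\<^sub>R x) k = c *\<^sub>R coord x k"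
  by (simp_all add: coord_def)

lemma bounded_linear_coord: "bounded_linear (\<lambda>x. coord x k)"
  by (rule bounded_linear_intro[where K=1]) (auto simp: coord_def intro: norm_bounded)

text \<open>
  The cut-off equation has a global solution by \<open>Picard_Lindeloef_global\<close>. Its mass is
  conserved, so that its norm never exceeds the cutoff radius, and it solves the equation
  without cutoff.
\<close>

lemma Galerkin_solution:
  obtains a where "\<And>t k. N < k \<Longrightarrow> a t k = 0" "\<And>k. k \<le> N \<Longrightarrow> a 0 k = a0 k" "solves_upto lam N a"
    "\<And>t. hnorm2 0 (a t) = hnorm2 0 (a 0)" "\<And>t. energy lam N (a t) = energy lam N (a 0)"
proof -
  \<comment> \<open>The square root of the mass bounds every coefficient; adding 1 makes the radius positive.\<close>
  define M where "M = sqrt (hnorm2 0 (trunc N a0)) + 1"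
  have M: "M > 0" unfolding M_def using hnorm2_nonneg[OF hseq_trunc] by (smt (verit) real_sqrt_ge_zero)
  define \<rho> where "\<rho> x = radial_cutoff M x *\<^sub>R x" for x :: "nat discrete \<Rightarrow>\<^sub>C complex"
  define F where "F x k = (if k \<le> N then - \<i> * (of_real (lam * (real k)\<^sup>2) * coord x k
      + cubic (trunc N (coord (\<rho> x))) k) else 0)" for x k
  define f where "f x = state (F x)" for x
  have fF: "coord (f x) = F x" for x
    unfolding f_def by (rule coord_state[of N]) (simp add: F_def)
  obtain L where L: "\<And>x y D k. (\<And>n. cmod (x n) \<le> M) \<Longrightarrow> (\<And>n. cmod (y n) \<le> M) \<Longrightarrow>
    (\<And>n. cmod (x n - y n) \<le> D) \<Longrightarrow> cmod (cubic (trunc N x) k - cubic (trunc N y) k) \<le> L * D"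
    by (rule cubic_trunc_lipschitz[of M N]) blast
  have lip: "norm (f x - f y) \<le> (\<bar>lam\<bar> * (real N)\<^sup>2 + L * 2) * norm (x - y)" for x y
  proof (rule norm_le_coord)
    fix k
    have "cmod (cubic (trunc N (coord (\<rho> x))) k - cubic (trunc N (coord (\<rho> y))) k)
        \<le> L * (2 * norm (x - y))"
    proof (rule L)
      fix n
      show "cmod (coord (\<rho> x) n) \<le> M" "cmod (coord (\<rho> y) n) \<le> M"
        unfolding \<rho>_def by (rule order_trans[OF cmod_coord_le norm_radial_retraction_le[OF M]])+
      have "cmod (coord (\<rho> x) n - coord (\<rho> y) n) \<le> norm (\<rho> x - \<rho> y)"
        using cmod_coord_le[of "\<rho> x - \<rho> y" n] by (simp add: coord_diff)
      also have "\<dots> \<le> 2 * norm (x - y)"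
        unfolding \<rho>_def by (rule radial_retraction_lipschitz[OF M])
      finally show "cmod (coord (\<rho> x) n - coord (\<rho> y) n) \<le> 2 * norm (x - y)" .
    qed
    note c = this
    have l: "cmod (coord x k - coord y k) \<le> norm (x - y)"
      using cmod_coord_le[of "x - y" k] by (simp add: coord_diff)
    have L0: "0 \<le> L * (2 * norm (x - y))" using order_trans[OF norm_ge_zero c] .
    show "norm (coord (f x - f y) k) \<le> (\<bar>lam\<bar> * (real N)\<^sup>2 + L * 2) * norm (x - y)"
    proof (cases "k \<le> N")
      case True
      have "coord (f x - f y) k = - \<i> * (of_real (lam * (real k)\<^sup>2) * (coord x k - coord y k)
        + (cubic (trunc N (coord (\<rho> x))) k - cubic (trunc N (coord (\<rho> y))) k))"
        using True by (simp add: coord_diff fF F_def algebra_simps)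
      moreover have "cmod (- \<i> * (of_real r * z + v)) \<le> \<bar>r\<bar> * cmod z + cmod v" for r z v
        using norm_triangle_ineq[of "of_real r * z" v] by (simp add: norm_mult)
      ultimately have "norm (coord (f x - f y) k) \<le> \<bar>lam * (real k)\<^sup>2\<bar> * cmod (coord x k - coord y k)
        + cmod (cubic (trunc N (coord (\<rho> x))) k - cubic (trunc N (coord (\<rho> y))) k)"
        by (simp only:)
      also have "\<dots> \<le> (\<bar>lam\<bar> * (real N)\<^sup>2) * norm (x - y) + L * (2 * norm (x - y))"
        using True by (intro add_mono mult_mono l c) (auto simp: abs_mult intro!: mult_left_mono power_mono)
      finally show ?thesis by (simp add: algebra_simps)
    next
      case False
      then have "coord (f x - f y) k = 0" by (simp add: coord_diff fF F_def)
      moreover have "0 \<le> (\<bar>lam\<bar> * (real N)\<^sup>2 + L * 2) * norm (x - y)"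
        using L0 by (simp add: distrib_right mult.assoc)
      ultimately show ?thesis by simp
    qed
  qed
  obtain y where y: "y 0 = state (trunc N a0)" "\<And>t. (y has_vector_derivative f (y t)) (at t)"
    by (rule Picard_Lindeloef_global[of f, OF lip]) blast
  define a where "a t = coord (y t)" for t
  have der: "((\<lambda>r. a r k) has_vector_derivative F (y t) k) (at t)" for k t
    using bounded_linear.has_vector_derivative[OF bounded_linear_coord y(2)[of t], of k] by (simp add: a_def fF)
  have init: "a 0 = trunc N a0" by (simp add: a_def y coord_state[OF trunc_beyond])
  have supp: "a t k = 0" if "N < k" for t k
    using constant_of_zero_derivative[of "\<lambda>r. a r k" t] der[of k] that init by (simp add: F_def trunc_def)
  then have tr: "trunc N (a t) = a t" for t by (auto simp: trunc_def)
  define c where "c t = radial_cutoff M (y t)" for t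
  have cub: "cubic (trunc N (coord (\<rho> (y t)))) k = of_real ((c t) ^ 3) * cubic (a t) k" for t k
  proof -
    have "trunc N (coord (\<rho> (y t))) = (\<lambda>n. of_real (c t) * a t n)"
      using supp by (auto simp: trunc_def \<rho>_def c_def a_def coord_scaleR scaleR_conv_of_real)
    then show ?thesis using cubic_scale[OF hseq_finite_support(1)[OF supp]] by simp
  qed
  have damped: "solves_damped lam N (\<lambda>t. (c t) ^ 3) a"
    unfolding solves_damped_def
  proof (intro allI impI)
    fix k t assume "k \<le> N"
    then have "F (y t) k = - \<i> * (of_real (lam * (real k)\<^sup>2) * a t k + of_real ((c t) ^ 3) * cubic (a t) k)"
      unfolding F_def cub by (simp add: a_def)
    with der[of k t] show "((\<lambda>r. a r k) has_vector_derivative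
        - \<i> * (of_real (lam * (real k)\<^sup>2) * a t k + of_real ((c t) ^ 3) * cubic (a t) k)) (at t)"
      by (simp only:)
  qed
  note mass = mass_conservation[OF damped supp]
  have "norm (y t) \<le> M" for t
  proof (rule norm_le_coord)
    fix k
    have "(cmod (a t k))\<^sup>2 \<le> hnorm2 0 (a t)"
      using sum_le_hnorm2[of "a t" 0 "{k}", OF hseq_finite_support(1)[OF supp]] by (simp add: wsq_0)
    also have "\<dots> = hnorm2 0 (trunc N a0)" by (simp add: mass init)
    finally have "cmod (a t k) \<le> sqrt (hnorm2 0 (trunc N a0))" by (rule real_le_rsqrt)
    then show "norm (coord (y t) k) \<le> M" by (simp add: a_def M_def)
  qed
  then have "c t = 1" for t by (simp add: c_def radial_cutoff_def)
  then have sol: "solves_upto lam N a"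
    using damped by (simp add: solves_damped_def solves_upto_def)
  show thesis
    by (rule that[OF supp _ sol mass energy_conservation[OF sol supp]]) (auto simp: init trunc_def)
qed

section \<open>Integrable functions on the circle are determined by their Fourier coefficients\<close>

definition circ :: "real measure" where "circ = restrict_space lborel {0..2 * pi}"

interpretation circ: finite_measure circ
  by (rule finite_measureI) (simp add: circ_def emeasure_restrict_space space_restrict_space)

lemma space_circ: "space circ = {0..2 * pi}"
  by (simp add: circ_def space_restrict_space)

lemma measure_circ: "measure circ (space circ) = 2 * pi"
  by (simp add: space_circ) (simp add: circ_def measure_restrict_space)

lemma borel_measurable_circ: "f \<in> borel_measurable borel \<Longrightarrow> f \<in> borel_measurable circ"
  unfolding circ_def by (intro measurable_restrict_space1) simp

lemma integral_circ: "integral\<^sup>L circ f = (LINT x:{0..2 * pi}|lborel. f x)"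
  for f :: "real \<Rightarrow> 'a::{banach, second_countable_topology}"
  unfolding circ_def set_lebesgue_integral_def by (rule integral_restrict_space) simp

lemma integrable_circ: "integrable circ f \<longleftrightarrow> set_integrable lborel {0..2 * pi} f"
  for f :: "real \<Rightarrow> 'a::{banach, second_countable_topology}"
  unfolding circ_def set_integrable_def by (rule integrable_restrict_space) simp

lemma fourier_coeff_circ:
  "fourier_coeff f k = integral\<^sup>L circ (\<lambda>x. f x * cnj (fourier_mode k x)) / (2 * pi)"
  by (simp add: fourier_coeff_def integral_circ)

lemma fourier_mode_cis: "fourier_mode k x = cis (real_of_int k * x)"
  by (simp add: fourier_mode_def cis_conv_exp mult_ac)

lemma fourier_mode_mult: "fourier_mode j x * fourier_mode k x = fourier_mode (j + k) x"
  by (simp add: fourier_mode_cis cis_mult distrib_right)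

lemma cnj_fourier_mode: "cnj (fourier_mode k x) = fourier_mode (- k) x"
  by (simp add: fourier_mode_cis cis_cnj)

lemma norm_fourier_mode [simp]: "cmod (fourier_mode k x) = 1"
  by (simp add: fourier_mode_cis)

lemma fourier_mode_0 [simp]: "fourier_mode 0 x = 1"
  by (simp add: fourier_mode_cis)

lemma continuous_on_fourier_mode: "continuous_on A (fourier_mode k)"
  unfolding fourier_mode_def by (intro continuous_intros)

lemma fourier_mode_borel [measurable]: "fourier_mode k \<in> borel_measurable borel"
  by (rule borel_measurable_continuous_onI[OF continuous_on_fourier_mode])

lemma fourier_mode_periodic: "fourier_mode k (x + 2 * pi) = fourier_mode k x"
proof -
  have "cis (real_of_int k * (x + 2 * pi)) = cis (real_of_int k * x) * cis (2 * pi * real_of_int k)"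
    by (simp add: cis_mult algebra_simps)
  then show ?thesis by (simp add: fourier_mode_cis cis_multiple_2pi)
qed

lemma integral_fourier_mode:
  "integral\<^sup>L circ (fourier_mode k) = (if k = 0 then 2 * pi else 0)"
proof (cases "k = 0")
  case True
  then have "integral\<^sup>L circ (fourier_mode k) = integral\<^sup>L circ (\<lambda>x. 1)"
    by (intro Bochner_Integration.integral_cong) auto
  then show ?thesis using True measure_circ by (simp add: scaleR_conv_of_real)
next
  case False
  define F where "F x = fourier_mode k x / (\<i> * of_int k)" for x
  have "has_bochner_integral lborel (\<lambda>x. indicator {0..2 * pi} x *\<^sub>R fourier_mode k x) (F (2 * pi) - F 0)"
  proof (rule has_bochner_integral_FTC_Icc)
    fix x
    have "((\<lambda>x. exp (\<i> * of_int k * of_real x)) has_vector_derivative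
        of_real 1 * (\<i> * of_int k * exp (\<i> * of_int k * of_real x))) (at x within {0..2 * pi})"
      by (auto intro!: derivative_eq_intros has_vector_derivative_real_field simp: mult_ac)
    then have "((\<lambda>x. exp (\<i> * of_int k * of_real x) / (\<i> * of_int k)) has_vector_derivative
        of_real 1 * (\<i> * of_int k * exp (\<i> * of_int k * of_real x)) / (\<i> * of_int k)) (at x within {0..2 * pi})"
      by (rule has_vector_derivative_divide)
    then show "(F has_vector_derivative fourier_mode k x) (at x within {0..2 * pi})"
      using False by (simp add: F_def[abs_def] fourier_mode_def[abs_def])
  qed (auto intro: continuous_on_fourier_mode)
  moreover have "F (2 * pi) = F 0"
    using fourier_mode_periodic[of k 0] by (simp add: F_def)
  ultimately have "integral\<^sup>L lborel (\<lambda>x. indicator {0..2 * pi} x *\<^sub>R fourier_mode k x) = 0"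
    by (simp add: has_bochner_integral_integral_eq)
  then show ?thesis using False by (simp add: integral_circ set_lebesgue_integral_def)
qed

lemma integrable_circ_mult_bounded:
  fixes f g :: "real \<Rightarrow> complex"
  assumes "integrable circ f" "g \<in> borel_measurable circ" "\<And>x. x \<in> {0..2*pi} \<Longrightarrow> cmod (g x) \<le> B"
  shows "integrable circ (\<lambda>x. f x * g x)"
proof (rule Bochner_Integration.integrable_bound)
  show "integrable circ (\<lambda>x. B * norm (f x))" using assms(1) by auto
  show "AE x in circ. norm (f x * g x) \<le> norm (B * norm (f x))"
  proof (rule AE_I2)
    fix x assume "x \<in> space circ"
    then have g: "cmod (g x) \<le> B" using assms(3) by (simp add: space_circ)
    then have "0 \<le> B" using norm_ge_zero order_trans by blast
    then show "norm (f x * g x) \<le> norm (B * norm (f x))"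
      using mult_right_mono[OF g, of "cmod (f x)"] by (simp add: norm_mult abs_mult mult_ac)
  qed
qed (use assms in measurable)

lemma integrable_mult_fourier_mode:
  "integrable circ f \<Longrightarrow> integrable circ (\<lambda>x. f x * fourier_mode k x)"
  by (rule integrable_circ_mult_bounded[where B=1]) (auto intro: borel_measurable_circ)

text \<open>
  Vanishing of all Fourier coefficients is inherited by the product with any real polynomial
  in \<open>cos x\<close> and \<open>sin x\<close>. The statement quantifies over \<open>h\<close> so that the induction
  passes products: the second factor is applied to \<open>h\<close> times the first.
\<close>

lemma polynomial_cis_orthogonal:
  fixes q :: "complex \<Rightarrow> real"
  assumes "real_polynomial_function q"
  shows "\<And>h. integrable circ h \<Longrightarrow> (\<And>k. integral\<^sup>L circ (\<lambda>x. h x * fourier_mode k x) = 0) \<Longrightarrow>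
    integrable circ (\<lambda>x. h x * of_real (q (cis x))) \<and>
    (\<forall>k. integral\<^sup>L circ (\<lambda>x. h x * of_real (q (cis x)) * fourier_mode k x) = 0)"
  using assms
proof (induction q rule: real_polynomial_function.induct)
  case (linear f)
  define \<alpha> where "\<alpha> = (of_real (f 1) - \<i> * of_real (f \<i>)) / (2::complex)"
  define \<beta> where "\<beta> = (of_real (f 1) + \<i> * of_real (f \<i>)) / (2::complex)"
  interpret f: bounded_linear f by fact
  have eq: "of_real (f (cis x)) = \<alpha> * fourier_mode 1 x + \<beta> * fourier_mode (-1) x" for x
  proof -
    have "cis x = cos x *\<^sub>R 1 + sin x *\<^sub>R \<i>" by (simp add: complex_eq_iff)
    then have "f (cis x) = cos x * f 1 + sin x * f \<i>" by (simp add: f.add f.scaleR)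
    then show ?thesis
      by (simp add: fourier_mode_cis \<alpha>_def \<beta>_def complex_eq_iff field_simps)
  qed
  have eq': "h x * of_real (f (cis x)) * fourier_mode k x =
      \<alpha> * (h x * fourier_mode (1 + k) x) + \<beta> * (h x * fourier_mode (-1 + k) x)" for x k
    unfolding eq fourier_mode_mult[symmetric] by (simp add: algebra_simps)
  have "integrable circ (\<lambda>x. h x * of_real (f (cis x)) * fourier_mode 0 x)"
    unfolding eq' by (intro Bochner_Integration.integrable_add integrable_mult_right integrable_mult_fourier_mode linear.prems)
  moreover have "integral\<^sup>L circ (\<lambda>x. h x * of_real (f (cis x)) * fourier_mode k x) = 0" for k
    unfolding eq' using linear.prems
    by (subst Bochner_Integration.integral_add) (auto intro!: integrable_mult_right integrable_mult_fourier_mode)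
  ultimately show ?case by simp
next
  case (const c)
  have eq: "h x * complex_of_real c * fourier_mode k x = of_real c * (h x * fourier_mode k x)" for x k
    by simp
  show ?case unfolding eq using const by simp
next
  case (add f g)
  have eq: "h x * of_real (f (cis x) + g (cis x)) * fourier_mode k x =
      h x * of_real (f (cis x)) * fourier_mode k x + h x * of_real (g (cis x)) * fourier_mode k x" for x k
    by (simp add: algebra_simps)
  note f = add.IH(1)[OF add.prems] and g = add.IH(2)[OF add.prems]
  have "integrable circ (\<lambda>x. h x * of_real (f (cis x) + g (cis x)) * fourier_mode 0 x)"
    unfolding eq using f g
    by (intro Bochner_Integration.integrable_add integrable_mult_fourier_mode) auto
  moreover have "integral\<^sup>L circ (\<lambda>x. h x * of_real (f (cis x) + g (cis x)) * fourier_mode k x) = 0" for k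
    unfolding eq using f g
    by (subst Bochner_Integration.integral_add) (auto intro!: integrable_mult_fourier_mode)
  ultimately show ?case by simp
next
  case (mult f g)
  note f = mult.IH(1)[OF mult.prems]
  have "integrable circ (\<lambda>x. (h x * of_real (f (cis x))) * of_real (g (cis x))) \<and>
    (\<forall>k. integral\<^sup>L circ (\<lambda>x. (h x * of_real (f (cis x))) * of_real (g (cis x)) * fourier_mode k x) = 0)"
    by (rule mult.IH(2)) (use f in auto)
  then show ?case by (simp add: mult.assoc)
qed

lemma continuous_cis_orthogonal:
  fixes \<phi> :: "complex \<Rightarrow> real"
  assumes h: "integrable circ h" "\<And>k. integral\<^sup>L circ (\<lambda>x. h x * fourier_mode k x) = 0"
    and \<phi>: "continuous_on UNIV \<phi>"
  shows "integral\<^sup>L circ (\<lambda>x. h x * of_real (\<phi> (cis x))) = 0"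
proof -
  define I where "I = integral\<^sup>L circ (\<lambda>x. cmod (h x))"
  have I0: "0 \<le> I" unfolding I_def by simp
  have small: "cmod (integral\<^sup>L circ (\<lambda>x. h x * of_real (\<phi> (cis x)))) \<le> e * I" if e: "e > 0" for e
  proof -
    obtain q where q: "real_polynomial_function q" "\<And>z. z \<in> sphere 0 1 \<Longrightarrow> \<bar>\<phi> z - q z\<bar> < e"
      using Stone_Weierstrass_real_polynomial_function[of "sphere (0::complex) 1" \<phi> e]
        e continuous_on_subset[OF \<phi>] by auto
    have q': "\<bar>\<phi> (cis x) - q (cis x)\<bar> \<le> e" for x using q(2)[of "cis x"] by simp
    have qc: "continuous_on UNIV q"
      using q(1) continuous_on_polymonial_function real_polynomial_function_eq by blast
    note orth = polynomial_cis_orthogonal[OF q(1) h]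
    have meas: "(\<lambda>x. complex_of_real (\<phi> (cis x) - q (cis x))) \<in> borel_measurable circ"
      by (intro borel_measurable_circ borel_measurable_continuous_onI continuous_intros
        continuous_on_compose2[OF \<phi>] continuous_on_compose2[OF qc]) auto
    have int: "integrable circ (\<lambda>x. h x * of_real (\<phi> (cis x) - q (cis x)))"
      by (rule integrable_circ_mult_bounded[OF h(1) meas, of e]) (unfold norm_of_real, rule q')
    have "integral\<^sup>L circ (\<lambda>x. h x * of_real (\<phi> (cis x)))
        = integral\<^sup>L circ (\<lambda>x. h x * of_real (\<phi> (cis x) - q (cis x)) + h x * of_real (q (cis x)))"
      by (simp add: algebra_simps)
    also have "\<dots> = integral\<^sup>L circ (\<lambda>x. h x * of_real (\<phi> (cis x) - q (cis x)))
        + integral\<^sup>L circ (\<lambda>x. h x * of_real (q (cis x)))"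
      by (rule Bochner_Integration.integral_add) (use int orth in auto)
    also have "integral\<^sup>L circ (\<lambda>x. h x * of_real (q (cis x))) = 0"
      using orth[THEN conjunct2, rule_format, of 0] by simp
    finally have "cmod (integral\<^sup>L circ (\<lambda>x. h x * of_real (\<phi> (cis x))))
        = cmod (integral\<^sup>L circ (\<lambda>x. h x * of_real (\<phi> (cis x) - q (cis x))))" by simp
    also have "\<dots> \<le> integral\<^sup>L circ (\<lambda>x. cmod (h x * of_real (\<phi> (cis x) - q (cis x))))"
      by (rule integral_norm_bound)
    also have "\<dots> \<le> integral\<^sup>L circ (\<lambda>x. e * cmod (h x))"
    proof (rule integral_mono)
      show "cmod (h x * of_real (\<phi> (cis x) - q (cis x))) \<le> e * cmod (h x)" for x
        unfolding norm_mult norm_of_real using q'[of x] by (subst mult.commute) (rule mult_right_mono, auto)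
    qed (use int h in auto)
    finally show ?thesis by (simp add: I_def)
  qed
  have "cmod (integral\<^sup>L circ (\<lambda>x. h x * of_real (\<phi> (cis x)))) \<le> 0"
  proof (rule field_le_epsilon)
    fix e :: real assume e: "e > 0"
    have "cmod (integral\<^sup>L circ (\<lambda>x. h x * of_real (\<phi> (cis x)))) \<le> (e / (I + 1)) * I"
      by (rule small) (use e I0 in auto)
    also have "\<dots> \<le> e" using e I0 by (simp add: field_simps)
    finally show "cmod (integral\<^sup>L circ (\<lambda>x. h x * of_real (\<phi> (cis x)))) \<le> 0 + e" by simp
  qed
  then show ?thesis by simp
qed

lemma cis_eq_iff_on_period:
  assumes "cis x = cis y" "0 < x" "x < 2 * pi" "0 \<le> y" "y \<le> 2 * pi"
  shows "x = y"
proof -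
  have "cis (x - y) = 1" using assms(1) by (simp add: cis_divide[symmetric])
  then have "cos (x - y) = 1" by (metis Re_complex_of_real cis.sel(1) of_real_1)
  then obtain n where n: "x - y = real_of_int n * 2 * pi" using cos_one_2pi_int by auto
  have "\<bar>x - y\<bar> < 2 * pi" using assms by auto
  then have "\<bar>real_of_int n\<bar> * (2 * pi) < 1 * (2 * pi)" unfolding n by (simp add: abs_mult)
  then have "\<bar>real_of_int n\<bar> < 1" using mult_less_cancel_right_pos[of "2*pi"] by simp
  then have "n = 0" by linarith
  then show ?thesis using n by simp
qed

text \<open>
  The indicator of the arc is the pointwise limit of the continuous functions
  \<open>min 1 (n \<cdot> infdist z C)\<close>, with \<open>C\<close> the complementary closed arc. Working on the circle in the
  complex plane rather than on \<open>[0, 2\<pi>]\<close> takes care of periodicity.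
\<close>

lemma arc_orthogonal:
  assumes h: "integrable circ h" "\<And>k. integral\<^sup>L circ (\<lambda>x. h x * fourier_mode k x) = 0"
    and a: "0 \<le> a" "a \<le> 2 * pi"
  shows "integral\<^sup>L circ (\<lambda>x. h x * indicator {a<..<2 * pi} x) = 0"
proof -
  define C where "C = cis ` ({0..a} \<union> {2 * pi})"
  have C: "closed C" "C \<noteq> {}"
    unfolding C_def by (intro compact_imp_closed compact_continuous_image continuous_intros compact_Un) auto
  have inC: "cis x \<in> C \<longleftrightarrow> x \<notin> {a<..<2 * pi}" if "x \<in> {0..2 * pi}" for x
  proof
    assume "cis x \<in> C"
    then obtain y where y: "cis x = cis y" "y \<in> {0..a} \<union> {2 * pi}"
      unfolding C_def by (rule imageE)
    show "x \<notin> {a<..<2 * pi}"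
    proof
      assume x: "x \<in> {a<..<2 * pi}"
      then have "x = y" using y a by (intro cis_eq_iff_on_period) auto
      then show False using x y by auto
    qed
  next
    assume "x \<notin> {a<..<2 * pi}"
    then have "x \<in> {0..a} \<union> {2 * pi}" using that by auto
    then show "cis x \<in> C" unfolding C_def by (rule imageI)
  qed
  define \<phi> where "\<phi> n z = min 1 (real n * infdist z C)" for n z
  have lim: "(\<lambda>n. \<phi> n (cis x)) \<longlonglongrightarrow> indicator {a<..<2 * pi} x" if x: "x \<in> {0..2 * pi}" for x
  proof (cases "x \<in> {a<..<2 * pi}")
    case True
    then have pos: "infdist (cis x) C > 0"
      using inC[OF x] infdist_pos_not_in_closed[OF C] by blast
    obtain N :: nat where N: "1 / infdist (cis x) C < real N" using reals_Archimedean2 by blast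
    have "\<phi> n (cis x) = 1" if "n \<ge> N" for n
    proof -
      have "1 / infdist (cis x) C < real n" using N that by linarith
      then show ?thesis using pos by (simp add: \<phi>_def field_simps)
    qed
    then show ?thesis using True
      by (intro tendsto_eventually eventually_sequentiallyI[of N]) simp
  next
    case False
    then have "infdist (cis x) C = 0" using inC[OF x] by simp
    then show ?thesis using False by (simp add: \<phi>_def)
  qed
  have cont: "continuous_on UNIV (\<phi> n)" for n unfolding \<phi>_def by (intro continuous_intros)
  have phi01: "0 \<le> \<phi> n z" "\<phi> n z \<le> 1" for n z by (auto simp: \<phi>_def infdist_nonneg)
  have hm: "h \<in> borel_measurable circ" using h(1) by auto
  have "(\<lambda>n. integral\<^sup>L circ (\<lambda>x. h x * of_real (\<phi> n (cis x))))
      \<longlonglongrightarrow> integral\<^sup>L circ (\<lambda>x. h x * of_real (indicator {a<..<2 * pi} x))"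
  proof (rule integral_dominated_convergence[where w="\<lambda>x. cmod (h x)"])
    show "(\<lambda>x. h x * of_real (indicator {a<..<2 * pi} x)) \<in> borel_measurable circ"
      by (intro borel_measurable_times hm borel_measurable_circ) measurable
    show "(\<lambda>x. h x * of_real (\<phi> n (cis x))) \<in> borel_measurable circ" for n
      by (intro borel_measurable_times hm borel_measurable_circ borel_measurable_continuous_onI
        continuous_intros continuous_on_compose2[OF cont]) auto
    show "integrable circ (\<lambda>x. cmod (h x))" using h by auto
    show "AE x in circ. (\<lambda>n. h x * of_real (\<phi> n (cis x))) \<longlonglongrightarrow> h x * of_real (indicator {a<..<2 * pi} x)"
      by (intro AE_I2 tendsto_mult tendsto_const tendsto_of_real lim) (simp add: space_circ)
    show "AE x in circ. norm (h x * of_real (\<phi> n (cis x))) \<le> cmod (h x)" for n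
      using phi01 by (intro AE_I2) (simp add: norm_mult mult_left_le)
  qed
  moreover have "integral\<^sup>L circ (\<lambda>x. h x * of_real (\<phi> n (cis x))) = 0" for n
    by (rule continuous_cis_orthogonal[OF h cont])
  ultimately have "integral\<^sup>L circ (\<lambda>x. h x * of_real (indicator {a<..<2 * pi} x)) = 0"
    by (simp add: LIMSEQ_const_iff)
  moreover have "(\<lambda>x. h x * of_real (indicator {a<..<2 * pi} x)) = (\<lambda>x. h x * indicator {a<..<2 * pi} x)"
    by (auto simp: indicator_def)
  ultimately show ?thesis by simp
qed

text \<open>
  The positive and negative parts of \<open>G\<close> are densities of two finite measures that agree on
  half-lines, hence are equal.
\<close>

lemma AE_zero_of_half_line_integrals:
  fixes G :: "real \<Rightarrow> real"
  assumes G: "integrable lborel G" and z: "\<And>a. integral\<^sup>L lborel (\<lambda>x. G x * indicator {a<..} x) = 0"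
  shows "AE x in lborel. G x = 0"
proof -
  define P where "P = density lborel (\<lambda>x. ennreal (G x))"
  define Q where "Q = density lborel (\<lambda>x. ennreal (- G x))"
  have [measurable]: "G \<in> borel_measurable borel" using G by auto
  have int: "integrable lborel (\<lambda>x. max 0 (G x) * indicator {a<..} x)"
     "integrable lborel (\<lambda>x. max 0 (- G x) * indicator {a<..} x)" for a
    by (rule Bochner_Integration.integrable_bound[OF G]; auto simp: indicator_def)+
  have P: "emeasure P {a<..} = ennreal (integral\<^sup>L lborel (\<lambda>x. max 0 (G x) * indicator {a<..} x))" for a
  proof -
    have "emeasure P {a<..} = (\<integral>\<^sup>+x. ennreal (max 0 (G x) * indicator {a<..} x) \<partial>lborel)"
      unfolding P_def by (auto simp: emeasure_density indicator_def max_def ennreal_neg intro!: nn_integral_cong)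
    also have "\<dots> = ennreal (integral\<^sup>L lborel (\<lambda>x. max 0 (G x) * indicator {a<..} x))"
      by (intro nn_integral_eq_integral int) auto
    finally show ?thesis .
  qed
  have Q: "emeasure Q {a<..} = ennreal (integral\<^sup>L lborel (\<lambda>x. max 0 (- G x) * indicator {a<..} x))" for a
  proof -
    have "emeasure Q {a<..} = (\<integral>\<^sup>+x. ennreal (max 0 (- G x) * indicator {a<..} x) \<partial>lborel)"
      unfolding Q_def by (auto simp: emeasure_density indicator_def max_def ennreal_neg intro!: nn_integral_cong)
    also have "\<dots> = ennreal (integral\<^sup>L lborel (\<lambda>x. max 0 (- G x) * indicator {a<..} x))"
      by (intro nn_integral_eq_integral int) auto
    finally show ?thesis .
  qed
  have eq: "integral\<^sup>L lborel (\<lambda>x. max 0 (G x) * indicator {a<..} x)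
      = integral\<^sup>L lborel (\<lambda>x. max 0 (- G x) * indicator {a<..} x)" for a
  proof -
    have "integral\<^sup>L lborel (\<lambda>x. max 0 (G x) * indicator {a<..} x)
      - integral\<^sup>L lborel (\<lambda>x. max 0 (- G x) * indicator {a<..} x)
      = integral\<^sup>L lborel (\<lambda>x. max 0 (G x) * indicator {a<..} x - max 0 (- G x) * indicator {a<..} x)"
      by (rule Bochner_Integration.integral_diff[OF int, symmetric])
    also have "\<dots> = integral\<^sup>L lborel (\<lambda>x. G x * indicator {a<..} x)"
      by (intro Bochner_Integration.integral_cong) (auto simp: max_def indicator_def)
    finally show ?thesis using z by simp
  qed
  have "P = Q"
    by (rule measure_eqI_lessThan) (auto simp: P Q eq, auto simp: P_def Q_def)
  then have "AE x in lborel. ennreal (G x) = ennreal (- G x)"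
    unfolding P_def Q_def by (intro sigma_finite_measure.density_unique[OF lborel.sigma_finite_measure_axioms]) auto
  then show ?thesis
  proof eventually_elim
    case (elim x)
    then show ?case by (cases "0 \<le> G x") (auto simp: ennreal_neg)
  qed
qed

text \<open>
  Completeness of the exponentials, in \<open>L\<^sup>1\<close>: the half-line integrals of the real and imaginary
  parts are integrals over arcs, which vanish by Stone-Weierstrass.
\<close>

lemma fourier_uniqueness:
  assumes h: "integrable circ h" "\<And>k. integral\<^sup>L circ (\<lambda>x. h x * fourier_mode k x) = 0"
  shows "AE x in circ. h x = 0"
proof -
  have AE0: "AE x in lborel. indicator {0..2*pi} x * L (h x) = 0"
    if L: "bounded_linear L" for L :: "complex \<Rightarrow> real"
  proof (rule AE_zero_of_half_line_integrals)
    interpret L: bounded_linear L by fact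
    define G where "G x = indicator {0..2*pi} x * L (h x)" for x
    have "integrable circ (\<lambda>x. L (h x))" by (rule integrable_bounded_linear[OF L h(1)])
    then have int: "integrable lborel G"
      by (simp add: integrable_circ set_integrable_def G_def[abs_def])
    then show "integrable lborel (\<lambda>x. indicator {0..2*pi} x * L (h x))"
      by (simp add: G_def[abs_def])
    have [measurable]: "G \<in> borel_measurable borel"
      using borel_measurable_integrable[OF int] by simp
    fix a
    have key: "integral\<^sup>L lborel (\<lambda>x. G x * indicator {b<..} x) = 0"
      if b: "0 \<le> b" "b \<le> 2 * pi" for b
    proof -
      have hi: "integrable circ (\<lambda>x. h x * indicator {b<..<2*pi} x)"
        by (rule integrable_circ_mult_bounded[OF h(1), of _ 1])
          (auto intro!: borel_measurable_circ simp: indicator_def)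
      have "integral\<^sup>L circ (\<lambda>x. L (h x * indicator {b<..<2*pi} x)) = L 0"
        unfolding integral_bounded_linear[OF L hi] arc_orthogonal[OF h b] ..
      then have "integral\<^sup>L lborel (\<lambda>x. indicator {0..2*pi} x * L (h x * indicator {b<..<2*pi} x)) = 0"
        by (simp add: integral_circ set_lebesgue_integral_def L.zero)
      moreover have "indicator {0..2*pi} x * L (h x * indicator {b<..<2*pi} x) = G x * indicator {b<..<2*pi} x" for x
        by (cases "x \<in> {b<..<2*pi}") (simp_all add: G_def L.zero)
      ultimately have "integral\<^sup>L lborel (\<lambda>x. G x * indicator {b<..<2*pi} x) = 0"
        by simp
      also have "integral\<^sup>L lborel (\<lambda>x. G x * indicator {b<..<2*pi} x) = integral\<^sup>L lborel (\<lambda>x. G x * indicator {b<..} x)"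
      proof (rule integral_cong_AE)
        have "AE x in lborel. x \<noteq> 2 * pi" by (rule AE_lborel_singleton)
        then show "AE x in lborel. G x * indicator {b<..<2*pi} x = G x * indicator {b<..} x"
          by eventually_elim (auto simp: indicator_def G_def)
      qed measurable
      finally show ?thesis .
    qed
    define b where "b = max 0 (min a (2 * pi))"
    have "integral\<^sup>L lborel (\<lambda>x. G x * indicator {a<..} x) = integral\<^sup>L lborel (\<lambda>x. G x * indicator {b<..} x)"
    proof (rule integral_cong_AE)
      have "AE x in lborel. x \<noteq> 0" by (rule AE_lborel_singleton)
      then show "AE x in lborel. G x * indicator {a<..} x = G x * indicator {b<..} x"
        by eventually_elim (auto simp: indicator_def b_def G_def max_def min_def split: if_splits)
    qed measurable
    then show "integral\<^sup>L lborel (\<lambda>x. indicator {0..2*pi} x * L (h x) * indicator {a<..} x) = 0"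
      using key[of b] by (simp add: b_def G_def)
  qed
  have "AE x in lborel. x \<in> {0..2*pi} \<longrightarrow> h x = 0"
    using AE0[OF bounded_linear_Re] AE0[OF bounded_linear_Im]
    by eventually_elim (simp add: complex_eq_iff indicator_def)
  then show ?thesis
    unfolding circ_def by (subst AE_restrict_space_iff) simp_all
qed

section \<open>The Riesz-Fischer theorem\<close>

lemma fourier_mode_circ [measurable]: "fourier_mode k \<in> borel_measurable circ"
  by (rule borel_measurable_circ[OF fourier_mode_borel])

definition sqint :: "(real \<Rightarrow> complex) \<Rightarrow> bool" where
  "sqint f \<longleftrightarrow> f \<in> borel_measurable circ \<and> integrable circ (\<lambda>x. (cmod (f x))\<^sup>2)"

lemma sqint_bound:
  assumes "f \<in> borel_measurable circ" "integrable circ g" "AE x in circ. (cmod (f x))\<^sup>2 \<le> g x"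
  shows "sqint f"
  unfolding sqint_def
proof
  show "integrable circ (\<lambda>x. (cmod (f x))\<^sup>2)"
    by (rule Bochner_Integration.integrable_bound[OF assms(2)]) (use assms in auto)
qed fact

lemma sqint_add: assumes "sqint f" "sqint g" shows "sqint (\<lambda>x. f x + g x)"
proof (rule sqint_bound)
  show "integrable circ (\<lambda>x. 2 * (cmod (f x))\<^sup>2 + 2 * (cmod (g x))\<^sup>2)"
    using assms by (auto simp: sqint_def)
  show "AE x in circ. (cmod (f x + g x))\<^sup>2 \<le> 2 * (cmod (f x))\<^sup>2 + 2 * (cmod (g x))\<^sup>2"
    using wsq_add_le[of 0 "\<lambda>_. _" "\<lambda>_. _" 0] by (auto simp: wsq_0)
qed (use assms in \<open>auto simp: sqint_def\<close>)

lemma sqint_cnj: "sqint f \<Longrightarrow> sqint (\<lambda>x. cnj (f x))"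
  by (auto simp: sqint_def intro: borel_measurable_continuous_on[OF continuous_on_cnj[OF continuous_on_id]])

lemma sqint_mult_mode: "sqint f \<Longrightarrow> sqint (\<lambda>x. f x * fourier_mode k x)"
  by (auto simp: sqint_def norm_mult borel_measurable_circ)

lemma sqint_bounded:
  assumes "f \<in> borel_measurable borel" "\<And>x. cmod (f x) \<le> B"
  shows "sqint f"
proof (rule sqint_bound)
  show "integrable circ (\<lambda>x. B\<^sup>2)" by simp
  show "AE x in circ. (cmod (f x))\<^sup>2 \<le> B\<^sup>2" using assms by (auto intro!: power_mono)
qed (use assms borel_measurable_circ in auto)

lemma sqint_mode: "sqint (fourier_mode k)"
  by (rule sqint_bounded[of _ 1]) auto

lemma sqint_scale: "sqint f \<Longrightarrow> sqint (\<lambda>x. c * f x)"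
  by (auto simp: sqint_def norm_mult power_mult_distrib)

lemma sqint_diff: "sqint f \<Longrightarrow> sqint g \<Longrightarrow> sqint (\<lambda>x. f x - g x)"
  using sqint_add[of f "\<lambda>x. (-1) * g x"] sqint_scale[of g "-1"] by simp

lemma sqint_mult:
  assumes "sqint f" "sqint g"
  shows "integrable circ (\<lambda>x. f x * g x)"
proof (rule Bochner_Integration.integrable_bound)
  show "integrable circ (\<lambda>x. (cmod (f x))\<^sup>2 + (cmod (g x))\<^sup>2)"
    using assms by (auto simp: sqint_def)
  have "cmod (f x * g x) \<le> (cmod (f x))\<^sup>2 + (cmod (g x))\<^sup>2" for x
    using sum_squares_bound[of "cmod (f x)" "cmod (g x)"] mult_nonneg_nonneg[OF norm_ge_zero[of "f x"] norm_ge_zero[of "g x"]]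
    unfolding norm_mult by linarith
  then show "AE x in circ. norm (f x * g x) \<le> norm ((cmod (f x))\<^sup>2 + (cmod (g x))\<^sup>2)" by auto
qed (use assms in \<open>auto simp: sqint_def\<close>)

lemma sqint_integrable: "sqint f \<Longrightarrow> integrable circ f"
  using sqint_mult[OF _ sqint_mode[of 0]] by simp

lemma sqint_Cauchy_Schwarz:
  assumes "sqint f" "sqint g"
  shows "(integral\<^sup>L circ (\<lambda>x. cmod (f x * g x)))\<^sup>2 \<le>
    integral\<^sup>L circ (\<lambda>x. (cmod (f x))\<^sup>2) * integral\<^sup>L circ (\<lambda>x. (cmod (g x))\<^sup>2)"
proof -
  have m: "f \<in> borel_measurable circ" "g \<in> borel_measurable circ" using assms by (auto simp: sqint_def)
  have i: "integrable circ (\<lambda>x. (cmod (f x))\<^sup>2)" "integrable circ (\<lambda>x. (cmod (g x))\<^sup>2)"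
    using assms by (auto simp: sqint_def)
  have "(\<integral>\<^sup>+x. ennreal (cmod (f x)) * ennreal (cmod (g x)) \<partial>circ)\<^sup>2
      \<le> (\<integral>\<^sup>+x. (ennreal (cmod (f x)))\<^sup>2 \<partial>circ) * (\<integral>\<^sup>+x. (ennreal (cmod (g x)))\<^sup>2 \<partial>circ)"
    by (rule Cauchy_Schwarz_nn_integral) (use m in auto)
  also have "(\<integral>\<^sup>+x. ennreal (cmod (f x)) * ennreal (cmod (g x)) \<partial>circ) = (\<integral>\<^sup>+x. ennreal (cmod (f x * g x)) \<partial>circ)"
    by (simp add: norm_mult ennreal_mult)
  also have "\<dots> = ennreal (integral\<^sup>L circ (\<lambda>x. cmod (f x * g x)))"
    by (rule nn_integral_eq_integral[OF integrable_norm[OF sqint_mult[OF assms]]]) auto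
  also have "(\<integral>\<^sup>+x. (ennreal (cmod (f x)))\<^sup>2 \<partial>circ) = ennreal (integral\<^sup>L circ (\<lambda>x. (cmod (f x))\<^sup>2))"
    by (simp add: ennreal_power nn_integral_eq_integral[OF i(1)])
  also have "(\<integral>\<^sup>+x. (ennreal (cmod (g x)))\<^sup>2 \<partial>circ) = ennreal (integral\<^sup>L circ (\<lambda>x. (cmod (g x))\<^sup>2))"
    by (simp add: ennreal_power nn_integral_eq_integral[OF i(2)])
  finally show ?thesis
    by (simp add: ennreal_power ennreal_mult'[symmetric])
qed

lemma L2_circle_sqint: "f \<in> L2_circle \<Longrightarrow> sqint f"
  by (auto simp: L2_circle_def sqint_def integrable_circ intro: borel_measurable_circ)

lemma L2_circleI: "f \<in> borel_measurable borel \<Longrightarrow> (\<And>x. f (x + 2 * pi) = f x) \<Longrightarrow> sqint f \<Longrightarrow> f \<in> L2_circle"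
  by (auto simp: L2_circle_def sqint_def integrable_circ)

lemma fourier_coeff_diff:
  assumes "sqint f" "sqint g"
  shows "fourier_coeff (\<lambda>x. f x - g x) k = fourier_coeff f k - fourier_coeff g k"
proof -
  have "integrable circ (\<lambda>x. f x * cnj (fourier_mode k x))" if "sqint f" for f
    unfolding cnj_fourier_mode by (rule sqint_mult[OF that sqint_mode])
  then show ?thesis
    using assms by (simp add: fourier_coeff_circ left_diff_distrib diff_divide_distrib)
qed

definition psum :: "(nat \<Rightarrow> complex) \<Rightarrow> nat \<Rightarrow> real \<Rightarrow> complex" where
  "psum c N x = (\<Sum>n\<le>N. c n * fourier_mode (int n) x)"

lemma psum_measurable [measurable]: "psum c N \<in> borel_measurable borel"
  unfolding psum_def by measurable

lemma psum_periodic: "psum c N (x + 2 * pi) = psum c N x"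
  by (simp add: psum_def fourier_mode_periodic)

lemma cmod_psum_le: "cmod (psum c N x) \<le> (\<Sum>n\<le>N. cmod (c n))"
  unfolding psum_def by (rule order_trans[OF norm_sum]) (simp add: norm_mult)

lemma sqint_psum: "sqint (psum c N)"
  by (rule sqint_bounded[OF psum_measurable cmod_psum_le])

lemma integral_psum_mult:
  assumes "sqint g"
  shows "integral\<^sup>L circ (\<lambda>x. psum c N x * g x) =
    (\<Sum>n\<le>N. c n * integral\<^sup>L circ (\<lambda>x. fourier_mode (int n) x * g x))"
proof -
  have int: "integrable circ (\<lambda>x. fourier_mode (int n) x * g x)" for n
    by (rule sqint_mult[OF sqint_mode assms])
  have "integral\<^sup>L circ (\<lambda>x. psum c N x * g x)
      = integral\<^sup>L circ (\<lambda>x. \<Sum>n\<le>N. c n * (fourier_mode (int n) x * g x))"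
    by (simp add: psum_def sum_distrib_right mult.assoc)
  also have "\<dots> = (\<Sum>n\<le>N. integral\<^sup>L circ (\<lambda>x. c n * (fourier_mode (int n) x * g x)))"
    by (intro Bochner_Integration.integral_sum integrable_mult_right int)
  also have "\<dots> = (\<Sum>n\<le>N. c n * integral\<^sup>L circ (\<lambda>x. fourier_mode (int n) x * g x))"
    using int by simp
  finally show ?thesis .
qed

lemma integral_mode_mult_cnj:
  "integral\<^sup>L circ (\<lambda>x. fourier_mode j x * cnj (fourier_mode k x)) = (if j = k then 2 * pi else 0)"
  unfolding cnj_fourier_mode fourier_mode_mult by (simp add: integral_fourier_mode)

lemma fourier_coeff_psum:
  "fourier_coeff (psum c N) k = (if 0 \<le> k \<and> k \<le> int N then c (nat k) else 0)"
proof -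
  have "fourier_coeff (psum c N) k = (\<Sum>n\<le>N. c n * (if int n = k then 2 * pi else 0)) / (2 * pi)"
    unfolding fourier_coeff_circ
    by (subst integral_psum_mult)
      (auto simp: integral_mode_mult_cnj intro!: sqint_cnj sqint_mode)
  also have "(\<Sum>n\<le>N. c n * (if int n = k then 2 * pi else 0))
      = (\<Sum>n\<le>N. if n = nat k \<and> 0 \<le> k then c n * (2 * pi) else 0)"
    by (intro sum.cong) auto
  also have "\<dots> = (if 0 \<le> k \<and> k \<le> int N then c (nat k) * (2 * pi) else 0)"
    by (cases "0 \<le> k") auto
  finally show ?thesis by simp
qed

lemma Parseval_psum: "integral\<^sup>L circ (\<lambda>x. (cmod (psum c N x))\<^sup>2) = 2 * pi * (\<Sum>n\<le>N. (cmod (c n))\<^sup>2)"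
proof -
  have "complex_of_real (integral\<^sup>L circ (\<lambda>x. (cmod (psum c N x))\<^sup>2))
      = integral\<^sup>L circ (\<lambda>x. of_real ((cmod (psum c N x))\<^sup>2))"
    by (rule integral_complex_of_real[symmetric])
  also have "\<dots> = integral\<^sup>L circ (\<lambda>x. psum c N x * cnj (psum c N x))"
    unfolding complex_norm_square ..
  also have "\<dots> = (\<Sum>n\<le>N. c n * integral\<^sup>L circ (\<lambda>x. fourier_mode (int n) x * cnj (psum c N x)))"
    by (rule integral_psum_mult[OF sqint_cnj[OF sqint_psum]])
  also have "\<dots> = (\<Sum>n\<le>N. c n * (2 * pi * cnj (c n)))"
  proof (intro sum.cong refl arg_cong2[where f="(*)"])
    fix n assume n: "n \<in> {..N}"
    have "integral\<^sup>L circ (\<lambda>x. fourier_mode (int n) x * cnj (psum c N x))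
        = cnj (integral\<^sup>L circ (\<lambda>x. psum c N x * cnj (fourier_mode (int n) x)))"
      unfolding Bochner_Integration.integral_cnj[symmetric] by (simp add: mult.commute)
    also have "integral\<^sup>L circ (\<lambda>x. psum c N x * cnj (fourier_mode (int n) x)) = 2 * pi * c n"
      using fourier_coeff_psum[of c N "int n"] n by (simp add: fourier_coeff_circ field_simps)
    finally show "integral\<^sup>L circ (\<lambda>x. fourier_mode (int n) x * cnj (psum c N x)) = 2 * pi * cnj (c n)" by simp
  qed
  also have "\<dots> = complex_of_real (2 * pi * (\<Sum>n\<le>N. (cmod (c n))\<^sup>2))"
    by (simp add: sum_distrib_left complex_norm_square mult_ac del: of_real_power)
  finally show ?thesis by (simp only: of_real_eq_iff)
qed

lemma psum_diff:
  assumes "N \<le> M"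
  shows "psum c M x - psum c N x = psum (\<lambda>n. if N < n then c n else 0) M x"
proof -
  have "psum c M x = psum c N x + (\<Sum>n\<in>{N<..M}. c n * fourier_mode (int n) x)"
    unfolding psum_def using assms
    by (subst sum.union_disjoint[symmetric]) (auto intro!: sum.cong)
  moreover have "psum (\<lambda>n. if N < n then c n else 0) M x = (\<Sum>n\<in>{N<..M}. c n * fourier_mode (int n) x)"
    unfolding psum_def by (rule sum.mono_neutral_cong_right) auto
  ultimately show ?thesis by simp
qed

lemma Parseval_psum_diff:
  assumes "N \<le> M"
  shows "integral\<^sup>L circ (\<lambda>x. (cmod (psum c M x - psum c N x))\<^sup>2) = 2 * pi * (\<Sum>n\<in>{N<..M}. (cmod (c n))\<^sup>2)"
proof -
  have "(\<Sum>n\<le>M. (cmod (if N < n then c n else 0))\<^sup>2) = (\<Sum>n\<in>{N<..M}. (cmod (c n))\<^sup>2)"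
    by (rule sum.mono_neutral_cong_right) auto
  then show ?thesis unfolding psum_diff[OF assms] Parseval_psum by simp
qed

lemma sum_tail_le:
  assumes "c \<in> hseq 0" "e > 0"
  shows "\<exists>N. \<forall>M\<ge>N. \<forall>K\<ge>N. (\<Sum>n\<in>{K<..M}. (cmod (c n))\<^sup>2) \<le> e"
proof -
  have "summable (\<lambda>n. (cmod (c n))\<^sup>2)" using assms by (simp add: hseq_def wsq_0[abs_def])
  then obtain N where N: "\<And>m n. m \<ge> N \<Longrightarrow> norm (\<Sum>k\<in>{m..<n}. (cmod (c k))\<^sup>2) < e"
    using assms(2) unfolding summable_Cauchy by blast
  show ?thesis
  proof (intro exI[of _ N] allI impI)
    fix M K assume "N \<le> M" "N \<le> K"
    have "{K<..M} = {Suc K..<Suc M}" by auto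
    then show "(\<Sum>n\<in>{K<..M}. (cmod (c n))\<^sup>2) \<le> e" using N[of "Suc K" "Suc M"] \<open>N \<le> K\<close> by simp
  qed
qed

text \<open>
  Besides the function itself, the \<open>L\<^sup>2\<close> convergence of the partial sums and almost everywhere
  convergence along a subsequence are recorded; the latter feeds Fatou's lemma in
  \<open>square_L2_plus\<close>. The subsequence is sparse enough for its increments to be summable
  in \<open>L\<^sup>1\<close>.
\<close>

lemma Riesz_Fischer:
  assumes c: "c \<in> hseq 0"
  obtains f r where "f \<in> L2_circle" "\<And>k. fourier_coeff f k = (if 0 \<le> k then c (nat k) else 0)"
    "(\<lambda>N. integral\<^sup>L circ (\<lambda>x. (cmod (f x - psum c N x))\<^sup>2)) \<longlonglongrightarrow> 0"
    "AE x in circ. (\<lambda>n. psum c (r n) x) \<longlonglongrightarrow> f x" "strict_mono (r :: nat \<Rightarrow> nat)"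
proof -
  define T where "T e = (SOME N. \<forall>M\<ge>N. \<forall>K\<ge>N. (\<Sum>n\<in>{K<..M}. (cmod (c n))\<^sup>2) \<le> e)" for e
  have T: "(\<Sum>n\<in>{K<..M}. (cmod (c n))\<^sup>2) \<le> e" if "e > 0" "T e \<le> M" "T e \<le> K" for e M K
    using someI_ex[OF sum_tail_le[OF c that(1)]] that unfolding T_def by blast
  \<comment> \<open>The tail beyond \<open>r n\<close> is at most \<open>(1/4)\<^sup>n\<close>, so that consecutive partial sums differ by
    \<open>O((1/2)\<^sup>n)\<close> in \<open>L\<^sup>2\<close>, hence in \<open>L\<^sup>1\<close>.\<close>
  define r where "r = rec_nat (T 1) (\<lambda>n p. max (Suc p) (T ((1/4) ^ Suc n)))"
  have r0: "r 0 = T 1" and rS: "r (Suc n) = max (Suc (r n)) (T ((1/4) ^ Suc n))" for n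
    by (simp_all add: r_def)
  have r: "strict_mono r" unfolding strict_mono_Suc_iff by (simp add: rS less_eq_Suc_le)
  have rT: "T ((1/4) ^ n) \<le> r n" for n by (cases n) (auto simp: r0 rS)
  define d where "d n x = psum c (r (Suc n)) x - psum c (r n) x" for n x
  have d_sq: "sqint (d n)" for n unfolding d_def by (intro sqint_diff sqint_psum)
  have [measurable]: "d n \<in> borel_measurable circ" for n using d_sq by (simp add: sqint_def)
  have d_int: "integrable circ (\<lambda>x. cmod (d n x))" for n using sqint_integrable[OF d_sq] by simp
  have d_le: "integral\<^sup>L circ (\<lambda>x. cmod (d n x)) \<le> 2 * pi * (1/2) ^ n" for n
  proof -
    have "(integral\<^sup>L circ (\<lambda>x. cmod (d n x * fourier_mode 0 x)))\<^sup>2 \<le>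
        integral\<^sup>L circ (\<lambda>x. (cmod (d n x))\<^sup>2) * integral\<^sup>L circ (\<lambda>x. (cmod (fourier_mode 0 x))\<^sup>2)"
      by (rule sqint_Cauchy_Schwarz[OF d_sq sqint_mode])
    also have "integral\<^sup>L circ (\<lambda>x. (cmod (d n x))\<^sup>2) = 2 * pi * (\<Sum>n\<in>{r n<..r (Suc n)}. (cmod (c n))\<^sup>2)"
      unfolding d_def by (rule Parseval_psum_diff) (simp add: rS)
    also have "\<dots> \<le> 2 * pi * (1/4) ^ n"
      using rT[of n] by (intro mult_left_mono T) (auto simp: rS)
    finally have "(integral\<^sup>L circ (\<lambda>x. cmod (d n x)))\<^sup>2 \<le> 2 * pi * (1/4) ^ n * (2 * pi)"
      using measure_circ by simp
    also have "\<dots> = (2 * pi * (1/2) ^ n)\<^sup>2"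
      by (simp add: power2_eq_square power_mult_distrib[symmetric])
    finally show ?thesis by (rule power2_le_imp_le) simp
  qed
  have "AE x in circ. summable (\<lambda>n. cmod (d n x))"
  proof -
    have "(\<integral>\<^sup>+x. (\<Sum>n. ennreal (cmod (d n x))) \<partial>circ) = (\<Sum>n. \<integral>\<^sup>+x. ennreal (cmod (d n x)) \<partial>circ)"
      by (intro nn_integral_suminf) measurable
    also have "\<dots> = (\<Sum>n. ennreal (integral\<^sup>L circ (\<lambda>x. cmod (d n x))))"
      using d_int by (intro suminf_cong nn_integral_eq_integral) auto
    also have "\<dots> \<le> (\<Sum>n. ennreal (2 * pi * (1/2) ^ n))"
      using d_le by (intro suminf_le) (auto intro: ennreal_leI)
    also have "\<dots> = ennreal (\<Sum>n. 2 * pi * (1/2) ^ n)"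
      by (intro suminf_ennreal2 summable_mult summable_geometric) auto
    also have "\<dots> < \<infinity>" by simp
    finally have "(\<integral>\<^sup>+x. (\<Sum>n. ennreal (cmod (d n x))) \<partial>circ) \<noteq> \<infinity>" by simp
    then have "AE x in circ. (\<Sum>n. ennreal (cmod (d n x))) \<noteq> \<infinity>"
      by (intro nn_integral_PInf_AE) measurable
    then show ?thesis
      by eventually_elim (auto intro: summable_suminf_not_top)
  qed
  define f where "f x = lim (\<lambda>n. psum c (r n) x)" for x
  have conv: "AE x in circ. (\<lambda>n. psum c (r n) x) \<longlonglongrightarrow> f x"
    using \<open>AE x in circ. summable (\<lambda>n. cmod (d n x))\<close>
  proof eventually_elim
    case (elim x)
    then have "summable (\<lambda>n. d n x)" by (rule summable_norm_cancel)
    then have "convergent (\<lambda>n. \<Sum>i<n. d i x)" by (simp add: summable_iff_convergent)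
    moreover have "(\<Sum>i<n. d i x) = psum c (r n) x - psum c (r 0) x" for n
      unfolding d_def by (rule sum_lessThan_telescope)
    ultimately have "convergent (\<lambda>n. (psum c (r n) x - psum c (r 0) x) + psum c (r 0) x)"
      by (intro convergent_add) (auto simp: convergent_const)
    then have "convergent (\<lambda>n. psum c (r n) x)" by simp
    then show ?case unfolding f_def by (simp add: convergent_LIMSEQ_iff)
  qed
  have fm: "f \<in> borel_measurable borel" unfolding f_def by measurable
  have fm': "f \<in> borel_measurable circ" by (rule borel_measurable_circ[OF fm])
  have per: "f (x + 2 * pi) = f x" for x by (simp add: f_def psum_periodic)
  have tail: "(\<integral>\<^sup>+x. ennreal ((cmod (f x - psum c N x))\<^sup>2) \<partial>circ) \<le> ennreal (2 * pi * e)"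
    if e: "e > 0" "T e \<le> N" for e N
  proof -
    have "(\<integral>\<^sup>+x. ennreal ((cmod (f x - psum c N x))\<^sup>2) \<partial>circ)
        = (\<integral>\<^sup>+x. liminf (\<lambda>n. ennreal ((cmod (psum c (r n) x - psum c N x))\<^sup>2)) \<partial>circ)"
      using conv
    proof (intro nn_integral_cong_AE, eventually_elim)
      case (elim x)
      have "(\<lambda>n. ennreal ((cmod (psum c (r n) x - psum c N x))\<^sup>2)) \<longlonglongrightarrow> ennreal ((cmod (f x - psum c N x))\<^sup>2)"
        by (intro tendsto_ennrealI tendsto_power tendsto_norm tendsto_diff elim tendsto_const)
      from lim_imp_Liminf[OF _ this] show ?case by simp
    qed
    also have "\<dots> \<le> liminf (\<lambda>n. \<integral>\<^sup>+x. ennreal ((cmod (psum c (r n) x - psum c N x))\<^sup>2) \<partial>circ)"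
      by (intro nn_integral_liminf borel_measurable_circ) measurable
    also have "\<dots> \<le> liminf (\<lambda>n. ennreal (2 * pi * e))"
    proof (rule Liminf_mono)
      show "\<forall>\<^sub>F n in sequentially. (\<integral>\<^sup>+x. ennreal ((cmod (psum c (r n) x - psum c N x))\<^sup>2) \<partial>circ) \<le> ennreal (2 * pi * e)"
      proof (rule eventually_sequentiallyI)
        fix n assume "N \<le> n"
        then have n: "N \<le> r n" using seq_suble[OF r, of n] by simp
        have "sqint (\<lambda>x. psum c (r n) x - psum c N x)" by (intro sqint_diff sqint_psum)
        then have "(\<integral>\<^sup>+x. ennreal ((cmod (psum c (r n) x - psum c N x))\<^sup>2) \<partial>circ)
            = ennreal (integral\<^sup>L circ (\<lambda>x. (cmod (psum c (r n) x - psum c N x))\<^sup>2))"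
          by (intro nn_integral_eq_integral) (auto simp: sqint_def)
        also have "\<dots> \<le> ennreal (2 * pi * e)"
          unfolding Parseval_psum_diff[OF n] using e n by (intro ennreal_leI mult_left_mono T) auto
        finally show "(\<integral>\<^sup>+x. ennreal ((cmod (psum c (r n) x - psum c N x))\<^sup>2) \<partial>circ) \<le> ennreal (2 * pi * e)" .
      qed
    qed
    also have "\<dots> = ennreal (2 * pi * e)" by (simp add: Liminf_const)
    finally show ?thesis .
  qed
  have diff_sq: "sqint (\<lambda>x. f x - psum c (T 1) x)"
    unfolding sqint_def
  proof
    show m: "(\<lambda>x. f x - psum c (T 1) x) \<in> borel_measurable circ"
      by (intro borel_measurable_circ borel_measurable_diff fm) measurable
    show "integrable circ (\<lambda>x. (cmod (f x - psum c (T 1) x))\<^sup>2)"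
      unfolding integrable_iff_bounded using m tail[of 1 "T 1"]
      by (auto simp: le_less_trans)
  qed
  have fsq: "sqint f" using sqint_add[OF diff_sq sqint_psum[of c "T 1"]] by simp
  have f: "f \<in> L2_circle" by (rule L2_circleI[OF fm per fsq])
  have L2lim: "(\<lambda>N. integral\<^sup>L circ (\<lambda>x. (cmod (f x - psum c N x))\<^sup>2)) \<longlonglongrightarrow> 0"
  proof (rule LIMSEQ_I)
    fix e :: real assume e: "e > 0"
    show "\<exists>no. \<forall>n\<ge>no. norm (integral\<^sup>L circ (\<lambda>x. (cmod (f x - psum c n x))\<^sup>2) - 0) < e"
    proof (intro exI[of _ "T (e / (4 * pi))"] allI impI)
      fix n assume n: "T (e / (4 * pi)) \<le> n"
      have "sqint (\<lambda>x. f x - psum c n x)" by (intro sqint_diff sqint_psum fsq)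
      then have "ennreal (integral\<^sup>L circ (\<lambda>x. (cmod (f x - psum c n x))\<^sup>2))
          = (\<integral>\<^sup>+x. ennreal ((cmod (f x - psum c n x))\<^sup>2) \<partial>circ)"
        by (intro nn_integral_eq_integral[symmetric]) (auto simp: sqint_def)
      also have "\<dots> \<le> ennreal (2 * pi * (e / (4 * pi)))" by (rule tail[OF _ n]) (use e in auto)
      finally have "integral\<^sup>L circ (\<lambda>x. (cmod (f x - psum c n x))\<^sup>2) \<le> e / 2"
        using e by (subst (asm) ennreal_le_iff) auto
      then show "norm (integral\<^sup>L circ (\<lambda>x. (cmod (f x - psum c n x))\<^sup>2) - 0) < e"
        using e by simp
    qed
  qed
  have "fourier_coeff f k = (if 0 \<le> k then c (nat k) else 0)" for k
  proof -
    define v where "v = (if 0 \<le> k then c (nat k) else 0)"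
    have le: "(cmod (fourier_coeff f k - v))\<^sup>2 \<le> integral\<^sup>L circ (\<lambda>x. (cmod (f x - psum c N x))\<^sup>2) / (2 * pi)"
      if "nat k \<le> N" for N
    proof -
      have "fourier_coeff f k - v = fourier_coeff f k - fourier_coeff (psum c N) k"
        using that by (auto simp: v_def fourier_coeff_psum)
      also have "\<dots> = fourier_coeff (\<lambda>x. f x - psum c N x) k"
        by (rule fourier_coeff_diff[OF fsq sqint_psum, symmetric])
      finally have eq: "fourier_coeff f k - v = integral\<^sup>L circ (\<lambda>x. (f x - psum c N x) * cnj (fourier_mode k x)) / (2 * pi)"
        by (simp add: fourier_coeff_circ)
      have "cmod (fourier_coeff f k - v) \<le> integral\<^sup>L circ (\<lambda>x. cmod ((f x - psum c N x) * cnj (fourier_mode k x))) / (2 * pi)"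
        unfolding eq norm_divide using integral_norm_bound[of circ "\<lambda>x. (f x - psum c N x) * cnj (fourier_mode k x)"]
        by (simp add: divide_right_mono)
      then have "(cmod (fourier_coeff f k - v))\<^sup>2
          \<le> (integral\<^sup>L circ (\<lambda>x. cmod ((f x - psum c N x) * cnj (fourier_mode k x))) / (2 * pi))\<^sup>2"
        by (rule power_mono) simp
      also have "\<dots> = (integral\<^sup>L circ (\<lambda>x. cmod ((f x - psum c N x) * cnj (fourier_mode k x))))\<^sup>2 / (2 * pi)\<^sup>2"
        by (rule power_divide)
      also have "\<dots> \<le> (integral\<^sup>L circ (\<lambda>x. (cmod (f x - psum c N x))\<^sup>2) *
          integral\<^sup>L circ (\<lambda>x. (cmod (cnj (fourier_mode k x)))\<^sup>2)) / (2 * pi)\<^sup>2"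
        by (intro divide_right_mono sqint_Cauchy_Schwarz sqint_diff fsq sqint_psum sqint_cnj sqint_mode) auto
      also have "\<dots> = integral\<^sup>L circ (\<lambda>x. (cmod (f x - psum c N x))\<^sup>2) / (2 * pi)"
        using measure_circ by (simp add: power2_eq_square)
      finally show ?thesis .
    qed
    have "(cmod (fourier_coeff f k - v))\<^sup>2 \<le> 0"
    proof (rule LIMSEQ_le_const)
      show "(\<lambda>N. integral\<^sup>L circ (\<lambda>x. (cmod (f x - psum c N x))\<^sup>2) / (2 * pi)) \<longlonglongrightarrow> 0"
        using tendsto_divide[OF L2lim tendsto_const[of "2 * pi"]] by simp
    qed (use le in blast)
    then show ?thesis by (simp add: v_def)
  qed
  from that[OF f this L2lim conv r] show thesis .
qed

section \<open>Products of functions without negative frequencies\<close>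

definition fcoef :: "(real \<Rightarrow> complex) \<Rightarrow> nat \<Rightarrow> complex" where
  "fcoef f n = fourier_coeff f (int n)"

lemma L2_plus_sqint: "f \<in> L2_plus \<Longrightarrow> sqint f"
  by (auto simp: L2_plus_def L2_circle_sqint)

lemma fourier_coeff_L2_plus:
  "f \<in> L2_plus \<Longrightarrow> fourier_coeff f k = (if 0 \<le> k then fcoef f (nat k) else 0)"
  by (auto simp: L2_plus_def fcoef_def)

lemma Bessel:
  assumes f: "sqint f"
  shows "fcoef f \<in> hseq 0"
proof -
  define F where "F = integral\<^sup>L circ (\<lambda>x. (cmod (f x))\<^sup>2)"
  have F0: "0 \<le> F" by (simp add: F_def)
  have "(\<Sum>n\<le>N. wsq 0 (fcoef f) n) \<le> F / (2 * pi)" for N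
  proof -
    define s where "s = (\<Sum>n\<le>N. (cmod (fcoef f n))\<^sup>2)"
    have s0: "0 \<le> s" by (simp add: s_def sum_nonneg)
    have "integral\<^sup>L circ (\<lambda>x. psum (fcoef f) N x * cnj (f x))
        = (\<Sum>n\<le>N. fcoef f n * integral\<^sup>L circ (\<lambda>x. fourier_mode (int n) x * cnj (f x)))"
      by (rule integral_psum_mult[OF sqint_cnj[OF f]])
    also have "\<dots> = (\<Sum>n\<le>N. fcoef f n * (2 * pi * cnj (fcoef f n)))"
    proof (intro sum.cong refl arg_cong2[where f="(*)"])
      fix n
      have "integral\<^sup>L circ (\<lambda>x. fourier_mode (int n) x * cnj (f x))
          = cnj (integral\<^sup>L circ (\<lambda>x. f x * cnj (fourier_mode (int n) x)))"
        unfolding Bochner_Integration.integral_cnj[symmetric] by (simp add: mult.commute)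
      also have "\<dots> = 2 * pi * cnj (fcoef f n)"
        by (simp add: fcoef_def fourier_coeff_circ)
      finally show "integral\<^sup>L circ (\<lambda>x. fourier_mode (int n) x * cnj (f x)) = 2 * pi * cnj (fcoef f n)" .
    qed
    also have "\<dots> = complex_of_real (2 * pi * s)"
      by (simp add: s_def sum_distrib_left complex_norm_square mult_ac del: of_real_power)
    finally have eq: "integral\<^sup>L circ (\<lambda>x. psum (fcoef f) N x * cnj (f x)) = complex_of_real (2 * pi * s)" .
    have "2 * pi * s = cmod (integral\<^sup>L circ (\<lambda>x. psum (fcoef f) N x * cnj (f x)))"
      unfolding eq norm_of_real using s0 by simp
    also have "\<dots> \<le> integral\<^sup>L circ (\<lambda>x. cmod (psum (fcoef f) N x * cnj (f x)))"
      by (rule integral_norm_bound)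
    finally have "(2 * pi * s)\<^sup>2 \<le> (integral\<^sup>L circ (\<lambda>x. cmod (psum (fcoef f) N x * cnj (f x))))\<^sup>2"
      using s0 by (intro power_mono) auto
    also have "\<dots> \<le> integral\<^sup>L circ (\<lambda>x. (cmod (psum (fcoef f) N x))\<^sup>2) * integral\<^sup>L circ (\<lambda>x. (cmod (cnj (f x)))\<^sup>2)"
      by (rule sqint_Cauchy_Schwarz[OF sqint_psum sqint_cnj[OF f]])
    also have "\<dots> = 2 * pi * s * F"
      by (simp add: Parseval_psum s_def F_def)
    finally have "(2 * pi * s) * (2 * pi * s) \<le> (2 * pi * s) * F" by (simp add: power2_eq_square)
    then have "2 * pi * s \<le> F"
      using s0 F0 by (cases "s = 0") auto
    then show ?thesis by (simp add: s_def wsq_0 field_simps)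
  qed
  then show ?thesis by (rule hseqI_bounded(1))
qed

text \<open>
  The Riesz-Fischer function with the coefficients of \<open>f\<close> agrees with \<open>f\<close> almost everywhere, by
  \<open>fourier_uniqueness\<close>.
\<close>

lemma L2_plus_expansion:
  assumes f: "f \<in> L2_plus"
  obtains r where
    "(\<lambda>N. integral\<^sup>L circ (\<lambda>x. (cmod (f x - psum (fcoef f) N x))\<^sup>2)) \<longlonglongrightarrow> 0"
    "AE x in circ. (\<lambda>n. psum (fcoef f) (r n) x) \<longlonglongrightarrow> f x" "strict_mono (r :: nat \<Rightarrow> nat)"
proof -
  have fs: "sqint f" by (rule L2_plus_sqint[OF f])
  obtain g r where g: "g \<in> L2_circle" "\<And>k. fourier_coeff g k = (if 0 \<le> k then fcoef f (nat k) else 0)"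
    "(\<lambda>N. integral\<^sup>L circ (\<lambda>x. (cmod (g x - psum (fcoef f) N x))\<^sup>2)) \<longlonglongrightarrow> 0"
    "AE x in circ. (\<lambda>n. psum (fcoef f) (r n) x) \<longlonglongrightarrow> g x" "strict_mono (r :: nat \<Rightarrow> nat)"
    using Riesz_Fischer[OF Bessel[OF fs]] by blast
  have gs: "sqint g" by (rule L2_circle_sqint[OF g(1)])
  have "AE x in circ. f x - g x = 0"
  proof (rule fourier_uniqueness)
    show "integrable circ (\<lambda>x. f x - g x)" by (rule sqint_integrable[OF sqint_diff[OF fs gs]])
    fix k
    have "fourier_coeff (\<lambda>x. f x - g x) (- k) = 0"
      by (simp add: fourier_coeff_diff[OF fs gs] g(2) fourier_coeff_L2_plus[OF f])
    then show "integral\<^sup>L circ (\<lambda>x. (f x - g x) * fourier_mode k x) = 0"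
      by (simp add: fourier_coeff_circ cnj_fourier_mode)
  qed
  then have ae: "AE x in circ. f x = g x" by simp
  have "integral\<^sup>L circ (\<lambda>x. (cmod (f x - psum (fcoef f) N x))\<^sup>2)
      = integral\<^sup>L circ (\<lambda>x. (cmod (g x - psum (fcoef f) N x))\<^sup>2)" for N
  proof (rule integral_cong_AE)
    show "AE x in circ. (cmod (f x - psum (fcoef f) N x))\<^sup>2 = (cmod (g x - psum (fcoef f) N x))\<^sup>2"
      using ae by eventually_elim simp
  qed (use sqint_diff[OF fs sqint_psum[of "fcoef f" N]] sqint_diff[OF gs sqint_psum[of "fcoef f" N]]
      in \<open>auto simp: sqint_def intro: borel_measurable_integrable\<close>)
  then have 1: "(\<lambda>N. integral\<^sup>L circ (\<lambda>x. (cmod (f x - psum (fcoef f) N x))\<^sup>2)) \<longlonglongrightarrow> 0"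
    using g(3) by simp
  have 2: "AE x in circ. (\<lambda>n. psum (fcoef f) (r n) x) \<longlonglongrightarrow> f x"
    using ae g(4) by eventually_elim simp
  show thesis by (rule that[OF 1 2 g(5)])
qed

lemma L2_plus_pairing:
  assumes f: "f \<in> L2_plus" and g: "sqint g"
  shows "(\<lambda>N. \<Sum>n\<le>N. fcoef f n * integral\<^sup>L circ (\<lambda>x. fourier_mode (int n) x * g x))
    \<longlonglongrightarrow> integral\<^sup>L circ (\<lambda>x. f x * g x)"
proof -
  have fs: "sqint f" by (rule L2_plus_sqint[OF f])
  define D where "D N = integral\<^sup>L circ (\<lambda>x. (cmod (f x - psum (fcoef f) N x))\<^sup>2)" for N
  define G where "G = integral\<^sup>L circ (\<lambda>x. (cmod (g x))\<^sup>2)"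
  have D: "D \<longlonglongrightarrow> 0"
    using L2_plus_expansion[OF f] unfolding D_def by blast
  define S where "S N = integral\<^sup>L circ (\<lambda>x. psum (fcoef f) N x * g x)" for N
  have bound: "cmod (integral\<^sup>L circ (\<lambda>x. f x * g x) - S N) \<le> sqrt (D N * G)" for N
  proof (rule real_le_rsqrt)
    have d: "sqint (\<lambda>x. f x - psum (fcoef f) N x)" by (rule sqint_diff[OF fs sqint_psum])
    have "integral\<^sup>L circ (\<lambda>x. f x * g x) - S N = integral\<^sup>L circ (\<lambda>x. f x * g x - psum (fcoef f) N x * g x)"
      unfolding S_def by (rule Bochner_Integration.integral_diff[OF sqint_mult[OF fs g] sqint_mult[OF sqint_psum g], symmetric])
    also have "\<dots> = integral\<^sup>L circ (\<lambda>x. (f x - psum (fcoef f) N x) * g x)"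
      by (simp add: left_diff_distrib)
    finally have "(cmod (integral\<^sup>L circ (\<lambda>x. f x * g x) - S N))\<^sup>2
        \<le> (integral\<^sup>L circ (\<lambda>x. cmod ((f x - psum (fcoef f) N x) * g x)))\<^sup>2"
      using integral_norm_bound[of circ "\<lambda>x. (f x - psum (fcoef f) N x) * g x"] by (intro power_mono) auto
    also have "\<dots> \<le> D N * G"
      unfolding D_def G_def by (rule sqint_Cauchy_Schwarz[OF d g])
    finally show "(cmod (integral\<^sup>L circ (\<lambda>x. f x * g x) - S N))\<^sup>2 \<le> D N * G" .
  qed
  have "(\<lambda>N. sqrt (D N * G)) \<longlonglongrightarrow> sqrt (0 * G)"
    by (intro tendsto_real_sqrt tendsto_mult D tendsto_const)
  then have "(\<lambda>N. integral\<^sup>L circ (\<lambda>x. f x * g x) - S N) \<longlonglongrightarrow> 0"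
    by (intro Lim_null_comparison[OF _ \<open>(\<lambda>N. sqrt (D N * G)) \<longlonglongrightarrow> sqrt (0 * G)\<close>[simplified]] always_eventually)
      (use bound in auto)
  then have "(\<lambda>N. integral\<^sup>L circ (\<lambda>x. f x * g x) - (integral\<^sup>L circ (\<lambda>x. f x * g x) - S N))
      \<longlonglongrightarrow> integral\<^sup>L circ (\<lambda>x. f x * g x) - 0"
    by (intro tendsto_diff tendsto_const)
  then show ?thesis by (simp add: S_def integral_psum_mult[OF g])
qed

lemma psum_square:
  "(psum c N x)\<^sup>2 = psum (conv (trunc N c) (trunc N c)) (N + N) x"
proof -
  have "(psum c N x)\<^sup>2 = (\<Sum>i\<le>N. \<Sum>j\<le>N. (c i * c j) * fourier_mode (int (i + j)) x)"
    unfolding power2_eq_square psum_def sum_product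
    by (intro sum.cong refl) (simp add: fourier_mode_mult[symmetric])
  also have "\<dots> = (\<Sum>(i,j)\<in>{..N} \<times> {..N}. (c i * c j) * fourier_mode (int (i + j)) x)"
    by (simp add: sum.cartesian_product)
  also have "\<dots> = (\<Sum>(n,i)\<in>(SIGMA n:{..N+N}. {..n}). trunc N c i * trunc N c (n - i) * fourier_mode (int n) x)"
  proof (rule sum.reindex_bij_witness_not_neutral[of "{}" "{(n,i) \<in> (SIGMA n:{..N+N}. {..n}). i > N \<or> n - i > N}" _
      "\<lambda>(n,i). (i, n - i)" "\<lambda>(i,j). (i + j, i)"])
    show "finite {(n, i) \<in> (SIGMA n:{..N+N}. {..n}). i > N \<or> n - i > N}"
      by (rule finite_subset[of _ "{..N+N} \<times> {..N+N}"]) auto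
  qed (auto simp: trunc_def)
  also have "\<dots> = (\<Sum>n\<le>N+N. \<Sum>i\<le>n. trunc N c i * trunc N c (n - i) * fourier_mode (int n) x)"
    by (simp add: sum.Sigma)
  also have "\<dots> = psum (conv (trunc N c) (trunc N c)) (N + N) x"
    unfolding psum_def conv_def by (simp add: sum_distrib_right)
  finally show ?thesis .
qed

lemma integral_psum_fourth:
  "integral\<^sup>L circ (\<lambda>x. (cmod ((psum c N x)\<^sup>2))\<^sup>2) = 2 * pi * hnorm2 0 (conv (trunc N c) (trunc N c))"
proof -
  have "hnorm2 0 (conv (trunc N c) (trunc N c)) = (\<Sum>n\<le>N+N. (cmod (conv (trunc N c) (trunc N c) n))\<^sup>2)"
    by (subst hseq_finite_support(2)[of "N+N"])
      (auto simp: wsq_0 intro!: conv_finite_support[of N _ N] trunc_beyond)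
  then show ?thesis unfolding psum_square Parseval_psum by simp
qed

text \<open>
  Cauchy-Schwarz for \<open>|u|\<^sup>2\<close> against the constant 1 on the circle: \<open>(\<integral>|u|\<^sup>2)\<^sup>2 \<le> \<integral>|u|\<^sup>4\<close>.
\<close>

lemma mass_square_le:
  assumes "\<And>n. n > N \<Longrightarrow> a n = 0"
  shows "(hnorm2 0 a)\<^sup>2 \<le> hnorm2 0 (conv a a)"
proof -
  have tr: "trunc N a = a" using assms by (auto simp: trunc_def)
  have h: "hnorm2 0 a = (\<Sum>n\<le>N. (cmod (a n))\<^sup>2)" using hnorm2_trunc[of 0 N a] by (simp add: tr wsq_0)
  have sq: "sqint (\<lambda>x. (psum a N x)\<^sup>2)" unfolding psum_square by (rule sqint_psum)
  have "(integral\<^sup>L circ (\<lambda>x. cmod ((psum a N x)\<^sup>2 * fourier_mode 0 x)))\<^sup>2 \<le>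
     integral\<^sup>L circ (\<lambda>x. (cmod ((psum a N x)\<^sup>2))\<^sup>2) * integral\<^sup>L circ (\<lambda>x. (cmod (fourier_mode 0 x))\<^sup>2)"
    by (rule sqint_Cauchy_Schwarz[OF sq sqint_mode])
  also have "integral\<^sup>L circ (\<lambda>x. cmod ((psum a N x)\<^sup>2 * fourier_mode 0 x)) = 2 * pi * hnorm2 0 a"
    using Parseval_psum[of a N] by (simp add: norm_power h)
  also have "integral\<^sup>L circ (\<lambda>x. (cmod (fourier_mode 0 x))\<^sup>2) = 2 * pi"
    using measure_circ by simp
  finally have "(2 * pi * hnorm2 0 a)\<^sup>2 \<le> 2 * pi * hnorm2 0 (conv a a) * (2 * pi)"
    unfolding integral_psum_fourth tr .
  then have "(2 * pi)\<^sup>2 * (hnorm2 0 a)\<^sup>2 \<le> (2 * pi)\<^sup>2 * hnorm2 0 (conv a a)"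
    by (simp add: power2_eq_square mult_ac)
  then show ?thesis by (rule mult_left_le_imp_le) simp
qed

text \<open>
  The partial sums satisfy \<open>\<integral>|u\<^sub>N|\<^sup>4 \<le> C\<close> by \<open>hnorm2_conv_le\<close>, with \<open>C\<close> independent of \<open>N\<close>, and
  Fatou's lemma transfers the bound to \<open>u\<close>. Once \<open>u\<^sup>2\<close> is known to be in \<open>L\<^sup>2\<close>, its coefficients
  are pairings of \<open>u\<close> with the \<open>L\<^sup>2\<close> functions \<open>u \<cdot> cnj (fourier_mode k)\<close>.
\<close>

lemma square_L2_plus:
  assumes u: "u \<in> L2_plus" and h: "fcoef u \<in> hseq 1"
  shows "(\<lambda>x. (u x)\<^sup>2) \<in> L2_plus" "fcoef (\<lambda>x. (u x)\<^sup>2) = conv (fcoef u) (fcoef u)"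
proof -
  define c where "c = fcoef u"
  have us: "sqint u" by (rule L2_plus_sqint[OF u])
  have ub: "u \<in> borel_measurable borel" and up: "\<And>x. u (x + 2 * pi) = u x"
    using u by (auto simp: L2_plus_def L2_circle_def)
  obtain r where r: "AE x in circ. (\<lambda>n. psum c (r n) x) \<longlonglongrightarrow> u x"
    using L2_plus_expansion[OF u] unfolding c_def by blast
  have c0: "c \<in> hseq 0" and c1: "c \<in> hseq 1" using h hseq_weaken by (auto simp: c_def)
  define B where "B = 2 * pi * (2 * (hnorm2 1 c * hnorm2 0 c))"
  have four: "integral\<^sup>L circ (\<lambda>x. (cmod ((psum c N x)\<^sup>2))\<^sup>2) \<le> B" for N
  proof -
    have t: "cmod (trunc N c n) \<le> cmod (c n)" for n by (simp add: trunc_def)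
    note t1 = hseq_mono(2)[OF c1 order_refl t] and t0 = hseq_mono(2)[OF c0 order_refl t]
    have "hnorm2 0 (conv (trunc N c) (trunc N c))
        \<le> hnorm2 1 (trunc N c) * hnorm2 0 (trunc N c) + hnorm2 0 (trunc N c) * hnorm2 1 (trunc N c)"
      by (rule hnorm2_conv_le(2)[OF hseq_trunc hseq_trunc])
    also have "\<dots> \<le> hnorm2 1 c * hnorm2 0 c + hnorm2 0 c * hnorm2 1 c"
      by (intro add_mono mult_mono t1 t0 hnorm2_nonneg hseq_trunc c0 c1)
    finally show ?thesis unfolding integral_psum_fourth B_def by simp
  qed
  have m: "(\<lambda>x. (u x)\<^sup>2) \<in> borel_measurable borel" using ub by measurable
  have "(\<integral>\<^sup>+x. ennreal ((cmod ((u x)\<^sup>2))\<^sup>2) \<partial>circ)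
      = (\<integral>\<^sup>+x. liminf (\<lambda>n. ennreal ((cmod ((psum c (r n) x)\<^sup>2))\<^sup>2)) \<partial>circ)"
    using r
  proof (intro nn_integral_cong_AE, eventually_elim)
    case (elim x)
    have "(\<lambda>n. ennreal ((cmod ((psum c (r n) x)\<^sup>2))\<^sup>2)) \<longlonglongrightarrow> ennreal ((cmod ((u x)\<^sup>2))\<^sup>2)"
      by (intro tendsto_ennrealI tendsto_power tendsto_norm elim)
    from lim_imp_Liminf[OF _ this] show ?case by simp
  qed
  also have "\<dots> \<le> liminf (\<lambda>n. \<integral>\<^sup>+x. ennreal ((cmod ((psum c (r n) x)\<^sup>2))\<^sup>2) \<partial>circ)"
    by (intro nn_integral_liminf borel_measurable_circ) measurable
  also have "\<dots> \<le> liminf (\<lambda>n. ennreal B)"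
  proof (intro Liminf_mono always_eventually allI)
    fix n
    have "sqint (\<lambda>x. (psum c (r n) x)\<^sup>2)" unfolding psum_square by (rule sqint_psum)
    then have "(\<integral>\<^sup>+x. ennreal ((cmod ((psum c (r n) x)\<^sup>2))\<^sup>2) \<partial>circ)
        = ennreal (integral\<^sup>L circ (\<lambda>x. (cmod ((psum c (r n) x)\<^sup>2))\<^sup>2))"
      by (intro nn_integral_eq_integral) (auto simp: sqint_def)
    also have "\<dots> \<le> ennreal B" by (intro ennreal_leI four)
    finally show "(\<integral>\<^sup>+x. ennreal ((cmod ((psum c (r n) x)\<^sup>2))\<^sup>2) \<partial>circ) \<le> ennreal B" .
  qed
  also have "\<dots> = ennreal B" by (simp add: Liminf_const)
  also have "\<dots> < \<infinity>" by simp
  finally have fin: "(\<integral>\<^sup>+x. ennreal ((cmod ((u x)\<^sup>2))\<^sup>2) \<partial>circ) < \<infinity>" .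
  have sq: "sqint (\<lambda>x. (u x)\<^sup>2)"
    unfolding sqint_def
  proof
    show mc: "(\<lambda>x. (u x)\<^sup>2) \<in> borel_measurable circ" by (rule borel_measurable_circ[OF m])
    have [measurable]: "u \<in> borel_measurable circ" by (rule borel_measurable_circ[OF ub])
    show "integrable circ (\<lambda>x. (cmod ((u x)\<^sup>2))\<^sup>2)"
      unfolding integrable_iff_bounded using fin by simp
  qed
  have coef: "fourier_coeff (\<lambda>x. (u x)\<^sup>2) k = (if 0 \<le> k then conv c c (nat k) else 0)" for k
  proof -
    have "(\<lambda>N. \<Sum>n\<le>N. c n * integral\<^sup>L circ (\<lambda>x. fourier_mode (int n) x * (u x * cnj (fourier_mode k x))))
        \<longlonglongrightarrow> integral\<^sup>L circ (\<lambda>x. u x * (u x * cnj (fourier_mode k x)))"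
      unfolding c_def cnj_fourier_mode by (rule L2_plus_pairing[OF u sqint_mult_mode[OF us]])
    note pair = this
    have prod: "integral\<^sup>L circ (\<lambda>x. u x * (u x * cnj (fourier_mode k x))) = 2 * pi * fourier_coeff (\<lambda>x. (u x)\<^sup>2) k"
      by (simp add: fourier_coeff_circ power2_eq_square mult.assoc)
    have modes: "integral\<^sup>L circ (\<lambda>x. fourier_mode (int n) x * (u x * cnj (fourier_mode k x)))
        = 2 * pi * (if int n \<le> k then c (nat k - n) else 0)" for n
    proof -
      have eqx: "fourier_mode (int n) x * (u x * cnj (fourier_mode k x)) = u x * cnj (fourier_mode (k - int n) x)" for x
        by (simp add: cnj_fourier_mode fourier_mode_mult mult.left_commute)
      have "integral\<^sup>L circ (\<lambda>x. fourier_mode (int n) x * (u x * cnj (fourier_mode k x)))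
          = 2 * pi * fourier_coeff u (k - int n)"
        unfolding eqx by (simp add: fourier_coeff_circ)
      also have "\<dots> = 2 * pi * (if int n \<le> k then c (nat k - n) else 0)"
        unfolding fourier_coeff_L2_plus[OF u] c_def by (auto simp: nat_diff_distrib')
      finally show ?thesis .
    qed
    have lim: "(\<lambda>N. \<Sum>n\<le>N. c n * (2 * pi * (if int n \<le> k then c (nat k - n) else 0)))
        \<longlonglongrightarrow> 2 * pi * fourier_coeff (\<lambda>x. (u x)\<^sup>2) k"
      using pair unfolding prod modes .
    have ev: "(\<Sum>n\<le>N. c n * (2 * pi * (if int n \<le> k then c (nat k - n) else 0)))
        = 2 * pi * (if 0 \<le> k then conv c c (nat k) else 0)" if "nat k \<le> N" for N
    proof (cases "0 \<le> k")
      case True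
      have "(\<Sum>n\<le>N. c n * (2 * pi * (if int n \<le> k then c (nat k - n) else 0)))
          = (\<Sum>n\<le>nat k. 2 * pi * (c n * c (nat k - n)))"
        by (rule sum.mono_neutral_cong_right) (use that True in auto)
      then show ?thesis using True by (simp add: conv_def sum_distrib_left)
    next
      case False
      then have "(\<Sum>n\<le>N. c n * (2 * pi * (if int n \<le> k then c (nat k - n) else 0))) = 0"
        by (intro sum.neutral) auto
      then show ?thesis using False by simp
    qed
    have "(\<lambda>N. \<Sum>n\<le>N. c n * (2 * pi * (if int n \<le> k then c (nat k - n) else 0)))
        \<longlonglongrightarrow> 2 * pi * (if 0 \<le> k then conv c c (nat k) else 0)"
      by (rule tendsto_eventually, rule eventually_sequentiallyI[of "nat k"]) (rule ev)
    from LIMSEQ_unique[OF lim this] show ?thesis by simp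
  qed
  have "(\<lambda>x. (u x)\<^sup>2) \<in> L2_circle" by (rule L2_circleI[OF m _ sq]) (simp add: up)
  then show "(\<lambda>x. (u x)\<^sup>2) \<in> L2_plus" by (simp add: L2_plus_def coef)
  show "fcoef (\<lambda>x. (u x)\<^sup>2) = conv (fcoef u) (fcoef u)"
    by (auto simp: fcoef_def[of "\<lambda>x. (u x)\<^sup>2"] coef c_def)
qed

lemma fourier_coeff_cubic:
  assumes u: "u \<in> L2_plus" and h: "fcoef u \<in> hseq 1"
  shows "fourier_coeff (\<lambda>x. of_real ((cmod (u x))\<^sup>2) * u x) (int k) = cubic (fcoef u) k"
proof -
  define c where "c = fcoef u"
  have us: "sqint u" by (rule L2_plus_sqint[OF u])
  note sq = square_L2_plus[OF u h, folded c_def]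
  have c0: "c \<in> hseq 0" and c1: "c \<in> hseq 1" using h hseq_weaken by (auto simp: c_def)
  have b0: "conv c c \<in> hseq 0" by (rule hnorm2_conv_le(1)[OF c1 c1])
  have "(\<lambda>N. \<Sum>n\<le>N. conv c c n * integral\<^sup>L circ (\<lambda>x. fourier_mode (int n) x * cnj (u x * fourier_mode (int k) x)))
      \<longlonglongrightarrow> integral\<^sup>L circ (\<lambda>x. (u x)\<^sup>2 * cnj (u x * fourier_mode (int k) x))"
    using L2_plus_pairing[OF sq(1) sqint_cnj[OF sqint_mult_mode[OF us]]] unfolding sq(2) .
  note pair = this
  have modes: "integral\<^sup>L circ (\<lambda>x. fourier_mode (int n) x * cnj (u x * fourier_mode (int k) x))
      = 2 * pi * (if k \<le> n then cnj (c (n - k)) else 0)" for n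
  proof -
    have eqx: "fourier_mode (int n) x * cnj (u x * fourier_mode (int k) x)
        = cnj (u x * cnj (fourier_mode (int n - int k) x))" for x
    proof -
      have "fourier_mode (int n) x * cnj (fourier_mode (int k) x) = fourier_mode (int n - int k) x"
        by (simp add: cnj_fourier_mode fourier_mode_mult)
      then show ?thesis by (simp add: mult.left_commute)
    qed
    have "integral\<^sup>L circ (\<lambda>x. fourier_mode (int n) x * cnj (u x * fourier_mode (int k) x))
        = cnj (integral\<^sup>L circ (\<lambda>x. u x * cnj (fourier_mode (int n - int k) x)))"
      by (simp only: eqx Bochner_Integration.integral_cnj)
    also have "\<dots> = 2 * pi * cnj (fourier_coeff u (int n - int k))"
      by (simp add: fourier_coeff_circ)
    also have "\<dots> = 2 * pi * (if k \<le> n then cnj (c (n - k)) else 0)"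
    proof (cases "k \<le> n")
      case True
      then have "nat (int n - int k) = n - k" by linarith
      then show ?thesis using True by (simp add: fourier_coeff_L2_plus[OF u] c_def)
    next
      case False
      then show ?thesis by (simp add: fourier_coeff_L2_plus[OF u])
    qed
    finally show ?thesis .
  qed
  have l1: "(\<lambda>N. \<Sum>n\<le>N. conv c c n * (2 * pi * (if k \<le> n then cnj (c (n - k)) else 0)))
      \<longlonglongrightarrow> integral\<^sup>L circ (\<lambda>x. (u x)\<^sup>2 * cnj (u x * fourier_mode (int k) x))"
    using pair unfolding modes .
  have l2: "(\<lambda>N. 2 * pi * (\<Sum>n\<le>N. if k \<le> n then conv c c n * cnj (c (n - k)) else 0))
      \<longlonglongrightarrow> 2 * pi * corr (conv c c) c k"
    using corr_shift[OF b0 c0, of k] unfolding sums_def_le by (intro tendsto_mult tendsto_const)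
  have eq: "(\<Sum>n\<le>N. conv c c n * (2 * pi * (if k \<le> n then cnj (c (n - k)) else 0)))
      = 2 * pi * (\<Sum>n\<le>N. if k \<le> n then conv c c n * cnj (c (n - k)) else 0)" for N
    unfolding sum_distrib_left by (intro sum.cong) auto
  have I: "integral\<^sup>L circ (\<lambda>x. (u x)\<^sup>2 * cnj (u x * fourier_mode (int k) x)) = 2 * pi * corr (conv c c) c k"
    by (rule LIMSEQ_unique[OF l1[unfolded eq] l2])
  have eqx: "of_real ((cmod (u x))\<^sup>2) * u x * cnj (fourier_mode (int k) x)
      = (u x)\<^sup>2 * cnj (u x * fourier_mode (int k) x)" for x
    unfolding complex_norm_square by (simp add: power2_eq_square mult_ac)
  show ?thesis
    unfolding fourier_coeff_circ eqx I by (simp add: cubic_def c_def)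
qed

lemma fourier_coeff_szego_cubic:
  assumes u: "u \<in> L2_plus" and h: "fcoef u \<in> hseq 1"
  shows "fourier_coeff (szego_proj (\<lambda>x. of_real ((cmod (u x))\<^sup>2) * u x)) k =
    (if 0 \<le> k then cubic (fcoef u) (nat k) else 0)"
proof -
  define F where "F = (\<lambda>x. of_real ((cmod (u x))\<^sup>2) * u x)"
  have F: "fourier_coeff F k = cubic (fcoef u) (nat k)" if "0 \<le> k" for k
    using fourier_coeff_cubic[OF u h, of "nat k"] that by (simp add: F_def)
  obtain g where "g \<in> L2_circle" "\<And>k. fourier_coeff g k = (if 0 \<le> k then cubic (fcoef u) (nat k) else 0)"
    using Riesz_Fischer[OF cubic_hseq0[OF h]] by blast
  then have "\<exists>g. g \<in> L2_circle \<and> (\<forall>k. fourier_coeff g k = (if 0 \<le> k then fourier_coeff F k else 0))"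
    using F by auto
  from someI_ex[OF this] have "fourier_coeff (szego_proj F) k = (if 0 \<le> k then fourier_coeff F k else 0)"
    unfolding szego_proj_def by blast
  then show ?thesis using F by (simp add: F_def)
qed

section \<open>The uniform bound near a single mode\<close>

definition mode :: "nat \<Rightarrow> nat \<Rightarrow> complex" where
  "mode m n = (if n = m then 1 else 0)"

lemma mode_finite_support: "m < n \<Longrightarrow> mode m n = 0"
  by (simp add: mode_def)

lemma hseq_mode: "mode m \<in> hseq s"
  by (rule hseq_finite_support(1)[OF mode_finite_support])

lemma conv_mode: "conv (mode m) a n = (if m \<le> n then a (n - m) else 0)"
proof -
  have "conv (mode m) a n = (\<Sum>j\<le>n. if j = m then a (n - j) else 0)"
    unfolding conv_def mode_def by (intro sum.cong) auto
  then show ?thesis by simp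
qed

lemma conv_mode_mode: "conv (mode m) (mode m) = mode (m + m)"
  by (rule ext) (auto simp: conv_mode mode_def)

lemma l1_mode: "summable (\<lambda>n. cmod (mode m n))" "(\<Sum>n. cmod (mode m n)) = 1"
proof -
  have "(\<lambda>n. cmod (mode m n)) = (\<lambda>n. if n = m then 1 else 0)" by (auto simp: mode_def)
  then show "summable (\<lambda>n. cmod (mode m n))" "(\<Sum>n. cmod (mode m n)) = 1"
    using sums_single[of m "\<lambda>_. 1::real"] by (auto simp: sums_iff)
qed

lemma hnorm2_mode_add:
  assumes "q \<in> hseq 0"
  shows "hnorm2 0 (\<lambda>n. mode p n + q n) = 1 + 2 * Re (q p) + hnorm2 0 q"
proof -
  have "(\<lambda>n. (if n = p then 1 + 2 * Re (q n) else 0) + wsq 0 q n) sums ((1 + 2 * Re (q p)) + hnorm2 0 q)"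
    unfolding hnorm2_def
    by (intro sums_add sums_single summable_sums) (use assms in \<open>simp add: hseq_def\<close>)
  moreover have "(if n = p then 1 + 2 * Re (q n) else 0) + wsq 0 q n = wsq 0 (\<lambda>n. mode p n + q n) n" for n
  proof -
    have "(cmod (1 + z))\<^sup>2 = 1 + 2 * Re z + (cmod z)\<^sup>2" for z
      unfolding cmod_power2 by (simp add: power2_eq_square algebra_simps)
    then show ?thesis by (simp add: wsq_0 mode_def)
  qed
  ultimately show ?thesis by (simp add: hnorm2_def sums_iff)
qed

text \<open>
  The left-hand side is the variance of \<open>|u|\<^sup>2\<close> for \<open>u = e\<^sub>m + r\<close>. Since \<open>|e\<^sub>m| = 1\<close>, it is
  quadratic in \<open>r\<close>: the terms \<open>1 + 4 Re (r m)\<close> of order 0 and 1 of \<open>\<integral>|u|\<^sup>4\<close> and of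
  \<open>(\<integral>|u|\<^sup>2)\<^sup>2\<close> agree.
\<close>

lemma quartic_defect_near_mode:
  fixes m :: nat
  assumes r: "r \<in> hseq 1"
  defines "a \<equiv> \<lambda>n. mode m n + r n"
  shows "hnorm2 0 (conv a a) - (hnorm2 0 a)\<^sup>2 \<le> 8 * hnorm2 0 r + 4 * hnorm2 1 r * hnorm2 0 r"
proof -
  have r0: "r \<in> hseq 0" using r hseq_weaken by auto
  define q where "q n = 2 * conv (mode m) r n + conv r r n" for n
  have mr: "conv (mode m) r \<in> hseq 0" "hnorm2 0 (conv (mode m) r) \<le> hnorm2 0 r"
    using hnorm2_conv_l1_le[OF l1_mode(1) r0, of m] by (auto simp: l1_mode)
  have rr: "conv r r \<in> hseq 0" "hnorm2 0 (conv r r) \<le> 2 * hnorm2 1 r * hnorm2 0 r"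
    using hnorm2_conv_le[OF r r] by (auto simp: mult_ac)
  have q: "q \<in> hseq 0" "hnorm2 0 q \<le> 8 * hnorm2 0 r + 4 * hnorm2 1 r * hnorm2 0 r"
    using hseq_add[OF hseq_scale(1)[OF mr(1), of 2] rr(1)] mr(2) rr(2)
    by (auto simp: q_def[abs_def] hseq_scale(2)[OF mr(1)])
  have "conv a a = (\<lambda>n. mode (m + m) n + q n)"
    unfolding a_def conv_add_left conv_add_right conv_mode_mode conv_commute[of r "mode m"]
    by (auto simp: q_def)
  then have 1: "hnorm2 0 (conv a a) = 1 + 2 * Re (q (m + m)) + hnorm2 0 q"
    using hnorm2_mode_add[OF q(1)] by simp
  have 2: "hnorm2 0 a = 1 + 2 * Re (r m) + hnorm2 0 r"
    unfolding a_def by (rule hnorm2_mode_add[OF r0])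
  have "cmod (conv r r (m + m)) \<le> hnorm2 0 r"
    using cmod_conv_le_hnorm2[OF r0 r0] hnorm2_nonneg[OF r0] by simp
  then have "Re (conv r r (m + m)) \<le> hnorm2 0 r"
    using complex_Re_le_cmod order_trans by blast
  then have 3: "Re (q (m + m)) \<le> 2 * Re (r m) + hnorm2 0 r"
    by (simp add: q_def conv_mode)
  \<comment> \<open>The square of the mass need only be bounded below, by its linearisation at 1.\<close>
  have "(1 + x)\<^sup>2 \<ge> 1 + 2 * x" for x :: real by (simp add: power2_eq_square algebra_simps)
  from this[of "2 * Re (r m) + hnorm2 0 r"] have 4: "(hnorm2 0 a)\<^sup>2 \<ge> 1 + 2 * (2 * Re (r m) + hnorm2 0 r)"
    unfolding 2 by (simp add: add.assoc)
  show ?thesis using 1 3 4 q(2) by simp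
qed

text \<open>
  With \<open>X = 2 (m + 1)\<^sup>2 + 4\<close> bounding \<open>hnorm2 2\<close> of the data, this is \<open>4 X + 32\<close>: twice the mass plus
  twice the kinetic part, which gains at most 16 in the course of time.
\<close>

definition H1_bound :: "nat \<Rightarrow> real" where
  "H1_bound m = 8 * (real m + 1)\<^sup>2 + 48"

lemma weight2_le: "(real k + 1)\<^sup>2 \<le> 2 * (1 + (real k)\<^sup>2)"
  using sum_squares_bound[of "real k" 1] by (simp add: power2_eq_square algebra_simps)

text \<open>
  The bound on which the theorem rests. Conservation of energy and mass and \<open>mass_square_le\<close>
  give \<open>2 lam (kin t - kin 0) \<le> \<integral>|\<phi>|\<^sup>4 - (\<integral>|\<phi>|\<^sup>2)\<^sup>2\<close>, and the right-hand side is at most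
  \<open>32 \<epsilon>\<^sup>2 \<le> 32 lam\<close>.
\<close>

lemma Galerkin_bound:
  assumes eps: "0 < \<epsilon>" "\<epsilon> < 1" "\<epsilon>\<^sup>2 \<le> lam" and r: "r \<in> hseq 2" "hnorm2 2 r \<le> 2 * \<epsilon>\<^sup>2" and N: "m \<le> N"
  obtains a where "\<And>t k. N < k \<Longrightarrow> a t k = 0" "\<And>k. k \<le> N \<Longrightarrow> a 0 k = mode m k + r k" "solves_upto lam N a"
    "\<And>t. hnorm2 2 (a t) \<le> H1_bound m"
proof -
  obtain a where a: "\<And>t k. N < k \<Longrightarrow> a t k = 0" "\<And>k. k \<le> N \<Longrightarrow> a 0 k = mode m k + r k" "solves_upto lam N a"
    "\<And>t. hnorm2 0 (a t) = hnorm2 0 (a 0)" "\<And>t. energy lam N (a t) = energy lam N (a 0)"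
    using Galerkin_solution[of N "\<lambda>k. mode m k + r k" lam] by blast
  define s where "s = trunc N r"
  have e2: "\<epsilon>\<^sup>2 \<le> 1" "0 < \<epsilon>\<^sup>2" using eps by (auto simp: power_le_one)
  have lam: "lam > 0" using eps e2 by linarith
  have a0: "a 0 = (\<lambda>n. mode m n + s n)"
  proof
    fix n show "a 0 n = mode m n + s n"
      using a(1)[of n 0] a(2)[of n] N by (cases "n \<le> N") (auto simp: s_def trunc_def mode_def)
  qed
  have s: "s \<in> hseq 2" "hnorm2 2 s \<le> 2 * \<epsilon>\<^sup>2"
  proof -
    have "cmod (s n) \<le> cmod (r n)" for n by (simp add: s_def trunc_def)
    from hseq_mono[OF r(1) order_refl this] r(2) show "s \<in> hseq 2" "hnorm2 2 s \<le> 2 * \<epsilon>\<^sup>2" by auto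
  qed
  have s1: "s \<in> hseq 1" "hnorm2 1 s \<le> 2 * \<epsilon>\<^sup>2" and s0: "s \<in> hseq 0" "hnorm2 0 s \<le> 2 * \<epsilon>\<^sup>2"
    using s hseq_weaken[OF s(1)] hnorm2_weaken[OF s(1), of 1] hnorm2_weaken[OF s(1), of 0] by auto
  define kin where "kin t = (\<Sum>k\<le>N. (real k)\<^sup>2 * (cmod (a t k))\<^sup>2)" for t
  have h2: "a t \<in> hseq s" for t s by (rule hseq_finite_support(1)[OF a(1)])
  have init2: "hnorm2 2 (a 0) \<le> 2 * (real m + 1)\<^sup>2 + 4"
  proof -
    have "hnorm2 2 (mode m) = (real m + 1)\<^sup>2"
    proof -
      have "wsq 2 (mode m) = (\<lambda>n. if n = m then (real m + 1)\<^sup>2 else 0)" by (auto simp: wsq_def mode_def)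
      then show ?thesis
        using sums_single[of m "\<lambda>_. (real m + 1)\<^sup>2"] by (simp add: hnorm2_def sums_iff)
    qed
    then show ?thesis
      using hseq_add(2)[OF hseq_mode s(1), of m] s(2) e2 unfolding a0 by simp
  qed
  have kin_le: "kin t \<le> hnorm2 2 (a t)" for t
  proof -
    have "kin t \<le> (\<Sum>k\<le>N. wsq 2 (a t) k)"
      unfolding kin_def wsq_def by (intro sum_mono mult_right_mono power_mono) auto
    then show ?thesis using hseq_finite_support(2)[of N "a t" 2, OF a(1)] by simp
  qed
  have kin_bound: "kin t \<le> kin 0 + 16" for t
  proof -
    have "2 * lam * kin t + hnorm2 0 (conv (a t) (a t)) = 2 * lam * kin 0 + hnorm2 0 (conv (a 0) (a 0))"
      using a(5)[of t] by (simp add: energy_def kin_def)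
    moreover have "(hnorm2 0 (a 0))\<^sup>2 \<le> hnorm2 0 (conv (a t) (a t))"
      using mass_square_le[of N "a t", OF a(1)] a(4)[of t] by simp
    moreover have "hnorm2 0 (conv (a 0) (a 0)) - (hnorm2 0 (a 0))\<^sup>2 \<le> 32 * \<epsilon>\<^sup>2"
    proof -
      have "hnorm2 0 (conv (a 0) (a 0)) - (hnorm2 0 (a 0))\<^sup>2 \<le> 8 * hnorm2 0 s + 4 * hnorm2 1 s * hnorm2 0 s"
        unfolding a0 by (rule quartic_defect_near_mode[OF s1(1)])
      also have "\<dots> \<le> 8 * (2 * \<epsilon>\<^sup>2) + 4 * 2 * (2 * \<epsilon>\<^sup>2)"
        using s0 s1 e2 hnorm2_nonneg[OF s0(1)] hnorm2_nonneg[OF s1(1)]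
        by (intro add_mono mult_mono) auto
      finally show ?thesis by simp
    qed
    ultimately have "2 * lam * kin t \<le> 2 * lam * kin 0 + 32 * \<epsilon>\<^sup>2" by linarith
    also have "\<dots> \<le> 2 * lam * kin 0 + 32 * lam" using eps by simp
    finally have "2 * lam * kin t \<le> 2 * lam * (kin 0 + 16)" by (simp add: algebra_simps)
    then show ?thesis using lam by simp
  qed
  have "hnorm2 2 (a t) \<le> H1_bound m" for t
  proof -
    have "hnorm2 2 (a t) = (\<Sum>k\<le>N. wsq 2 (a t) k)" by (rule hseq_finite_support(2)[OF a(1)])
    also have "\<dots> \<le> (\<Sum>k\<le>N. 2 * wsq 0 (a t) k + 2 * ((real k)\<^sup>2 * (cmod (a t k))\<^sup>2))"
    proof (rule sum_mono)
      fix k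
      show "wsq 2 (a t) k \<le> 2 * wsq 0 (a t) k + 2 * ((real k)\<^sup>2 * (cmod (a t k))\<^sup>2)"
        using mult_right_mono[OF weight2_le[of k], of "(cmod (a t k))\<^sup>2"] by (simp add: wsq_def algebra_simps)
    qed
    also have "\<dots> = 2 * hnorm2 0 (a t) + 2 * kin t"
      using hseq_finite_support(2)[of N "a t" 0, OF a(1)] by (simp add: sum.distrib sum_distrib_left kin_def)
    also have "\<dots> \<le> 2 * hnorm2 2 (a 0) + 2 * (hnorm2 2 (a 0) + 16)"
      using hnorm2_weaken[of "a 0" 2 0, OF h2] a(4)[of t] kin_bound[of t] kin_le[of 0] by simp
    also have "\<dots> \<le> H1_bound m" using init2 by (simp add: H1_bound_def)
    finally show ?thesis .
  qed
  with a(1-3) show thesis by (rule that)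
qed

section \<open>Convergence of the truncated solutions\<close>

lemma solves_upto_mono: "solves_upto lam N a \<Longrightarrow> K \<le> N \<Longrightarrow> solves_upto lam K a"
  by (auto simp: solves_upto_def)

lemma hnorm2_limit_le:
  assumes lim: "\<And>k. (\<lambda>n. w n k) \<longlonglongrightarrow> v k" and h: "\<And>n. n \<ge> n0 \<Longrightarrow> w n \<in> hseq s"
    and le: "\<And>n. n \<ge> n0 \<Longrightarrow> hnorm2 s (w n) \<le> B"
  shows "v \<in> hseq s" "hnorm2 s v \<le> B"
proof -
  have "(\<Sum>k\<le>N. wsq s v k) \<le> B" for N
  proof (rule LIMSEQ_le_const2)
    show "(\<lambda>n. \<Sum>k\<le>N. wsq s (w n) k) \<longlonglongrightarrow> (\<Sum>k\<le>N. wsq s v k)"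
      unfolding wsq_def by (intro tendsto_intros lim)
    show "\<exists>N'. \<forall>n\<ge>N'. (\<Sum>k\<le>N. wsq s (w n) k) \<le> B"
      by (intro exI[of _ n0] allI impI order_trans[OF sum_le_hnorm2[OF h] le]) auto
  qed
  then show "v \<in> hseq s" "hnorm2 s v \<le> B" using hseqI_bounded by blast+
qed

text \<open>
  The truncated solutions are Cauchy in \<open>\<ell>\<^sup>2\<close>, locally uniformly in time, by \<open>stability\<close>; the cubic term
  converges in the same sense by \<open>cmod_cubic_diff_le\<close>, hence so do the time derivatives of
  each coefficient.
\<close>

lemma strong_solution:
  assumes G: "\<And>n. \<exists>a. (\<forall>t k. n + m < k \<longrightarrow> a t k = 0) \<and> (\<forall>k\<le>n + m. a 0 k = a0 k) \<and>
      solves_upto lam (n + m) a \<and> (\<forall>t. hnorm2 2 (a t) \<le> B)"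
  obtains a where "\<And>t. a t \<in> hseq 2" "\<And>t. hnorm2 2 (a t) \<le> B" "a 0 = a0" "\<And>K. solves_upto lam K a"
proof -
  define P where "P n a \<longleftrightarrow> (\<forall>t k. n + m < k \<longrightarrow> a t k = 0) \<and> (\<forall>k\<le>n + m. a 0 k = a0 k) \<and>
      solves_upto lam (n + m) a \<and> (\<forall>t. hnorm2 2 (a t) \<le> B)" for n and a :: "real \<Rightarrow> nat \<Rightarrow> complex"
  define A where "A n = (SOME a. P n a)" for n
  have "\<exists>a. P n a" for n using G[of n] by (simp only: P_def)
  then have "P n (A n)" for n unfolding A_def by (rule someI_ex)
  then have A: "\<And>n t k. n + m < k \<Longrightarrow> A n t k = 0" "\<And>n k. k \<le> n + m \<Longrightarrow> A n 0 k = a0 k"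
    "\<And>n. solves_upto lam (n + m) (A n)" "\<And>n t. hnorm2 2 (A n t) \<le> B"
    unfolding P_def by blast+
  have h: "A n t \<in> hseq s" for n t s by (rule hseq_finite_support(1)[OF A(1)])
  have B0: "0 \<le> B" using order_trans[OF hnorm2_nonneg[OF h] A(4)] .
  define R where "R = sqrt zeta2 * sqrt B"
  have l1: "summable (\<lambda>k. cmod (A n t k))" "(\<Sum>k. cmod (A n t k)) \<le> R" for n t
    using l1_of_hseq2[OF h[of n t]] mult_left_mono[OF real_sqrt_le_mono[OF A(4)], of "sqrt zeta2" n t]
    by (auto simp: R_def zeta2_nonneg)
  have R0: "0 \<le> R" by (simp add: R_def zeta2_nonneg B0)
  define E where "E T = 4 * B * exp (2 * (4 * (4 * B) + 9 * R\<^sup>2) * T)" for T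
  have E0: "0 \<le> E T" for T using B0 by (simp add: E_def)
  have d1: "hnorm2 1 (\<lambda>k. A n t k - A n' t k) \<le> 4 * B" for n n' t
    using hseq_diff(2)[of "A n t" 1 "A n' t", OF h h] hnorm2_weaken[of "A n t" 2 1, OF h] hnorm2_weaken[of "A n' t" 2 1, OF h]
      A(4)[of n t] A(4)[of n' t] by simp
  have cauchy: "hnorm2 0 (\<lambda>k. A n t k - A n' t k) \<le> E T / (real n + 1)" if "n \<le> n'" "\<bar>t\<bar> \<le> T" for n n' t T
  proof -
    have "hnorm2 0 (\<lambda>k. A n t k - A n' t k) \<le> (4 * B) / (real (n + m) + 1) * exp (2 * (4 * (4 * B) + 9 * R\<^sup>2) * T)"
    proof (rule stability)
      show "solves_upto lam (n + m) (A n)" by (rule A)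
      show "solves_upto lam (n + m) (A n')" by (rule solves_upto_mono[OF A(3)]) (use that in auto)
    qed (use that in \<open>auto simp: h l1 d1[simplified] A(2)\<close>)
    also have "\<dots> = E T / (real (n + m) + 1)" by (simp add: E_def)
    also have "\<dots> \<le> E T / (real n + 1)" by (intro divide_left_mono E0) auto
    finally show ?thesis .
  qed
  have coord: "cmod (A n t k - A n' t k) \<le> sqrt (E \<bar>t\<bar> / (real n + 1))" if "n \<le> n'" for n n' t k
  proof (rule real_le_rsqrt)
    have "(cmod (A n t k - A n' t k))\<^sup>2 \<le> hnorm2 0 (\<lambda>k. A n t k - A n' t k)"
      using sum_le_hnorm2[of "\<lambda>k. A n t k - A n' t k" 0 "{k}", OF hseq_diff(1)[OF h h]] by (simp add: wsq_0)
    also have "\<dots> \<le> E \<bar>t\<bar> / (real n + 1)" by (rule cauchy[OF that]) simp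
    finally show "(cmod (A n t k - A n' t k))\<^sup>2 \<le> E \<bar>t\<bar> / (real n + 1)" .
  qed
  have rate: "(\<lambda>n. sqrt (c / (real n + 1))) \<longlonglongrightarrow> 0" for c
  proof -
    have "(\<lambda>n. c / real (Suc n)) \<longlonglongrightarrow> 0" by (rule LIMSEQ_Suc[OF lim_const_over_n])
    then have "(\<lambda>n. sqrt (c / (real n + 1))) \<longlonglongrightarrow> sqrt 0"
      by (intro tendsto_real_sqrt) (simp add: add.commute)
    then show ?thesis by simp
  qed
  have "Cauchy (\<lambda>n. A n t k)" for t k
    unfolding Cauchy_altdef2
  proof (intro allI impI)
    fix e :: real assume e: "0 < e"
    obtain N where N: "sqrt (E \<bar>t\<bar> / (real N + 1)) < e"
      using order_tendstoD(2)[OF rate e] eventually_sequentially by (metis (mono_tags, lifting) order_refl)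
    have "dist (A n t k) (A N t k) < e" if "n \<ge> N" for n
      using coord[OF that, of t k] N by (simp add: dist_norm norm_minus_commute)
    then show "\<exists>N. \<forall>n\<ge>N. dist (A n t k) (A N t k) < e" by blast
  qed
  then have conv: "convergent (\<lambda>n. A n t k)" for t k by (rule Cauchy_convergent)
  define a where "a t k = lim (\<lambda>n. A n t k)" for t k
  have lim: "(\<lambda>n. A n t k) \<longlonglongrightarrow> a t k" for t k
    using conv[of t k] by (simp add: a_def convergent_LIMSEQ_iff)
  have a2: "a t \<in> hseq 2" "hnorm2 2 (a t) \<le> B" for t
    using hnorm2_limit_le[of "\<lambda>n. A n t" "a t" 0 2 B, OF lim] h A(4) by auto
  have al: "a t \<in> hseq s" "hnorm2 s (a t) \<le> B" if "s \<le> 2" for t s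
    using hseq_weaken[OF a2(1) that] order_trans[OF hnorm2_weaken[OF a2(1) that] a2(2)] by auto
  have Al: "hnorm2 s (A n t) \<le> B" if "s \<le> 2" for n t s
    using order_trans[OF hnorm2_weaken[OF h that] A(4)] .
  have l1a: "summable (\<lambda>k. cmod (a t k))" "(\<Sum>k. cmod (a t k)) \<le> R" for t
    using l1_of_hseq2[OF a2(1)[of t]] mult_left_mono[OF real_sqrt_le_mono[OF a2(2)], of "sqrt zeta2" t]
    by (auto simp: R_def zeta2_nonneg)
  have close: "hnorm2 0 (\<lambda>k. A n t k - a t k) \<le> E T / (real n + 1)" if "\<bar>t\<bar> \<le> T" for n t T
  proof (rule hnorm2_limit_le(2))
    show "(\<lambda>n'. A n t k - A n' t k) \<longlonglongrightarrow> A n t k - a t k" for k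
      by (intro tendsto_diff tendsto_const lim)
    show "(\<lambda>k. A n t k - A n' t k) \<in> hseq 0" for n' by (rule hseq_diff(1)[OF h h])
    show "hnorm2 0 (\<lambda>k. A n t k - A n' t k) \<le> E T / (real n + 1)" if "n \<le> n'" for n'
      by (rule cauchy[OF that \<open>\<bar>t\<bar> \<le> T\<close>])
  qed
  define L where "L = sqrt (4 * (4 * B) + 8 * R\<^sup>2) * sqrt B + R * sqrt B"
  have L0: "0 \<le> L" using B0 R0 by (simp add: L_def)
  have cub: "cmod (cubic (A n t) k - cubic (a t) k) \<le> L * sqrt (E T / (real n + 1))" if "\<bar>t\<bar> \<le> T" for n t k T
  proof -
    have "cmod (cubic (A n t) k - cubic (a t) k) \<le>
      (sqrt (4 * hnorm2 1 (\<lambda>k. A n t k - a t k) + 8 * (\<Sum>k. cmod (a t k))\<^sup>2) * sqrt (hnorm2 0 (A n t))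
        + (\<Sum>k. cmod (a t k)) * sqrt (hnorm2 0 (a t))) * sqrt (hnorm2 0 (\<lambda>k. A n t k - a t k))"
      by (rule cmod_cubic_diff_le) (auto simp: h al l1a)
    also have "\<dots> \<le> L * sqrt (E T / (real n + 1))"
    proof -
      have "hnorm2 1 (\<lambda>k. A n t k - a t k) \<le> 4 * B"
        using hseq_diff(2)[of "A n t" 1 "a t", OF h al(1)] Al[of 1 n t] al(2)[of 1 t] by simp
      moreover have "0 \<le> (\<Sum>k. cmod (a t k))" by (rule suminf_nonneg[OF l1a(1)]) simp
      ultimately show ?thesis
        unfolding L_def using l1a(2)[of t] Al[of 0 n t] al(2)[of 0 t] close[OF that, of n] R0 B0
          hnorm2_nonneg[of "A n t" 0, OF h] hnorm2_nonneg[of "a t" 0, OF al(1)]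
          hnorm2_nonneg[of "\<lambda>k. A n t k - a t k" 0, OF hseq_diff(1)[OF h al(1)]]
          hnorm2_nonneg[of "\<lambda>k. A n t k - a t k" 1, OF hseq_diff(1)[OF h al(1)]]
        by (intro mult_mono add_mono real_sqrt_le_mono power_mono mult_left_mono)
          (auto intro!: mult_nonneg_nonneg add_nonneg_nonneg)
    qed
    finally show ?thesis .
  qed
  have init: "a 0 = a0"
  proof
    fix k
    have "(\<lambda>n. A n 0 k) \<longlonglongrightarrow> a0 k"
      by (intro tendsto_eventually eventually_sequentiallyI[of k]) (simp add: A(2))
    then show "a 0 k = a0 k" using LIMSEQ_unique[OF lim] by blast
  qed
  have "solves_upto lam K a" for K
    unfolding solves_upto_def
  proof (intro allI impI)
    fix k :: nat and t :: real
    define T where "T = \<bar>t\<bar> + 1"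
    \<comment> \<open>Level \<open>n + k\<close> guarantees that the \<open>k\<close>-th equation is among those that are solved.\<close>
    define f' where "f' n x = - \<i> * (of_real (lam * (real k)\<^sup>2) * A (n + k) x k + cubic (A (n + k) x) k)" for n x
    define g' where "g' x = - \<i> * (of_real (lam * (real k)\<^sup>2) * a x k + cubic (a x) k)" for x
    define Q where "Q n = (\<bar>lam * (real k)\<^sup>2\<bar> + L) * sqrt (E T / (real n + 1))" for n
    have Q: "Q \<longlonglongrightarrow> 0"
      unfolding Q_def using tendsto_mult[OF tendsto_const rate] by fastforce
    have fg: "cmod (f' n x - g' x) \<le> Q n" if x: "\<bar>x\<bar> \<le> T" for n x
    proof -
      have mono: "sqrt (E T / (real (n + k) + 1)) \<le> sqrt (E T / (real n + 1))"
        by (intro real_sqrt_le_mono divide_left_mono E0) auto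
      have "(cmod (A (n + k) x k - a x k))\<^sup>2 \<le> hnorm2 0 (\<lambda>j. A (n + k) x j - a x j)"
        using sum_le_hnorm2[of "\<lambda>j. A (n + k) x j - a x j" 0 "{k}", OF hseq_diff(1)[OF h al(1)]] by (simp add: wsq_0)
      then have "(cmod (A (n + k) x k - a x k))\<^sup>2 \<le> E T / (real (n + k) + 1)"
        using close[OF x, of "n + k"] order_trans by blast
      then have 1: "cmod (A (n + k) x k - a x k) \<le> sqrt (E T / (real n + 1))"
        using mono real_le_rsqrt order_trans by blast
      have 2: "cmod (cubic (A (n + k) x) k - cubic (a x) k) \<le> L * sqrt (E T / (real n + 1))"
        using cub[OF x, of "n + k" k] mult_left_mono[OF mono L0] by linarith
      have "f' n x - g' x = - \<i> * (of_real (lam * (real k)\<^sup>2) * (A (n + k) x k - a x k)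
          + (cubic (A (n + k) x) k - cubic (a x) k))"
        by (simp add: f'_def g'_def algebra_simps)
      then have "cmod (f' n x - g' x) = cmod (of_real (lam * (real k)\<^sup>2) * (A (n + k) x k - a x k)
          + (cubic (A (n + k) x) k - cubic (a x) k))"
        by (simp only: norm_mult norm_minus_cancel norm_ii mult_1_left)
      also have "\<dots> \<le> \<bar>lam * (real k)\<^sup>2\<bar> * cmod (A (n + k) x k - a x k) + cmod (cubic (A (n + k) x) k - cubic (a x) k)"
      proof -
        have "cmod (of_real s * z + v) \<le> \<bar>s\<bar> * cmod z + cmod v" for s z v
          using norm_triangle_ineq[of "of_real s * z" v] by (simp add: norm_mult)
        then show ?thesis .
      qed
      also have "\<dots> \<le> \<bar>lam * (real k)\<^sup>2\<bar> * sqrt (E T / (real n + 1)) + L * sqrt (E T / (real n + 1))"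
        by (intro add_mono mult_left_mono 1 2) auto
      finally show ?thesis by (simp add: Q_def distrib_right)
    qed
    have "\<exists>g. \<forall>x\<in>{- T<..<T}. (\<lambda>n. A (n + k) x k) \<longlonglongrightarrow> g x \<and>
        (g has_derivative (\<lambda>h. h *\<^sub>R g' x)) (at x within {- T<..<T})"
    proof (rule has_derivative_sequence)
      show "((\<lambda>x. A (n + k) x k) has_derivative (\<lambda>h. h *\<^sub>R f' n x)) (at x within {- T<..<T})" for n x
        using A(3)[of "n + k"]
        by (auto simp: solves_upto_def f'_def has_vector_derivative_def intro: has_derivative_at_withinI)
      show "\<forall>\<^sub>F n in sequentially. \<forall>x\<in>{- T<..<T}. \<forall>h. norm (h *\<^sub>R f' n x - h *\<^sub>R g' x) \<le> e * norm h" if e: "e > 0" for e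
        using order_tendstoD(2)[OF Q e]
      proof eventually_elim
        case (elim n)
        show ?case
        proof (intro ballI allI)
          fix x h :: real assume "x \<in> {- T<..<T}"
          then have "\<bar>x\<bar> \<le> T" by auto
          from fg[OF this, of n] elim have "cmod (f' n x - g' x) \<le> e" by linarith
          then show "norm (h *\<^sub>R f' n x - h *\<^sub>R g' x) \<le> e * norm h"
            using mult_right_mono[OF _ abs_ge_zero[of h], of "cmod (f' n x - g' x)" e]
            by (simp add: scaleR_diff_right[symmetric] mult.commute)
        qed
      qed
      show "t \<in> {- T<..<T}" by (auto simp: T_def)
      show "(\<lambda>n. A (n + k) t k) \<longlonglongrightarrow> a t k" by (rule LIMSEQ_ignore_initial_segment[OF lim])
    qed auto
    then obtain g where g: "\<And>x. x \<in> {- T<..<T} \<Longrightarrow> (\<lambda>n. A (n + k) x k) \<longlonglongrightarrow> g x"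
      "\<And>x. x \<in> {- T<..<T} \<Longrightarrow> (g has_derivative (\<lambda>h. h *\<^sub>R g' x)) (at x within {- T<..<T})" by blast
    have ga: "g x = a x k" if "x \<in> {- T<..<T}" for x
      using LIMSEQ_unique[OF g(1)[OF that] LIMSEQ_ignore_initial_segment[OF lim]] .
    have tT: "t \<in> {- T<..<T}" by (auto simp: T_def)
    have "(g has_vector_derivative g' t) (at t)"
      using g(2)[OF tT] tT by (simp add: has_vector_derivative_def at_within_open[OF tT open_greaterThanLessThan])
    then have "((\<lambda>x. a x k) has_vector_derivative g' t) (at t)"
      by (rule has_vector_derivative_transform_within_open[OF _ open_greaterThanLessThan tT]) (rule ga)
    then show "((\<lambda>r. a r k) has_vector_derivative
        - \<i> * (of_real (lam * (real k)\<^sup>2) * a t k + cubic (a t) k)) (at t)"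
      by (simp only: g'_def)
  qed
  with a2 init show thesis by (rule that)
qed

text \<open>
  Each coefficient is continuous and the tails are uniformly small in \<open>hseq 1\<close> by the bound in
  \<open>hseq 2\<close>.
\<close>

lemma strong_solution_continuous:
  assumes a: "\<And>t. a t \<in> hseq 2" "\<And>t. hnorm2 2 (a t) \<le> B" "\<And>K. solves_upto lam K a"
  shows "((\<lambda>r. hnorm2 1 (\<lambda>n. a r n - a t n)) \<longlongrightarrow> 0) (at t)"
proof (rule tendstoI)
  fix e :: real assume e: "e > 0"
  have d2: "(\<lambda>n. a r n - a t n) \<in> hseq 2" "hnorm2 2 (\<lambda>n. a r n - a t n) \<le> 4 * B" for r
    using hseq_diff[OF a(1) a(1), of r t] a(2)[of r] a(2)[of t] by auto
  have B0: "0 \<le> B" using order_trans[OF hnorm2_nonneg[OF a(1)] a(2)] .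
  obtain K :: nat where K: "8 * B / e < real K" using reals_Archimedean2 by blast
  then have tail: "4 * B / (real K + 1) < e / 2" using e by (simp add: field_simps)
  have cont: "(\<lambda>r. a r k) \<midarrow>t\<rightarrow> a t k" for k
  proof -
    have "\<exists>d. ((\<lambda>r. a r k) has_vector_derivative d) (at t)"
      using a(3)[of k] unfolding solves_upto_def by blast
    then show ?thesis using has_vector_derivative_continuous continuous_at by blast
  qed
  have "((\<lambda>r. \<Sum>k\<le>K. wsq 1 (\<lambda>n. a r n - a t n) k) \<longlongrightarrow> (\<Sum>k\<le>K. (real k + 1) ^ 1 * (cmod (a t k - a t k))\<^sup>2)) (at t)"
    unfolding wsq_def by (intro tendsto_intros cont)
  then have "((\<lambda>r. \<Sum>k\<le>K. wsq 1 (\<lambda>n. a r n - a t n) k) \<longlongrightarrow> 0) (at t)" by simp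
  from order_tendstoD(2)[OF this, of "e / 2"]
  have "\<forall>\<^sub>F r in at t. (\<Sum>k\<le>K. wsq 1 (\<lambda>n. a r n - a t n) k) < e / 2" using e by simp
  then show "\<forall>\<^sub>F r in at t. dist (hnorm2 1 (\<lambda>n. a r n - a t n)) 0 < e"
  proof eventually_elim
    case (elim r)
    have d2': "(\<lambda>n. a r n - a t n) \<in> hseq (Suc 1)" using d2(1)[of r] by (simp add: numeral_2_eq_2)
    have "hnorm2 1 (\<lambda>n. a r n - a t n) \<le> (\<Sum>k\<le>K. wsq 1 (\<lambda>n. a r n - a t n) k)
        + hnorm2 (Suc 1) (\<lambda>n. a r n - a t n) / (real K + 1)"
      by (rule hnorm2_le_truncation[OF d2'])
    also have "hnorm2 (Suc 1) (\<lambda>n. a r n - a t n) / (real K + 1) \<le> 4 * B / (real K + 1)"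
      using d2(2)[of r] by (intro divide_right_mono) (auto simp: numeral_2_eq_2)
    finally have "hnorm2 1 (\<lambda>n. a r n - a t n) < e" using elim tail by linarith
    moreover have "0 \<le> hnorm2 1 (\<lambda>n. a r n - a t n)"
      by (rule hnorm2_nonneg[OF hseq_weaken[OF d2(1)]]) simp
    ultimately show ?case by (simp add: dist_real_def)
  qed
qed

section \<open>Sobolev norms in terms of coefficients\<close>

lemma infsum_int_supported_on_nat:
  fixes g :: "int \<Rightarrow> real"
  assumes "\<And>k. 0 \<le> g k" "\<And>k. k < 0 \<Longrightarrow> g k = 0"
  shows "g summable_on UNIV \<longleftrightarrow> summable (\<lambda>n. g (int n))"
    "summable (\<lambda>n. g (int n)) \<Longrightarrow> infsum g UNIV = (\<Sum>n. g (int n))"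
proof -
  have z: "g k = 0" if "k \<in> UNIV - range int" for k
  proof (rule assms(2))
    show "k < 0" using that nonneg_int_cases[of k] by force
  qed
  have "g summable_on UNIV \<longleftrightarrow> g summable_on range int"
    by (rule summable_on_cong_neutral) (use z in auto)
  also have "\<dots> \<longleftrightarrow> (\<lambda>n. g (int n)) summable_on UNIV"
    by (subst summable_on_reindex) (auto simp: o_def)
  also have "\<dots> \<longleftrightarrow> summable (\<lambda>n. g (int n))"
    by (rule summable_on_UNIV_nonneg_real_iff) (rule assms)
  finally show "g summable_on UNIV \<longleftrightarrow> summable (\<lambda>n. g (int n))" .
  assume s: "summable (\<lambda>n. g (int n))"
  have "infsum g UNIV = infsum g (range int)"
    by (rule infsum_cong_neutral) (use z in auto)
  also have "\<dots> = infsum (\<lambda>n. g (int n)) UNIV"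
    by (subst infsum_reindex) (auto simp: o_def)
  also have "\<dots> = (\<Sum>n. g (int n))"
    by (rule infsumI[OF sums_nonneg_imp_has_sum[OF summable_sums[OF s]]]) (rule assms)
  finally show "infsum g UNIV = (\<Sum>n. g (int n))" .
qed

lemma sobolev_weight:
  assumes "s = 1 \<or> s = (2::nat)"
  shows "(1 + (real n)\<^sup>2) powr (real s / 2) \<le> (real n + 1) ^ s"
    "(real n + 1) ^ s \<le> 2 * (1 + (real n)\<^sup>2) powr (real s / 2)"
proof -
  have up: "1 + (real n)\<^sup>2 \<le> (real n + 1)\<^sup>2" by (simp add: power2_eq_square algebra_simps)
  have low: "(real n + 1)\<^sup>2 \<le> 2 * (1 + (real n)\<^sup>2)" by (rule weight2_le)
  have p: "0 < 1 + (real n)\<^sup>2" by (simp add: add_pos_nonneg)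
  consider "s = 1" | "s = 2" using assms by blast
  then have "(1 + (real n)\<^sup>2) powr (real s / 2) \<le> (real n + 1) ^ s \<and>
    (real n + 1) ^ s \<le> 2 * (1 + (real n)\<^sup>2) powr (real s / 2)"
  proof cases
    case 1
    have sq: "(1 + (real n)\<^sup>2) powr (1/2) = sqrt (1 + (real n)\<^sup>2)"
      using p by (simp add: powr_half_sqrt)
    have "sqrt (1 + (real n)\<^sup>2) \<le> real n + 1" by (rule real_le_lsqrt) (use up in auto)
    moreover have "real n + 1 \<le> 2 * sqrt (1 + (real n)\<^sup>2)"
    proof -
      have "real n + 1 \<le> sqrt (2\<^sup>2 * (1 + (real n)\<^sup>2))"
        by (rule real_le_rsqrt) (use low p in auto)
      then show ?thesis by (simp only: real_sqrt_mult real_sqrt_abs)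
    qed
    ultimately show ?thesis using 1 sq by simp
  next
    case 2
    then show ?thesis using up low p by simp
  qed
  then show "(1 + (real n)\<^sup>2) powr (real s / 2) \<le> (real n + 1) ^ s"
    "(real n + 1) ^ s \<le> 2 * (1 + (real n)\<^sup>2) powr (real s / 2)" by auto
qed

lemma sobolev_L2_plus:
  assumes f: "f \<in> L2_plus" and s: "s = 1 \<or> s = (2::nat)"
  shows "f \<in> sobolev (real s / 2) \<longleftrightarrow> fcoef f \<in> hseq s"
    "fcoef f \<in> hseq s \<Longrightarrow> sobolev_norm (real s / 2) f \<le> ennreal (sqrt (hnorm2 s (fcoef f)))"
    "fcoef f \<in> hseq s \<Longrightarrow> ennreal (sqrt (hnorm2 s (fcoef f) / 2)) \<le> sobolev_norm (real s / 2) f"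
proof -
  define g where "g k = (1 + (real_of_int k)\<^sup>2) powr (real s / 2) * (cmod (fourier_coeff f k))\<^sup>2" for k :: int
  have g: "0 \<le> g k" "k < 0 \<Longrightarrow> g k = 0" for k
    using f by (auto simp: g_def L2_plus_def)
  have gn: "g (int n) = (1 + (real n)\<^sup>2) powr (real s / 2) * (cmod (fcoef f n))\<^sup>2" for n
    by (simp add: g_def fcoef_def)
  have le1: "g (int n) \<le> wsq s (fcoef f) n" for n
    unfolding gn wsq_def by (intro mult_right_mono sobolev_weight(1)[OF s]) auto
  have le2: "wsq s (fcoef f) n \<le> 2 * g (int n)" for n
    unfolding gn wsq_def using mult_right_mono[OF sobolev_weight(2)[OF s, of n], of "(cmod (fcoef f n))\<^sup>2"]
    by (simp add: mult.assoc)
  have sob: "f \<in> sobolev (real s / 2) \<longleftrightarrow> g summable_on UNIV"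
    using f by (simp add: sobolev_def L2_plus_def g_def[abs_def])
  also have "\<dots> \<longleftrightarrow> summable (\<lambda>n. g (int n))" by (rule infsum_int_supported_on_nat(1)[OF g])
  also have "\<dots> \<longleftrightarrow> fcoef f \<in> hseq s"
  proof
    assume "summable (\<lambda>n. g (int n))"
    then have "summable (\<lambda>n. 2 * g (int n))" by (rule summable_mult)
    then have "summable (wsq s (fcoef f))"
      by (rule summable_comparison_test'[of _ 0]) (use le2 in auto)
    then show "fcoef f \<in> hseq s" by (simp add: hseq_def)
  next
    assume "fcoef f \<in> hseq s"
    then have "summable (wsq s (fcoef f))" by (simp add: hseq_def)
    then show "summable (\<lambda>n. g (int n))"
      by (rule summable_comparison_test'[of _ 0]) (use le1 g in auto)
  qed
  finally show iff: "f \<in> sobolev (real s / 2) \<longleftrightarrow> fcoef f \<in> hseq s" .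
  assume h: "fcoef f \<in> hseq s"
  then have sg: "summable (\<lambda>n. g (int n))" and sw: "summable (wsq s (fcoef f))"
    using sob iff infsum_int_supported_on_nat(1)[OF g] by (auto simp: hseq_def)
  have norm: "sobolev_norm (real s / 2) f = ennreal (sqrt (\<Sum>n. g (int n)))"
    using iff h infsum_int_supported_on_nat(2)[OF g sg] by (simp add: sobolev_norm_def g_def)
  have "(\<Sum>n. g (int n)) \<le> hnorm2 s (fcoef f)"
    unfolding hnorm2_def by (rule suminf_le[OF le1 sg sw])
  then show "sobolev_norm (real s / 2) f \<le> ennreal (sqrt (hnorm2 s (fcoef f)))"
    unfolding norm by (intro ennreal_leI real_sqrt_le_mono)
  have "hnorm2 s (fcoef f) \<le> (\<Sum>n. 2 * g (int n))"
    unfolding hnorm2_def by (rule suminf_le[OF le2 sw summable_mult[OF sg]])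
  then have "hnorm2 s (fcoef f) / 2 \<le> (\<Sum>n. g (int n))"
    using suminf_mult[OF sg, of 2] by simp
  then show "ennreal (sqrt (hnorm2 s (fcoef f) / 2)) \<le> sobolev_norm (real s / 2) f"
    unfolding norm by (intro ennreal_leI real_sqrt_le_mono)
qed

lemma fcoef_diff:
  assumes "f \<in> L2_plus" "g \<in> L2_plus"
  shows "(\<lambda>x. f x - g x) \<in> L2_plus" "fcoef (\<lambda>x. f x - g x) = (\<lambda>n. fcoef f n - fcoef g n)"
proof -
  have s: "sqint f" "sqint g" using assms L2_plus_sqint by auto
  have "(\<lambda>x. f x - g x) \<in> L2_circle"
    using assms by (intro L2_circleI sqint_diff s) (auto simp: L2_plus_def L2_circle_def)
  then show "(\<lambda>x. f x - g x) \<in> L2_plus"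
    using assms by (simp add: L2_plus_def fourier_coeff_diff[OF s])
  show "fcoef (\<lambda>x. f x - g x) = (\<lambda>n. fcoef f n - fcoef g n)"
    by (auto simp: fcoef_def fourier_coeff_diff[OF s])
qed

lemma fourier_mode_L2_plus: "fourier_mode (int m) \<in> L2_plus" "fcoef (fourier_mode (int m)) = mode m"
proof -
  have eq: "fourier_mode (int m) = psum (mode m) m"
  proof
    fix x
    have "psum (mode m) m x = (\<Sum>n\<le>m. if n = m then fourier_mode (int n) x else 0)"
      unfolding psum_def mode_def by (intro sum.cong) auto
    then show "fourier_mode (int m) x = psum (mode m) m x" by simp
  qed
  have "fourier_mode (int m) \<in> L2_circle"
    by (rule L2_circleI[OF fourier_mode_borel fourier_mode_periodic sqint_mode])
  then show "fourier_mode (int m) \<in> L2_plus"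
    by (simp add: L2_plus_def) (simp add: eq fourier_coeff_psum)
  show "fcoef (fourier_mode (int m)) = mode m"
    by (rule ext) (auto simp: fcoef_def eq fourier_coeff_psum mode_def)
qed

lemma fourier_coeff_cong_AE:
  assumes "AE x in lborel. f x = g x" "sqint f" "sqint g"
  shows "fourier_coeff f k = fourier_coeff g k"
proof -
  have m: "(\<lambda>x. h x * cnj (fourier_mode k x)) \<in> borel_measurable circ" if "sqint h" for h
    unfolding cnj_fourier_mode by (rule borel_measurable_integrable[OF sqint_mult[OF that sqint_mode]])
  have "AE x in circ. f x = g x"
    unfolding circ_def by (subst AE_restrict_space_iff) (use assms(1) in auto)
  then have "AE x in circ. f x * cnj (fourier_mode k x) = g x * cnj (fourier_mode k x)"
    by eventually_elim simp
  then show ?thesis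
    unfolding fourier_coeff_circ using integral_cong_AE[OF m[OF assms(2)] m[OF assms(3)]] by simp
qed

section \<open>Existence and uniqueness of the flow\<close>

lemma Szego_equation_coeff_iff:
  "(\<i> * d + of_real lam * ((\<i> * of_int (int k))\<^sup>2 * c) = F) \<longleftrightarrow>
    d = - \<i> * (of_real (lam * (real k)\<^sup>2) * c + F)"
  for c d F :: complex
proof -
  have "(\<i> * of_int (int k))\<^sup>2 = - (of_real ((real k)\<^sup>2) :: complex)"
    by (simp add: power_mult_distrib)
  then have "(\<i> * d + of_real lam * ((\<i> * of_int (int k))\<^sup>2 * c) = F) \<longleftrightarrow>
      \<i> * d = of_real (lam * (real k)\<^sup>2) * c + F"
    by (auto simp: algebra_simps)
  also have "\<dots> \<longleftrightarrow> d = - \<i> * (of_real (lam * (real k)\<^sup>2) * c + F)"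
  proof
    assume "\<i> * d = of_real (lam * (real k)\<^sup>2) * c + F"
    then have "- \<i> * (\<i> * d) = - \<i> * (of_real (lam * (real k)\<^sup>2) * c + F)" by simp
    then show "d = - \<i> * (of_real (lam * (real k)\<^sup>2) * c + F)"
      by (simp only: mult.assoc[symmetric]) simp
  next
    assume "d = - \<i> * (of_real (lam * (real k)\<^sup>2) * c + F)"
    then show "\<i> * d = of_real (lam * (real k)\<^sup>2) * c + F"
      by (simp only: mult.assoc[symmetric]) simp
  qed
  finally show ?thesis .
qed

text \<open>
  The definition of a solution asks for \<open>u 0 = \<phi>\<close> almost everywhere, so \<open>\<phi>\<close> itself is used at time
  0 and Riesz-Fischer representatives at all other times.
\<close>

lemma existence_of_flow:
  assumes \<phi>: "\<phi> \<in> L2_plus"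
    and a: "\<And>t. a t \<in> hseq 2" "\<And>t. hnorm2 2 (a t) \<le> B" "a 0 = fcoef \<phi>" "\<And>K. solves_upto (\<epsilon> powr \<alpha>) K a"
  shows "\<exists>u. is_nls_szego_solution \<alpha> \<epsilon> \<phi> u"
proof -
  have "\<exists>f. f \<in> L2_plus \<and> fcoef f = a t" for t
  proof -
    obtain f where f: "f \<in> L2_circle" "\<And>k. fourier_coeff f k = (if 0 \<le> k then a t (nat k) else 0)"
      using Riesz_Fischer[OF hseq_weaken[OF a(1)]] by blast
    then have "f \<in> L2_plus" "fcoef f = a t" by (auto simp: L2_plus_def fcoef_def)
    then show ?thesis by blast
  qed
  then obtain U where U: "\<And>t. U t \<in> L2_plus" "\<And>t. fcoef (U t) = a t" by metis
  define u where "u t = (if t = 0 then \<phi> else U t)" for t :: real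
  have u: "u t \<in> L2_plus" "fcoef (u t) = a t" for t
    using U \<phi> a(3) by (auto simp: u_def)
  have h1: "a t \<in> hseq 1" for t using hseq_weaken[OF a(1)] by simp
  have "is_nls_szego_solution \<alpha> \<epsilon> \<phi> u"
    unfolding is_nls_szego_solution_def
  proof (intro conjI allI)
    show "continuous_in_sobolev_plus (1/2) u"
      unfolding continuous_in_sobolev_plus_def
    proof (intro conjI allI)
      show "u t \<in> sobolev_plus (1/2)" for t
        using sobolev_L2_plus(1)[OF u(1), of 1 t] h1 u by (simp add: sobolev_plus_def)
      fix t
      have le: "sobolev_norm (1/2) (\<lambda>x. u r x - u t x) \<le> ennreal (sqrt (hnorm2 1 (\<lambda>n. a r n - a t n)))" for r
        using sobolev_L2_plus(2)[OF fcoef_diff(1)[OF u(1) u(1)], of 1 r t] hseq_diff(1)[OF h1 h1, of r t]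
        by (simp add: fcoef_diff(2)[OF u(1) u(1)] u(2))
      have "((\<lambda>r. ennreal (sqrt (hnorm2 1 (\<lambda>n. a r n - a t n)))) \<longlongrightarrow> ennreal (sqrt 0)) (at t)"
        by (intro tendsto_ennrealI tendsto_real_sqrt strong_solution_continuous[of a B "\<epsilon> powr \<alpha>"] a)
      then have lim: "((\<lambda>r. ennreal (sqrt (hnorm2 1 (\<lambda>n. a r n - a t n)))) \<longlongrightarrow> 0) (at t)" by simp
      show "((\<lambda>r. sobolev_norm (1/2) (\<lambda>x. u r x - u t x)) \<longlongrightarrow> 0) (at t)"
        by (rule tendsto_sandwich[OF always_eventually always_eventually tendsto_const lim]) (use le in auto)
    qed
    show "AE x in lborel. u 0 x = \<phi> x" by (simp add: u_def)
    fix k t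
    have co: "fourier_coeff (u r) k = (if 0 \<le> k then a r (nat k) else 0)" for r
      using fourier_coeff_L2_plus[OF u(1)] u(2) by simp
    have sz: "fourier_coeff (szego_proj (\<lambda>x. of_real ((cmod (u t x))\<^sup>2) * u t x)) k
        = (if 0 \<le> k then cubic (a t) (nat k) else 0)"
      using fourier_coeff_szego_cubic[OF u(1)] u(2) h1 by simp
    show "\<exists>d. ((\<lambda>r. fourier_coeff (u r) k) has_vector_derivative d) (at t) \<and>
        \<i> * d + of_real (\<epsilon> powr \<alpha>) * ((\<i> * of_int k)\<^sup>2 * fourier_coeff (u t) k) =
        fourier_coeff (szego_proj (\<lambda>x. of_real ((cmod (u t x))\<^sup>2) * u t x)) k"
    proof (cases "0 \<le> k")
      case True
      then obtain n where n: "k = int n" by (rule nonneg_int_cases)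
      define d where "d = - \<i> * (of_real (\<epsilon> powr \<alpha> * (real n)\<^sup>2) * a t n + cubic (a t) n)"
      have "((\<lambda>r. a r n) has_vector_derivative d) (at t)"
        using a(4)[of n] unfolding solves_upto_def d_def by blast
      moreover have "\<i> * d + of_real (\<epsilon> powr \<alpha>) * ((\<i> * of_int (int n))\<^sup>2 * a t n) = cubic (a t) n"
        unfolding Szego_equation_coeff_iff d_def ..
      ultimately show ?thesis unfolding co sz unfolding n by (intro exI[of _ d]) simp
    next
      case False
      then show ?thesis unfolding co sz by (intro exI[of _ 0]) simp
    qed
  qed
  then show ?thesis by blast
qed

lemma bounded_on_compact_interval_of_local_bound:
  fixes g :: "real \<Rightarrow> real"
  assumes "\<And>t. \<exists>C. eventually (\<lambda>r. g r \<le> C) (at t)"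
  shows "\<exists>M. \<forall>t. \<bar>t\<bar> \<le> T \<longrightarrow> g t \<le> M"
proof -
  have "\<exists>C S. open S \<and> t \<in> S \<and> (\<forall>r\<in>S. g r \<le> C)" for t
  proof -
    obtain C S where S: "open S" "t \<in> S" "\<And>r. r \<in> S \<Longrightarrow> r \<noteq> t \<Longrightarrow> g r \<le> C"
      using assms[of t] unfolding eventually_at_topological by blast
    have "g r \<le> max C (g t)" if "r \<in> S" for r
      using S(3)[OF that] by (cases "r = t") auto
    then show ?thesis using S(1,2) by blast
  qed
  then obtain C S where S: "\<And>t. open (S t)" "\<And>t. t \<in> S t" "\<And>t r. r \<in> S t \<Longrightarrow> g r \<le> C t" by metis
  obtain D where D: "D \<subseteq> {- T..T}" "finite D" "{- T..T} \<subseteq> (\<Union>c\<in>D. S c)"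
    by (rule compactE_image[OF compact_Icc, of "{- T..T}" S]) (use S in auto)
  have "g t \<le> (\<Sum>c\<in>D. \<bar>C c\<bar>)" if "\<bar>t\<bar> \<le> T" for t
  proof -
    have "t \<in> {- T..T}" using that by auto
    then obtain c where c: "c \<in> D" "t \<in> S c" using D by blast
    have "g t \<le> \<bar>C c\<bar>" using S(3)[OF c(2)] by simp
    also have "\<dots> \<le> (\<Sum>c\<in>D. \<bar>C c\<bar>)" using D(2) c(1) by (intro member_le_sum) auto
    finally show ?thesis .
  qed
  then show ?thesis by blast
qed

text \<open>
  Weak-strong uniqueness: the coefficients of any \<open>H\<^sup>1\<^sup>/\<^sup>2\<close> solution are those of the \<open>H\<^sup>1\<close> solution \<open>a\<close>.
  The continuity in \<open>H\<^sup>1\<^sup>/\<^sup>2\<close> is used only through boundedness on compact time intervals, which is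
  what \<open>stability\<close> requires.
\<close>

lemma uniqueness_of_flow:
  assumes \<phi>: "\<phi> \<in> L2_plus" and v: "is_nls_szego_solution \<alpha> \<epsilon> \<phi> v"
    and a: "\<And>t. a t \<in> hseq 2" "\<And>t. hnorm2 2 (a t) \<le> B" "a 0 = fcoef \<phi>" "\<And>K. solves_upto (\<epsilon> powr \<alpha>) K a"
  shows "v t \<in> L2_plus" "fcoef (v t) = a t"
proof -
  define b where "b t = fcoef (v t)" for t
  have cont: "continuous_in_sobolev_plus (1/2) v" and init: "AE x in lborel. v 0 x = \<phi> x"
    and eqn: "\<And>k t. \<exists>d. ((\<lambda>r. fourier_coeff (v r) k) has_vector_derivative d) (at t) \<and>
        \<i> * d + of_real (\<epsilon> powr \<alpha>) * ((\<i> * of_int k)\<^sup>2 * fourier_coeff (v t) k) =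
        fourier_coeff (szego_proj (\<lambda>x. of_real ((cmod (v t x))\<^sup>2) * v t x)) k"
    using v unfolding is_nls_szego_solution_def by blast+
  have vL: "v t \<in> L2_plus" and vS: "v t \<in> sobolev (1/2)" for t
    using cont by (auto simp: continuous_in_sobolev_plus_def sobolev_plus_def)
  show "v t \<in> L2_plus" by (rule vL)
  have b1: "b t \<in> hseq 1" for t
    using sobolev_L2_plus(1)[OF vL, of 1 t] vS by (simp add: b_def)
  have a1: "a t \<in> hseq 1" for t using hseq_weaken[OF a(1)] by simp
  have bsol: "solves_upto (\<epsilon> powr \<alpha>) K b" for K
    unfolding solves_upto_def
  proof (intro allI impI)
    fix k t
    obtain d where d: "((\<lambda>r. fourier_coeff (v r) (int k)) has_vector_derivative d) (at t)"
      "\<i> * d + of_real (\<epsilon> powr \<alpha>) * ((\<i> * of_int (int k))\<^sup>2 * fourier_coeff (v t) (int k)) =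
        fourier_coeff (szego_proj (\<lambda>x. of_real ((cmod (v t x))\<^sup>2) * v t x)) (int k)"
      using eqn by blast
    have "fourier_coeff (szego_proj (\<lambda>x. of_real ((cmod (v t x))\<^sup>2) * v t x)) (int k) = cubic (b t) k"
      using fourier_coeff_szego_cubic[OF vL, of t "int k"] b1[of t] by (simp add: b_def)
    with d show "((\<lambda>r. b r k) has_vector_derivative
        - \<i> * (of_real (\<epsilon> powr \<alpha> * (real k)\<^sup>2) * b t k + cubic (b t) k)) (at t)"
      unfolding Szego_equation_coeff_iff by (simp add: b_def fcoef_def)
  qed
  have b0: "b 0 = a 0"
    using fourier_coeff_cong_AE[OF init L2_plus_sqint[OF vL] L2_plus_sqint[OF \<phi>]]
    by (auto simp: b_def a(3) fcoef_def)
  have "\<exists>C. eventually (\<lambda>r. hnorm2 1 (b r) \<le> C) (at t)" for t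
  proof -
    have "((\<lambda>r. sobolev_norm (1/2) (\<lambda>x. v r x - v t x)) \<longlongrightarrow> 0) (at t)"
      using cont by (auto simp: continuous_in_sobolev_plus_def)
    from order_tendstoD(2)[OF this, of 1]
    have "\<forall>\<^sub>F r in at t. sobolev_norm (1/2) (\<lambda>x. v r x - v t x) < 1" by simp
    then have "\<forall>\<^sub>F r in at t. hnorm2 1 (b r) \<le> 4 + 2 * hnorm2 1 (b t)"
    proof eventually_elim
      case (elim r)
      have d1: "(\<lambda>n. b r n - b t n) \<in> hseq 1" by (rule hseq_diff(1)[OF b1 b1])
      have "ennreal (sqrt (hnorm2 1 (\<lambda>n. b r n - b t n) / 2)) \<le> sobolev_norm (1/2) (\<lambda>x. v r x - v t x)"
        using sobolev_L2_plus(3)[OF fcoef_diff(1)[OF vL vL], of 1 r t] d1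
        by (simp add: fcoef_diff(2)[OF vL vL] b_def)
      also have "\<dots> < 1" by (rule elim)
      finally have "sqrt (hnorm2 1 (\<lambda>n. b r n - b t n) / 2) < 1"
        using ennreal_less_iff[of "sqrt (hnorm2 1 (\<lambda>n. b r n - b t n) / 2)" 1] hnorm2_nonneg[OF d1] by simp
      then have "hnorm2 1 (\<lambda>n. b r n - b t n) \<le> 2" by simp
      then show ?case
        using hseq_add(2)[OF d1 b1, of t] by simp
    qed
    then show ?thesis by blast
  qed
  note local = bounded_on_compact_interval_of_local_bound[of "\<lambda>r. hnorm2 1 (b r)", OF this]
  show "fcoef (v t) = a t"
  proof -
    obtain M where M: "\<And>r. \<bar>r\<bar> \<le> \<bar>t\<bar> \<Longrightarrow> hnorm2 1 (b r) \<le> M" using local[of "\<bar>t\<bar>"] by blast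
    define R where "R = sqrt zeta2 * sqrt B"
    define H where "H = 2 * M + 2 * B"
    define c where "c = exp (2 * (4 * H + 9 * R\<^sup>2) * \<bar>t\<bar>)"
    have l1: "summable (\<lambda>k. cmod (a r k))" "(\<Sum>k. cmod (a r k)) \<le> R" for r
      using l1_of_hseq2[OF a(1)[of r]] mult_left_mono[OF real_sqrt_le_mono[OF a(2)], of "sqrt zeta2" r]
      by (auto simp: R_def zeta2_nonneg)
    have d0: "(\<lambda>n. b t n - a t n) \<in> hseq 0" by (rule hseq_diff(1)[OF hseq_weaken[OF b1] hseq_weaken[OF a1]]) auto
    have le: "hnorm2 0 (\<lambda>n. b t n - a t n) \<le> (H * c) / (real K + 1)" for K
    proof -
      have "hnorm2 0 (\<lambda>n. b t n - a t n) \<le> H / (real K + 1) * exp (2 * (4 * H + 9 * R\<^sup>2) * \<bar>t\<bar>)"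
      proof (rule stability[OF bsol a(4)])
        show "hnorm2 1 (\<lambda>n. b r n - a r n) \<le> H" if "\<bar>r\<bar> \<le> \<bar>t\<bar>" for r
          using hseq_diff(2)[OF b1 a1, of r r] M[OF that] order_trans[OF hnorm2_weaken[OF a(1), of 1 r] a(2)]
          by (simp add: H_def)
      qed (use b1 a1 l1 b0 in auto)
      then show ?thesis by (simp add: c_def)
    qed
    have "hnorm2 0 (\<lambda>n. b t n - a t n) \<le> 0"
    proof (rule LIMSEQ_le_const)
      have "(\<lambda>K. (H * c) / real (Suc K)) \<longlonglongrightarrow> 0" by (rule LIMSEQ_Suc[OF lim_const_over_n])
      then show "(\<lambda>K. (H * c) / (real K + 1)) \<longlonglongrightarrow> 0" by (simp add: add.commute)
    qed (use le in blast)
    have "b t n = a t n" for n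
    proof -
      have "(cmod (b t n - a t n))\<^sup>2 \<le> hnorm2 0 (\<lambda>n. b t n - a t n)"
        using sum_le_hnorm2[OF d0, of "{n}"] by (simp add: wsq_0)
      then have "(cmod (b t n - a t n))\<^sup>2 \<le> 0" using \<open>hnorm2 0 (\<lambda>n. b t n - a t n) \<le> 0\<close> by linarith
      then show ?thesis by simp
    qed
    then show ?thesis by (auto simp: b_def)
  qed
qed

lemma flow_H1_bound:
  assumes eps: "0 < \<epsilon>" "\<epsilon> < 1" and alpha: "\<alpha> \<le> 2"
    and \<phi>: "\<phi> \<in> sobolev_plus 1" and near: "sobolev_norm 1 (\<lambda>x. \<phi> x - fourier_mode (int m) x) \<le> ennreal \<epsilon>"
  shows "sobolev_norm 1 (nls_szego_flow \<alpha> \<epsilon> t \<phi>) \<le> ennreal (sqrt (H1_bound m))"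
proof -
  define lam where "lam = \<epsilon> powr \<alpha>"
  have phiL: "\<phi> \<in> L2_plus" using \<phi> by (simp add: sobolev_plus_def)
  define r where "r = (\<lambda>n. fcoef \<phi> n - mode m n)"
  note dL = fcoef_diff(1)[OF phiL fourier_mode_L2_plus(1), of m]
  have dr: "fcoef (\<lambda>x. \<phi> x - fourier_mode (int m) x) = r"
    unfolding r_def fcoef_diff(2)[OF phiL fourier_mode_L2_plus(1)] fourier_mode_L2_plus(2) ..
  have "(\<lambda>x. \<phi> x - fourier_mode (int m) x) \<in> sobolev 1"
  proof (rule ccontr)
    assume "(\<lambda>x. \<phi> x - fourier_mode (int m) x) \<notin> sobolev 1"
    then have "sobolev_norm 1 (\<lambda>x. \<phi> x - fourier_mode (int m) x) = \<infinity>" by (simp add: sobolev_norm_def)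
    then show False using near by (simp add: top_unique)
  qed
  then have r2: "r \<in> hseq 2" using sobolev_L2_plus(1)[OF dL, of 2] dr by simp
  have rle: "hnorm2 2 r \<le> 2 * \<epsilon>\<^sup>2"
  proof -
    have "ennreal (sqrt (hnorm2 2 r / 2)) \<le> ennreal \<epsilon>"
      using sobolev_L2_plus(3)[OF dL, of 2] dr r2 near by simp
    then have "sqrt (hnorm2 2 r / 2) \<le> \<epsilon>" using eps by (subst (asm) ennreal_le_iff) auto
    then have "(sqrt (hnorm2 2 r / 2))\<^sup>2 \<le> \<epsilon>\<^sup>2" by (rule power_mono) (simp add: hnorm2_nonneg r2)
    then show ?thesis using hnorm2_nonneg[OF r2] by simp
  qed
  have lam: "\<epsilon>\<^sup>2 \<le> lam"
  proof -
    have "\<epsilon> powr 2 \<le> \<epsilon> powr \<alpha>" using eps alpha by (intro powr_mono') auto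
    then show ?thesis using eps by (simp add: lam_def)
  qed
  have "\<exists>a. (\<forall>t k. n + m < k \<longrightarrow> a t k = 0) \<and> (\<forall>k\<le>n + m. a 0 k = mode m k + r k) \<and>
      solves_upto lam (n + m) a \<and> (\<forall>t. hnorm2 2 (a t) \<le> H1_bound m)" for n
    using Galerkin_bound[OF eps lam r2 rle, of m "n + m"] by (metis le_add2)
  from strong_solution[of m "\<lambda>k. mode m k + r k", OF this]
  obtain a where a: "\<And>t. a t \<in> hseq 2" "\<And>t. hnorm2 2 (a t) \<le> H1_bound m"
    "a 0 = (\<lambda>k. mode m k + r k)" "\<And>K. solves_upto lam K a" by metis
  have a0: "a 0 = fcoef \<phi>" by (simp add: a(3) r_def)
  define v where "v = (SOME u. is_nls_szego_solution \<alpha> \<epsilon> \<phi> u)"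
  have "is_nls_szego_solution \<alpha> \<epsilon> \<phi> v"
    unfolding v_def by (rule someI_ex[OF existence_of_flow[OF phiL a(1,2) a0 a(4)[unfolded lam_def]]])
  from uniqueness_of_flow[OF phiL this a(1,2) a0 a(4)[unfolded lam_def], of t]
  have v: "v t \<in> L2_plus" "fcoef (v t) = a t" .
  have "sobolev_norm 1 (v t) \<le> ennreal (sqrt (hnorm2 2 (a t)))"
    using sobolev_L2_plus(2)[OF v(1), of 2] v(2) a(1) by simp
  also have "\<dots> \<le> ennreal (sqrt (H1_bound m))"
    by (intro ennreal_leI real_sqrt_le_mono a(2))
  finally show ?thesis by (simp add: nls_szego_flow_def v_def)
qed

theorem corollary1p6:
  fixes m :: nat
  shows "(SUP (\<epsilon>, \<alpha>) \<in> {0<..<1::real} \<times> {0..2::real}.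
            SUP \<phi> \<in> {\<phi> \<in> sobolev_plus 1.
                        sobolev_norm 1 (\<lambda>x. \<phi> x - fourier_mode (int m) x) \<le> ennreal \<epsilon>}.
              SUP t :: real. sobolev_norm 1 (nls_szego_flow \<alpha> \<epsilon> t \<phi>)) < \<infinity>"
proof -
  have "(SUP (\<epsilon>, \<alpha>) \<in> {0<..<1::real} \<times> {0..2::real}.
            SUP \<phi> \<in> {\<phi> \<in> sobolev_plus 1.
                        sobolev_norm 1 (\<lambda>x. \<phi> x - fourier_mode (int m) x) \<le> ennreal \<epsilon>}.
              SUP t :: real. sobolev_norm 1 (nls_szego_flow \<alpha> \<epsilon> t \<phi>)) \<le> ennreal (sqrt (H1_bound m))"
    by (auto intro!: SUP_least flow_H1_bound)
  also have "\<dots> < \<infinity>" by simp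
  finally show ?thesis .
qed

end
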